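(* In the setting below, let $1\le r<R$ and $1\le k\le M_r$, and assume $S^r_k\ne S_i$ for every $1\le i\le M$ (i.e. $S^r_k$ contains more than one set $S_i$). Let $\tau^{r,\varepsilon}_k$ be a positive function with $\tau^{r,\varepsilon}_k\sim\sum_{i:S_i\subseteq S^r_k}\tau^\varepsilon_i\,\mathbb E(N^\varepsilon(x,i,r))$ uniformly in $x\in S^r_k$. Then for each $t\ge0$ and each $1\le l\le M_r$ with $P^{r,\varepsilon}_{kl}\not\equiv0$, $$\lim_{\varepsilon\downarrow0}\mathbb P\Big(\frac{T^{r,\varepsilon}(x,S^r_l)}{\tau^{r,\varepsilon}_k}\ge t\Big)=e^{-t}$$ uniformly in $x\in S^r_k$.
   Context: Setting: a Markov renewal process on a metric space $S=S_1\cup\dots\cup S_M$ (disjoint Borel sets), embedded chain $(\mathbf X^{x,\varepsilon}_n,\mathbf T^{x,\varepsilon}_n)$ started at $(x,0)$ with transition kernels $Q^\varepsilon(y,\cdot)$ on $S\times[0,\infty)$ depending only on the spatial state; $P^\varepsilon(x,B)=Q^\varepsilon(x,B\times[0,\infty))$; $T^\varepsilon(x,B)$ has law $Q^\varepsilon(x,B\times\cdot)/P^\varepsilon(x,B)$. It satisfies: (a) $P^\varepsilon(x,S_i)=0$ for $x\in S_i$; for $i\ne j$, $P^\varepsilon(x,S_j)$ is $0$ for all $x\in S_i,\varepsilon$ ($P^\varepsilon_{ij}:\equiv0$) or positive with positive $P^\varepsilon_{ij}$, $P^\varepsilon(x,S_j)/P^\varepsilon_{ij}\to1$ uniformly in $x\in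 S_i$, $\sum_jP^\varepsilon_{ij}=1$, indices communicate through positive $P^\varepsilon$; (b) positive $\tau^\varepsilon_i$ with $\mathbb ET^\varepsilon(x,S_j)/\tau^\varepsilon_i\to1$ uniformly in $x\in S_i$ when $P^\varepsilon_{ij}\not\equiv0$; (c) $\mathrm{Var}\,T^\varepsilon(x,S_j)\le C(\tau^\varepsilon_i)^2$ for $\varepsilon\le\varepsilon_0$; (d) for bounded continuous $f$, $\mathbb Ef(T^\varepsilon(x_1,S_{j_1})/\tau^\varepsilon_i)-\mathbb Ef(T^\varepsilon(x_2,S_{j_2})/\tau^\varepsilon_i)\to0$ uniformly in $x_1,x_2\in S_i$ ($P^\varepsilon_{ij_1},P^\varepsilon_{ij_2}\not\equiv0$); (e) distributional limits of $T^{\varepsilon_n}(x_n,S_j)/\tau^{\varepsilon_n}_i$ ($x_n\in S_i$, $\varepsilon_n\downarrow0$) have no atoms; (f) $\lim_{\varepsilon\downarrow0}\prod_{k=1}^n\frac{P^\varepsilon_{a_kb_k}}{P^\varepsilon_{a_kd_k}}\frac{\tau^\varepsilon_a}{\tau^\varepsilon_c}\in[0,\infty]$ whenever defined. Hierarchy: $S^0_i=S_i$, $M_0=M$, $P^{0,\varepsilon}=P^\varepsilon$; $\pi^r$ maps a point or subset to its rank-$r$ cluster; $\theta_0^{x,\varepsilon}(r)=0$, $\theta_n^{x,\varepsilon}(r)=\min\{m>\theta_{n-1}(r):\pi^r(\mathbf X_m)\ne\pi^r(\mathbf X_{\theta_{n-1}(r)})\}$; if $M_r>1$, partition $\{1,\dots,M_r\}$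 into ergodic classes of $P^{r,0}_{ij}=\lim P^{r,\varepsilon}_{ij}$ and transient singletons $E_1,\dots,E_{M_{r+1}}$; $S^{r+1}_k=\bigcup_{i\in E_k}S^r_i$; $\lambda^r_k$ the invariant probability on $E_k$ (unit mass for a transient singleton); $P^{r+1,\varepsilon}_{kl}=\sum_{i\in E_k,\,S^r_j\subseteq S^{r+1}_l}\lambda^r_k(i)P^{r,\varepsilon}_{ij}\big/\sum_{i\in E_k,\,S^r_j\not\subseteq S^{r+1}_k}\lambda^r_k(i)P^{r,\varepsilon}_{ij}$; $R$ is the first rank with $M_R=1$. For $0\le r<R$: $\mathbf X^{x,r,\varepsilon}_n=\mathbf X^{x,\varepsilon}_{\theta_n(r)}$, $\mathbf T^{x,r,\varepsilon}_n=\sum_{m=\theta_{n-1}(r)+1}^{\theta_n(r)}\mathbf T^{x,\varepsilon}_m$ ($n\ge1$); $T^{r,\varepsilon}(x,S^r_j)$ has the law of $\mathbf T^{x,r,\varepsilon}_1$ conditioned on $\mathbf X^{x,r,\varepsilon}_1\in S^r_j$. $N^\varepsilon(x,i,r)=\sum_{n=0}^{\theta^{x,\varepsilon}_1(r)}\chi_{S_i}(\mathbf X^{x,\varepsilon}_n)$ for $x\in\pi^r(S_i)$. *)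

theory Defs
  imports "HOL-Probability.Probability"
begin

text \<open>Kernel family: Q eps y is the joint law of (next state, sojourn time) from state y,
 a probability measure on 'a x real (Borel sets).  Indices of the sets S_i range over 1..M.\<close>

type_synonym 'a kernels = "real \<Rightarrow> 'a \<Rightarrow> ('a \<times> real) measure"

definition Pk :: "'a::metric_space kernels \<Rightarrow> real \<Rightarrow> 'a \<Rightarrow> 'a set \<Rightarrow> real" where
  "Pk Q eps x B = measure (Q eps x) (B \<times> UNIV)"

text \<open>Mean of T^eps(x,B) (law of the time component conditioned on landing in B).\<close>
definition ET :: "'a::metric_space kernels \<Rightarrow> real \<Rightarrow> 'a \<Rightarrow> 'a set \<Rightarrow> real" where
  "ET Q eps x B =
     enn2real (\<integral>\<^sup>+ z. indicator (B \<times> UNIV) z * ennreal (snd z) \<partial>Q eps x) / Pk Q eps x B"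

text \<open>Variance of T^eps(x,B) (in ennreal, so that an infinite variance is infinite).\<close>
definition VarT :: "'a::metric_space kernels \<Rightarrow> real \<Rightarrow> 'a \<Rightarrow> 'a set \<Rightarrow> ennreal" where
  "VarT Q eps x B =
     (\<integral>\<^sup>+ z. indicator (B \<times> UNIV) z * ennreal ((snd z - ET Q eps x B)\<^sup>2) \<partial>Q eps x)
       / ennreal (Pk Q eps x B)"

definition Ef :: "'a::metric_space kernels \<Rightarrow> real \<Rightarrow> 'a \<Rightarrow> 'a set \<Rightarrow> real \<Rightarrow> (real \<Rightarrow> real) \<Rightarrow> real" where
  "Ef Q eps x B c f =
     (\<integral> z. indicator (B \<times> UNIV) z * f (snd z / c) \<partial>Q eps x) / Pk Q eps x B"

definition Tlaw :: "'a::metric_space kernels \<Rightarrow> real \<Rightarrow> 'a \<Rightarrow> 'a set \<Rightarrow> real \<Rightarrow> real measure" where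
  "Tlaw Q eps x B c =
     distr (density (Q eps x) (\<lambda>z. indicator (B \<times> UNIV) z / ennreal (Pk Q eps x B)))
       borel (\<lambda>z. snd z / c)"

definition not_ident_zero :: "(real \<Rightarrow> real) \<Rightarrow> bool" where
  "not_ident_zero f \<longleftrightarrow> (\<exists>eps>0. f eps \<noteq> 0)"

definition unif_tendsto :: "(real \<Rightarrow> 'b \<Rightarrow> real) \<Rightarrow> real \<Rightarrow> 'b set \<Rightarrow> bool" where
  "unif_tendsto F L A \<longleftrightarrow>
     (\<forall>\<delta>>0. eventually (\<lambda>eps. \<forall>x\<in>A. \<bar>F eps x - L\<bar> < \<delta>) (at_right 0))"

definition base_ok :: "('a::metric_space) kernels \<Rightarrow> (nat \<Rightarrow> 'a set) \<Rightarrow> nat \<Rightarrow> bool" where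
  "base_ok Q S M \<longleftrightarrow>
     (\<forall>i\<in>{1..M}. S i \<in> sets borel) \<and>
     (\<forall>i\<in>{1..M}. \<forall>j\<in>{1..M}. i \<noteq> j \<longrightarrow> S i \<inter> S j = {}) \<and>
     (\<Union>i\<in>{1..M}. S i) = UNIV \<and>
     (\<forall>eps>0. Q eps \<in> borel \<rightarrow>\<^sub>M prob_algebra (borel \<Otimes>\<^sub>M borel)) \<and>
     (\<forall>eps>0. \<forall>x. emeasure (Q eps x) (UNIV \<times> {..<0}) = 0)"

definition cond_a :: "'a::metric_space kernels \<Rightarrow> (nat \<Rightarrow> 'a set) \<Rightarrow> nat \<Rightarrow> (real \<Rightarrow> nat \<Rightarrow> nat \<Rightarrow> real) \<Rightarrow> bool" where
  "cond_a Q S M p \<longleftrightarrow>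
     (\<forall>eps>0. \<forall>i\<in>{1..M}. \<forall>x\<in>S i. Pk Q eps x (S i) = 0) \<and>
     (\<forall>eps>0. \<forall>i\<in>{1..M}. p eps i i = 0) \<and>
     (\<forall>i\<in>{1..M}. \<forall>j\<in>{1..M}. i \<noteq> j \<longrightarrow>
        ((\<forall>eps>0. p eps i j = 0 \<and> (\<forall>x\<in>S i. Pk Q eps x (S j) = 0)) \<or>
         ((\<forall>eps>0. p eps i j > 0 \<and> (\<forall>x\<in>S i. Pk Q eps x (S j) > 0)) \<and>
          unif_tendsto (\<lambda>eps x. Pk Q eps x (S j) / p eps i j) 1 (S i)))) \<and>
     (\<forall>eps>0. \<forall>i\<in>{1..M}. (\<Sum>j\<in>{1..M}. p eps i j) = 1) \<and>
     (\<forall>i\<in>{1..M}. \<forall>j\<in>{1..M}. i \<noteq> j \<longrightarrow>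
        (i, j) \<in> {(a, b). a \<in> {1..M} \<and> b \<in> {1..M} \<and> not_ident_zero (\<lambda>eps. p eps a b)}\<^sup>+)"

definition cond_b :: "'a::metric_space kernels \<Rightarrow> (nat \<Rightarrow> 'a set) \<Rightarrow> nat \<Rightarrow> (real \<Rightarrow> nat \<Rightarrow> nat \<Rightarrow> real)
     \<Rightarrow> (real \<Rightarrow> nat \<Rightarrow> real) \<Rightarrow> bool" where
  "cond_b Q S M p tau \<longleftrightarrow>
     (\<forall>eps>0. \<forall>i\<in>{1..M}. tau eps i > 0) \<and>
     (\<forall>i\<in>{1..M}. \<forall>j\<in>{1..M}. not_ident_zero (\<lambda>eps. p eps i j) \<longrightarrow>
        unif_tendsto (\<lambda>eps x. ET Q eps x (S j) / tau eps i) 1 (S i))"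

definition cond_c :: "'a::metric_space kernels \<Rightarrow> (nat \<Rightarrow> 'a set) \<Rightarrow> nat \<Rightarrow> (real \<Rightarrow> nat \<Rightarrow> nat \<Rightarrow> real)
     \<Rightarrow> (real \<Rightarrow> nat \<Rightarrow> real) \<Rightarrow> bool" where
  "cond_c Q S M p tau \<longleftrightarrow>
     (\<exists>C eps0. eps0 > 0 \<and> (\<forall>eps. 0 < eps \<and> eps \<le> eps0 \<longrightarrow>
        (\<forall>i\<in>{1..M}. \<forall>j\<in>{1..M}. not_ident_zero (\<lambda>e. p e i j) \<longrightarrow>
          (\<forall>x\<in>S i. VarT Q eps x (S j) \<le> ennreal (C * (tau eps i)\<^sup>2)))))"

definition cond_d :: "'a::metric_space kernels \<Rightarrow> (nat \<Rightarrow> 'a set) \<Rightarrow> nat \<Rightarrow> (real \<Rightarrow> nat \<Rightarrow> nat \<Rightarrow> real)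
     \<Rightarrow> (real \<Rightarrow> nat \<Rightarrow> real) \<Rightarrow> bool" where
  "cond_d Q S M p tau \<longleftrightarrow>
     (\<forall>f::real \<Rightarrow> real. continuous_on UNIV f \<longrightarrow> bounded (range f) \<longrightarrow>
       (\<forall>i\<in>{1..M}. \<forall>j1\<in>{1..M}. \<forall>j2\<in>{1..M}.
          not_ident_zero (\<lambda>e. p e i j1) \<longrightarrow> not_ident_zero (\<lambda>e. p e i j2) \<longrightarrow>
          unif_tendsto (\<lambda>eps (x1, x2). Ef Q eps x1 (S j1) (tau eps i) f - Ef Q eps x2 (S j2) (tau eps i) f)
             0 (S i \<times> S i)))"

definition cond_e :: "'a::metric_space kernels \<Rightarrow> (nat \<Rightarrow> 'a set) \<Rightarrow> nat \<Rightarrow> (real \<Rightarrow> nat \<Rightarrow> nat \<Rightarrow> real)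
     \<Rightarrow> (real \<Rightarrow> nat \<Rightarrow> real) \<Rightarrow> bool" where
  "cond_e Q S M p tau \<longleftrightarrow>
     (\<forall>i\<in>{1..M}. \<forall>j\<in>{1..M}. not_ident_zero (\<lambda>e. p e i j) \<longrightarrow>
       (\<forall>(es :: nat \<Rightarrow> real) (xs :: nat \<Rightarrow> 'a) (\<mu> :: real measure).
          (\<forall>n. es n > 0) \<longrightarrow> decseq es \<longrightarrow> es \<longlonglongrightarrow> 0 \<longrightarrow> (\<forall>n. xs n \<in> S i) \<longrightarrow>
          real_distribution \<mu> \<longrightarrow>
          weak_conv_m (\<lambda>n. Tlaw Q (es n) (xs n) (S j) (tau (es n) i)) \<mu> \<longrightarrow>
          (\<forall>a. measure \<mu> {a} = 0)))"

definition cond_f :: "nat \<Rightarrow> (real \<Rightarrow> nat \<Rightarrow> nat \<Rightarrow> real) \<Rightarrow> (real \<Rightarrow> nat \<Rightarrow> real) \<Rightarrow> bool" where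
  "cond_f M p tau \<longleftrightarrow>
     (\<forall>a\<in>{1..M}. \<forall>c\<in>{1..M}. \<forall>trs :: (nat \<times> nat \<times> nat) list.
        (\<forall>(ak, bk, dk)\<in>set trs. ak \<in> {1..M} \<and> bk \<in> {1..M} \<and> dk \<in> {1..M}
            \<and> not_ident_zero (\<lambda>e. p e ak dk)) \<longrightarrow>
        (\<exists>L::ereal. ((\<lambda>eps. ereal ((\<Prod>(ak, bk, dk)\<leftarrow>trs. p eps ak bk / p eps ak dk)
                                   * (tau eps a / tau eps c))) \<longlongrightarrow> L) (at_right 0)
                  \<and> L \<ge> 0))"

definition lim0 :: "(real \<Rightarrow> real) \<Rightarrow> real" where
  "lim0 f = Lim (at_right 0) f"

definition reach :: "nat \<Rightarrow> (nat \<Rightarrow> nat \<Rightarrow> real) \<Rightarrow> nat \<Rightarrow> nat \<Rightarrow> bool" where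
  "reach Mr P0 i j \<longleftrightarrow> (i, j) \<in> {(a, b). a \<in> {1..Mr} \<and> b \<in> {1..Mr} \<and> P0 a b > 0}\<^sup>*"

definition recurrent :: "nat \<Rightarrow> (nat \<Rightarrow> nat \<Rightarrow> real) \<Rightarrow> nat \<Rightarrow> bool" where
  "recurrent Mr P0 i \<longleftrightarrow> (\<forall>j. reach Mr P0 i j \<longrightarrow> reach Mr P0 j i)"

definition comm_class :: "nat \<Rightarrow> (nat \<Rightarrow> nat \<Rightarrow> real) \<Rightarrow> nat \<Rightarrow> nat set" where
  "comm_class Mr P0 i = {j \<in> {1..Mr}. reach Mr P0 i j \<and> reach Mr P0 j i}"

definition blocks :: "nat \<Rightarrow> (nat \<Rightarrow> nat \<Rightarrow> real) \<Rightarrow> nat set set" where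
  "blocks Mr P0 =
     {comm_class Mr P0 i | i. i \<in> {1..Mr} \<and> recurrent Mr P0 i} \<union>
     {{i} | i. i \<in> {1..Mr} \<and> \<not> recurrent Mr P0 i}"

definition hier_step ::
  "nat \<Rightarrow> (real \<Rightarrow> nat \<Rightarrow> nat \<Rightarrow> real) \<Rightarrow> nat \<Rightarrow> (nat \<Rightarrow> nat set) \<Rightarrow> (nat \<Rightarrow> nat \<Rightarrow> real)
     \<Rightarrow> (real \<Rightarrow> nat \<Rightarrow> nat \<Rightarrow> real) \<Rightarrow> bool" where
  "hier_step Mr Pr Mr' E lam Pr' \<longleftrightarrow>
    (let P0 = (\<lambda>i j. lim0 (\<lambda>eps. Pr eps i j)) in
     bij_betw E {1..Mr'} (blocks Mr P0) \<and>
     (\<forall>k\<in>{1..Mr'}.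
        (if (\<exists>i\<in>E k. recurrent Mr P0 i) then
           (\<forall>i. lam k i \<ge> 0) \<and> (\<forall>i. i \<notin> E k \<longrightarrow> lam k i = 0) \<and>
           (\<Sum>i\<in>E k. lam k i) = 1 \<and>
           (\<forall>j\<in>E k. (\<Sum>i\<in>E k. lam k i * P0 i j) = lam k j)
         else (\<forall>i. lam k i = (if i \<in> E k then 1 else 0)))) \<and>
     (\<forall>eps>0. \<forall>k\<in>{1..Mr'}. \<forall>l\<in>{1..Mr'}.
        Pr' eps k l =
          (if k = l then 0 else
             (\<Sum>i\<in>E k. \<Sum>j\<in>E l. lam k i * Pr eps i j) /
             (\<Sum>i\<in>E k. \<Sum>j\<in>{1..Mr} - E k. lam k i * Pr eps i j))))"

text \<open>Whole hierarchy: Mh r = M_r, Ph r = P^{r,.}, Eh r k = E_k at rank r (subset of {1..M_r}),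
  lamh r k = lambda^r_k; R is the first rank with M_R = 1.\<close>
definition hierarchy ::
  "nat \<Rightarrow> (real \<Rightarrow> nat \<Rightarrow> nat \<Rightarrow> real) \<Rightarrow> (nat \<Rightarrow> nat) \<Rightarrow> (nat \<Rightarrow> real \<Rightarrow> nat \<Rightarrow> nat \<Rightarrow> real)
     \<Rightarrow> (nat \<Rightarrow> nat \<Rightarrow> nat set) \<Rightarrow> (nat \<Rightarrow> nat \<Rightarrow> nat \<Rightarrow> real) \<Rightarrow> nat \<Rightarrow> bool" where
  "hierarchy M p Mh Ph Eh lamh R \<longleftrightarrow>
     Mh 0 = M \<and> Ph 0 = p \<and> Mh R = 1 \<and> (\<forall>r<R. Mh r > 1) \<and>
     (\<forall>r<R. hier_step (Mh r) (Ph r) (Mh (Suc r)) (Eh r) (lamh r) (Ph (Suc r)))"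

primrec cl :: "(nat \<Rightarrow> nat \<Rightarrow> nat set) \<Rightarrow> nat \<Rightarrow> nat \<Rightarrow> nat set" where
  "cl Eh 0 k = {k}"
| "cl Eh (Suc r) k = (\<Union>i\<in>Eh r k. cl Eh r i)"

definition Sr :: "(nat \<Rightarrow> 'a set) \<Rightarrow> (nat \<Rightarrow> nat \<Rightarrow> nat set) \<Rightarrow> nat \<Rightarrow> nat \<Rightarrow> 'a set" where
  "Sr S Eh r k = (\<Union>i\<in>cl Eh r k. S i)"

definition step_kernel :: "('a::metric_space \<Rightarrow> ('a \<times> real) measure) \<Rightarrow> 'a \<times> real \<Rightarrow> ('a \<times> real) measure" where
  "step_kernel K = (\<lambda>(y, s). distr (K y) (borel \<Otimes>\<^sub>M borel) (\<lambda>(y', t). (y', s + t)))"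

text \<open>stay_meas K x C n: the (sub-probability) joint law of (X_n, T_1 + ... + T_n) restricted to
  the event that X_1, ..., X_n all lie in C (chain started at (x, 0)).\<close>
primrec stay_meas :: "('a::metric_space \<Rightarrow> ('a \<times> real) measure) \<Rightarrow> 'a \<Rightarrow> 'a set \<Rightarrow> nat \<Rightarrow> ('a \<times> real) measure" where
  "stay_meas K x C 0 = return (borel \<Otimes>\<^sub>M borel) (x, 0)"
| "stay_meas K x C (Suc n) = density (stay_meas K x C n \<bind> step_kernel K) (indicator (C \<times> UNIV))"

text \<open>P((X_theta, T_1 + ... + T_theta) \<in> A) where theta is the first exit time from C.\<close>
definition exit_prob :: "('a::metric_space \<Rightarrow> ('a \<times> real) measure) \<Rightarrow> 'a \<Rightarrow> 'a set \<Rightarrow> ('a \<times> real) set \<Rightarrow> real" where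
  "exit_prob K x C A = enn2real (\<Sum>n. emeasure (stay_meas K x C n \<bind> step_kernel K) (A \<inter> ((- C) \<times> UNIV)))"

text \<open>E N(x, i, r) when C is the rank-r cluster of x and B = S_i.\<close>
definition expected_visits :: "('a::metric_space \<Rightarrow> ('a \<times> real) measure) \<Rightarrow> 'a \<Rightarrow> 'a set \<Rightarrow> 'a set \<Rightarrow> ennreal" where
  "expected_visits K x C B = (\<Sum>n. emeasure (stay_meas K x C n) (B \<times> UNIV))"

text \<open>P(T^{r,eps}(x, D) / c \<ge> t) where C is the cluster of x and D the target cluster.\<close>
definition exit_time_tail :: "('a::metric_space \<Rightarrow> ('a \<times> real) measure) \<Rightarrow> 'a \<Rightarrow> 'a set \<Rightarrow> 'a set \<Rightarrow> real \<Rightarrow> real \<Rightarrow> real" where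
  "exit_time_tail K x C D c t = exit_prob K x C (D \<times> {s. s / c \<ge> t}) / exit_prob K x C (D \<times> UNIV)"

end

theory Submission
  imports Defs
begin

text \<open>
  Let \<open>C\<close> be the cluster, \<open>D\<close> the target cluster and \<open>T\<close> the exit time divided by \<open>tauk\<close>. The
  probability \<open>h\<close> of leaving \<open>C\<close> through \<open>D\<close> and the expected exit time \<open>m\<close> are asymptotically
  independent of the starting point in \<open>C\<close>, and every \<open>S\<^sub>i\<close> in \<open>C\<close> is visited so often that a single
  sojourn is negligible against \<open>tauk\<close>. For \<open>m\<close> this is the hypothesis on \<open>tauk\<close>; for \<open>h\<close> and the
  visits it is an induction on the rank: the numbers of entries into the clusters of the previous
  rank form an almost invariant vector of the limiting chain on an ergodic class, and hence are
  asymptotically proportional to its stationary law. Summing the one-step equations of \<open>h\<close> and \<open>m\<close>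
  along the path with the weight \<open>exp (- \<theta> t / tauk)\<close> yields two linear relations which force the
  Laplace transform of \<open>T\<close>, given exit through \<open>D\<close>, to converge to \<open>1 / (1 + \<theta>)\<close>. At integer \<open>\<theta>\<close>
  these are the moments of \<open>exp (- T)\<close>, so \<open>exp (- T)\<close> becomes uniform on the unit interval.
\<close>

section \<open>Weighted transition operators and their potentials\<close>

text \<open>The obstacle is that nothing is assumed about the dynamics inside a set
  \<open>S i\<close>, so no invariant measure on the space is at hand; every estimate is a two-sided
  bound uniform over the starting points of a cluster, and such uniformity plays the part of lack of
  memory. Put \<open>w t = exp (- \<theta> * t / tauk)\<close>. Let \<open>l\<close> be the
  discounted exit probability through \<open>D\<close> divided by \<open>h\<close>, let
  \<open>J\<close> be the discounted sum of the mean sojourns divided by \<open>tauk\<close>, and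
  let \<open>B\<close> be the discounted sum of the losses \<open>1 - w\<close> over the steps that
  stay in \<open>C\<close>. Replacing \<open>h\<close> and \<open>m\<close> after a step by
  constants turns their one-step equations into \<open>1 = l + B\<close> and
  \<open>1 = J + B\<close> up to small errors; since a single sojourn is negligible,
  \<open>1 - w\<close> may be linearised, which gives \<open>B = \<theta> * J\<close>. Hence
  \<open>l = J = 1 / (1 + \<theta>)\<close>. Cancelling in \<open>ennreal\<close> needs finite
  potentials. Their finiteness is read off from the hypothesis on \<open>tauk\<close> for the top
  cluster and inherited by all clusters inside it, which is why it enters the induction as an
  assumption.\<close>

definition kop :: "('a::metric_space \<Rightarrow> ('a \<times> real) measure) \<Rightarrow> 'a set \<Rightarrow> (real \<Rightarrow> ennreal)
    \<Rightarrow> ('a \<Rightarrow> ennreal) \<Rightarrow> 'a \<Rightarrow> ennreal" where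
  "kop K C w f y = (\<integral>\<^sup>+ z. indicator C (fst z) * (w (snd z) * f (fst z)) \<partial>K y)"

text \<open>The Green operator of the chain killed on leaving \<open>C\<close>: the expected sum of
  \<open>f\<close> along the path before exit, discounted by the product of the weights. The term
  \<open>n = 0\<close> contributes \<open>f y\<close> whether or not \<open>y\<close> lies in
  \<open>C\<close>.\<close>

definition pot :: "('a::metric_space \<Rightarrow> ('a \<times> real) measure) \<Rightarrow> 'a set \<Rightarrow> (real \<Rightarrow> ennreal)
    \<Rightarrow> ('a \<Rightarrow> ennreal) \<Rightarrow> 'a \<Rightarrow> ennreal" where
  "pot K C w f y = (\<Sum>n. (kop K C w ^^ n) f y)"

abbreviation one :: "'b \<Rightarrow> ennreal" where
  "one \<equiv> (\<lambda>_. 1)"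

locale renewal_kernel =
  fixes K :: "'a::metric_space \<Rightarrow> ('a \<times> real) measure"
  assumes kernel: "K \<in> borel \<rightarrow>\<^sub>M prob_algebra (borel \<Otimes>\<^sub>M borel)"
    and time_nonneg: "\<And>x. emeasure (K x) (UNIV \<times> {..<0}) = 0"
begin

lemma kernel_subprob[measurable]: "K \<in> borel \<rightarrow>\<^sub>M subprob_algebra (borel \<Otimes>\<^sub>M borel)"
  using kernel by (rule measurable_prob_algebraD)

lemma sets_kernel[simp, measurable_cong]: "sets (K x) = sets (borel \<Otimes>\<^sub>M borel)"
  using kernel_subprob by (rule sets_kernel) simp

lemma space_kernel[simp]: "space (K x) = UNIV"
  using sets_eq_imp_space_eq[OF sets_kernel[of x]] by (simp add: space_pair_measure)

lemma prob_space_kernel: "prob_space (K x)"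
  using measurable_space[OF kernel, of x] by (simp add: space_prob_algebra)

lemma AE_time_nonneg: "AE z in K x. 0 \<le> snd z"
proof -
  have "{z \<in> space (K x). \<not> 0 \<le> snd z} = UNIV \<times> {..<0}" by auto
  then show ?thesis
    by (subst AE_iff_measurable[OF _ refl]) (auto simp: time_nonneg)
qed

lemma kop_measurable[measurable]:
  assumes [measurable]: "C \<in> sets borel" "w \<in> borel_measurable borel" "f \<in> borel_measurable borel"
  shows "kop K C w f \<in> borel_measurable borel"
  unfolding kop_def
  by (rule nn_integral_measurable_subprob_algebra2[where N="borel \<Otimes>\<^sub>M borel"]) measurable

lemma kop_pow_measurable[measurable]:
  assumes [measurable]: "C \<in> sets borel" "w \<in> borel_measurable borel" "f \<in> borel_measurable borel"
  shows "(kop K C w ^^ n) f \<in> borel_measurable borel"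
  by (induction n) (auto intro!: kop_measurable assms)

lemma pot_measurable[measurable]:
  assumes [measurable]: "C \<in> sets borel" "w \<in> borel_measurable borel" "f \<in> borel_measurable borel"
  shows "pot K C w f \<in> borel_measurable borel"
  unfolding pot_def by measurable

text \<open>Sojourns are almost surely nonnegative, so weights need only be compared at nonnegative
  times. This matters for bounds such as \<open>exp (- z) \<le> 1\<close>, which fail for negative
  \<open>z\<close>.\<close>

lemma kop_mono:
  assumes "\<And>y. y \<in> C \<Longrightarrow> y \<in> C' \<and> f y \<le> g y" "\<And>t. 0 \<le> t \<Longrightarrow> w t \<le> w' t"
  shows "kop K C w f x \<le> kop K C' w' g x"
  unfolding kop_def
proof (rule nn_integral_mono_AE)
  show "AE z in K x. indicator C (fst z) * (w (snd z) * f (fst z))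
      \<le> indicator C' (fst z) * (w' (snd z) * g (fst z))"
    using AE_time_nonneg[of x]
    by eventually_elim (use assms in \<open>auto simp: indicator_def intro!: mult_mono\<close>)
qed

lemma kop_add:
  assumes [measurable]: "C \<in> sets borel" "w \<in> borel_measurable borel"
    "f \<in> borel_measurable borel" "g \<in> borel_measurable borel"
  shows "kop K C w (\<lambda>y. f y + g y) x = kop K C w f x + kop K C w g x"
  unfolding kop_def by (subst nn_integral_add[symmetric]) (auto simp: distrib_left)

lemma kop_cmult:
  assumes [measurable]: "C \<in> sets borel" "w \<in> borel_measurable borel" "f \<in> borel_measurable borel"
  shows "kop K C w (\<lambda>y. a * f y) x = a * kop K C w f x"
  unfolding kop_def by (subst nn_integral_cmult[symmetric]) (auto simp: ac_simps)

lemma kop_cmult_weight: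
  assumes [measurable]: "C \<in> sets borel" "w \<in> borel_measurable borel" "f \<in> borel_measurable borel"
  shows "kop K C (\<lambda>t. a * w t) f x = a * kop K C w f x"
  unfolding kop_def by (subst nn_integral_cmult[symmetric]) (auto simp: ac_simps)

lemma kop_add_weight:
  assumes [measurable]: "C \<in> sets borel" "w \<in> borel_measurable borel" "w' \<in> borel_measurable borel"
    "f \<in> borel_measurable borel"
  shows "kop K C (\<lambda>t. w t + w' t) f x = kop K C w f x + kop K C w' f x"
  unfolding kop_def by (subst nn_integral_add[symmetric]) (auto simp: distrib_left distrib_right)

lemma kop_UN:
  assumes fin: "finite I" and dis: "disjoint_family_on A I"
    and [measurable]: "\<And>i. i \<in> I \<Longrightarrow> A i \<in> sets borel" "w \<in> borel_measurable borel"
    "f \<in> borel_measurable borel"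
  shows "kop K (\<Union>i\<in>I. A i) w f x = (\<Sum>i\<in>I. kop K (A i) w f x)"
  unfolding kop_def
proof (subst nn_integral_sum[symmetric])
  show "(\<integral>\<^sup>+ z. indicator (\<Union>i\<in>I. A i) (fst z) * (w (snd z) * f (fst z)) \<partial>K x)
    = (\<integral>\<^sup>+ z. (\<Sum>i\<in>I. indicator (A i) (fst z) * (w (snd z) * f (fst z))) \<partial>K x)"
    by (intro nn_integral_cong) (simp add: sum_distrib_right indicator_UN_disjoint[OF fin dis])
qed simp

lemma kop_Un:
  assumes "A \<inter> B = {}" and [measurable]: "A \<in> sets borel" "B \<in> sets borel"
    "w \<in> borel_measurable borel" "f \<in> borel_measurable borel"
  shows "kop K (A \<union> B) w f x = kop K A w f x + kop K B w f x"
  unfolding kop_def using assms(1)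
  by (subst nn_integral_add[symmetric]) (auto intro!: nn_integral_cong simp: indicator_def)

lemma kop_one: "C \<in> sets borel \<Longrightarrow> kop K C one one x = emeasure (K x) (C \<times> UNIV)"
proof -
  assume [measurable]: "C \<in> sets borel"
  have "kop K C one one x = (\<integral>\<^sup>+ z. indicator (C \<times> UNIV) z \<partial>K x)"
    unfolding kop_def by (intro nn_integral_cong) (auto simp: indicator_def split: prod.splits)
  then show ?thesis by simp
qed

lemma kop_UNIV_one: "kop K UNIV one one x = 1"
  using prob_space.emeasure_space_1[OF prob_space_kernel[of x]] by (simp add: kop_def)

lemma kop_le_one: "kop K C one one x \<le> 1"
  using kop_mono[of C UNIV one one one one x] by (simp add: kop_UNIV_one)

lemma kop_suminf:
  assumes [measurable]: "C \<in> sets borel" "w \<in> borel_measurable borel"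
    "\<And>n. f n \<in> borel_measurable borel"
  shows "kop K C w (\<lambda>y. \<Sum>n::nat. f n y) x = (\<Sum>n. kop K C w (f n) x)"
  unfolding kop_def by (subst nn_integral_suminf[symmetric]) auto

lemma pot_unfold:
  assumes [measurable]: "C \<in> sets borel" "w \<in> borel_measurable borel" "f \<in> borel_measurable borel"
  shows "pot K C w f x = f x + kop K C w (pot K C w f) x"
proof -
  have "pot K C w f x = (kop K C w ^^ 0) f x + (\<Sum>n. (kop K C w ^^ Suc n) f x)"
    unfolding pot_def
    by (subst suminf_offset[where i=1]) (auto intro: summableI simp: add.commute)
  also have "(\<Sum>n. (kop K C w ^^ Suc n) f x) = kop K C w (pot K C w f) x"
    unfolding pot_def by (subst kop_suminf) auto
  finally show ?thesis by simp
qed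

lemma pot_unfold_right:
  "pot K C w f x = f x + pot K C w (kop K C w f) x"
  unfolding pot_def
  by (subst suminf_offset[where i=1])
     (auto intro: summableI simp: funpow_Suc_right add.commute simp del: funpow.simps)

lemma kop_pow_add:
  assumes [measurable]: "C \<in> sets borel" "w \<in> borel_measurable borel"
    "f \<in> borel_measurable borel" "g \<in> borel_measurable borel"
  shows "(kop K C w ^^ n) (\<lambda>y. f y + g y) = (\<lambda>y. (kop K C w ^^ n) f y + (kop K C w ^^ n) g y)"
  by (induction n) (auto simp: kop_add)

lemma kop_pow_cmult:
  assumes [measurable]: "C \<in> sets borel" "w \<in> borel_measurable borel" "f \<in> borel_measurable borel"
  shows "(kop K C w ^^ n) (\<lambda>y. a * f y) = (\<lambda>y. a * (kop K C w ^^ n) f y)"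
  by (induction n) (auto simp: kop_cmult)

lemma kop_pow_mono:
  assumes "\<And>y. y \<in> C \<Longrightarrow> y \<in> C' \<and> f y \<le> g y" "\<And>t. 0 \<le> t \<Longrightarrow> w t \<le> w' t" "x \<in> C"
  shows "(kop K C w ^^ n) f x \<le> (kop K C' w' ^^ n) g x"
  using assms(3)
  by (induction n arbitrary: x) (auto intro!: kop_mono simp: assms(1,2))

lemma pot_add:
  assumes [measurable]: "C \<in> sets borel" "w \<in> borel_measurable borel"
    "f \<in> borel_measurable borel" "g \<in> borel_measurable borel"
  shows "pot K C w (\<lambda>y. f y + g y) x = pot K C w f x + pot K C w g x"
  unfolding pot_def by (simp add: kop_pow_add suminf_add[symmetric] summableI)

lemma pot_cmult:
  assumes [measurable]: "C \<in> sets borel" "w \<in> borel_measurable borel" "f \<in> borel_measurable borel"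
  shows "pot K C w (\<lambda>y. a * f y) x = a * pot K C w f x"
  unfolding pot_def by (simp add: kop_pow_cmult)

lemma pot_mono:
  assumes "\<And>y. y \<in> C \<Longrightarrow> y \<in> C' \<and> f y \<le> g y" "\<And>t. 0 \<le> t \<Longrightarrow> w t \<le> w' t" "x \<in> C"
  shows "pot K C w f x \<le> pot K C' w' g x"
  unfolding pot_def by (intro suminf_le summableI kop_pow_mono assms)

lemma pot_cong:
  assumes "\<And>y. y \<in> C \<Longrightarrow> f y = g y" "x \<in> C"
  shows "pot K C w f x = pot K C w g x"
  using assms by (intro antisym pot_mono) auto

lemma pot_sum:
  assumes "finite I" and [measurable]: "C \<in> sets borel" "w \<in> borel_measurable borel"
    "\<And>i. i \<in> I \<Longrightarrow> f i \<in> borel_measurable borel"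
  shows "pot K C w (\<lambda>y. \<Sum>i\<in>I. f i y) x = (\<Sum>i\<in>I. pot K C w (f i) x)"
  using assms(1,4)
proof (induction I rule: finite_induct)
  case empty
  show ?case using pot_cmult[of C w one 0 x] by simp
next
  case (insert i I)
  then show ?case by (simp add: pot_add)
qed

lemma pot_le_const:
  assumes [measurable]: "C \<in> sets borel" "w \<in> borel_measurable borel"
    and "\<And>y. y \<in> C \<Longrightarrow> f y \<le> a" "x \<in> C"
  shows "pot K C w f x \<le> a * pot K C w one x"
  using pot_mono[of C C f "\<lambda>_. a * 1" w w x] pot_cmult[of C w one a x] assms by simp

text \<open>Summing \<open>u + g = f + kop u\<close> along the orbit, everything but the initial value of \<open>u\<close>
  telescopes; every identity below is an instance.\<close>

lemma pot_telescope:
  assumes [measurable]: "C \<in> sets borel" "w \<in> borel_measurable borel" "u \<in> borel_measurable borel"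
    "g \<in> borel_measurable borel" "f \<in> borel_measurable borel"
    and eq: "\<And>y. y \<in> C \<Longrightarrow> u y + g y = f y + kop K C w u y"
    and fin: "pot K C w u x < \<infinity>" and x: "x \<in> C"
  shows "u x + pot K C w g x = pot K C w f x"
proof -
  have r: "pot K C w u x = u x + pot K C w (kop K C w u) x"
    by (rule pot_unfold_right)
  have "pot K C w u x + pot K C w g x = pot K C w f x + pot K C w (kop K C w u) x"
    using pot_cong[of C "\<lambda>y. u y + g y" "\<lambda>y. f y + kop K C w u y" x w] eq x
    by (simp add: pot_add)
  then have "pot K C w (kop K C w u) x + (u x + pot K C w g x)
      = pot K C w (kop K C w u) x + pot K C w f x"
    by (simp add: r ac_simps)
  moreover have "pot K C w (kop K C w u) x \<noteq> \<infinity>"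
    using fin r by (auto simp: less_top)
  ultimately show ?thesis
    by (simp add: ennreal_add_left_cancel)
qed

text \<open>The constant 1 splits into the one-step probabilities of leaving and of staying, so it
  telescopes; the finite expected stay is what excludes a path that never leaves.\<close>

lemma pot_exit_total:
  assumes [measurable]: "C \<in> sets borel" and fin: "pot K C one one x < \<infinity>" and x: "x \<in> C"
  shows "pot K C one (kop K (- C) one one) x = 1"
proof -
  have "one y + 0 = kop K (- C) one one y + kop K C one one y" for y
    using kop_Un[of "- C" C one one y] by (simp add: kop_UNIV_one)
  from pot_telescope[of C one one "\<lambda>_. 0" "kop K (- C) one one" x, OF _ _ _ _ _ this fin x]
  show ?thesis using pot_cmult[of C one one 0 x] by simp
qed

end

section \<open>Splitting the weight, and decomposing a path at its entries into a subset\<close>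

context renewal_kernel
begin

text \<open>The split is demanded at nonnegative times only: it serves for
  \<open>1 = exp (- z) + (1 - exp (- z))\<close>, whose second part is truncated to 0 in
  \<open>ennreal\<close> when \<open>z\<close> is negative.\<close>

lemma kop_split_weight:
  assumes [measurable]: "C \<in> sets borel" "w \<in> borel_measurable borel" "w' \<in> borel_measurable borel"
    "f \<in> borel_measurable borel"
    and eq: "\<And>t. 0 \<le> t \<Longrightarrow> v t = w t + w' t"
  shows "kop K C v f x = kop K C w f x + kop K C w' f x"
proof -
  have "kop K C v f x = kop K C (\<lambda>t. w t + w' t) f x"
    by (intro antisym kop_mono) (auto simp: eq)
  then show ?thesis by (simp add: kop_add_weight)
qed

text \<open>Decomposition of a path in \<open>C\<close> at its entries into \<open>A\<close>: the bracket multiplying the bounds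
  is the expected number of entries.\<close>

lemma last_entry_bounds:
  assumes [measurable]: "A \<in> sets borel" "C \<in> sets borel" "f \<in> borel_measurable borel"
    and sub: "A \<subseteq> C" and x: "x \<in> C"
    and bnd: "\<And>y. y \<in> C \<Longrightarrow> pot K C one one y \<le> ennreal b"
    and fbnd: "\<And>y. f y \<le> ennreal F"
    and lo: "\<And>y. y \<in> A \<Longrightarrow> lo \<le> pot K A one f y"
    and hi: "\<And>y. y \<in> A \<Longrightarrow> pot K A one f y \<le> hi"
  shows "lo * (indicator A x + pot K C one (\<lambda>y. indicator (C - A) y * kop K A one one y) x)
      \<le> pot K C one (\<lambda>y. indicator A y * f y) x" (is "lo * ?v \<le> ?p")
    and "pot K C one (\<lambda>y. indicator A y * f y) x
      \<le> hi * (indicator A x + pot K C one (\<lambda>y. indicator (C - A) y * kop K A one one y) x)"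
proof -
  \<comment> \<open>Inside \<open>A\<close> the unfolding of \<open>pot K A one f\<close> is exactly
    the one-step equation of \<open>u\<close> on \<open>C\<close>; outside \<open>A\<close> the term
    \<open>kop K C one u\<close> is left over, so after telescoping only the steps from
    \<open>C - A\<close> into \<open>A\<close> survive, that is, the entries.\<close>
  define u where "u y = indicator A y * pot K A one f y" for y
  have [measurable]: "u \<in> borel_measurable borel" unfolding u_def by measurable
  have ku: "kop K C one u y = kop K A one (pot K A one f) y" for y
    unfolding kop_def u_def using sub by (intro nn_integral_cong) (auto simp: indicator_def)
  have eq: "u y + indicator (C - A) y * kop K C one u y = indicator A y * f y + kop K C one u y"
    if "y \<in> C" for y
    using that pot_unfold[of A one f y] unfolding ku u_def by (auto simp: indicator_def)
  have ub: "u y \<le> ennreal F * ennreal b" for y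
  proof (cases "y \<in> A")
    case True
    have "pot K A one f y \<le> ennreal F * pot K A one one y"
      by (rule pot_le_const) (use fbnd True in auto)
    also have "pot K A one one y \<le> pot K C one one y"
      by (rule pot_mono) (use sub True in auto)
    also have "\<dots> \<le> ennreal b" using bnd sub True by auto
    finally show ?thesis using True by (auto simp: u_def mult_left_mono)
  qed (simp add: u_def)
  have "pot K C one u x \<le> ennreal F * ennreal b * pot K C one one x"
    by (rule pot_le_const) (use ub x in auto)
  also have "\<dots> \<le> ennreal F * ennreal b * ennreal b"
    by (intro mult_left_mono bnd x) auto
  also have "\<dots> < \<infinity>" by (simp add: ennreal_mult_less_top)
  finally have fin: "pot K C one u x < \<infinity>" .
  have main: "u x + pot K C one (\<lambda>y. indicator (C - A) y * kop K C one u y) x = ?p"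
    by (rule pot_telescope[OF _ _ _ _ _ eq fin x]) measurable
  have kc: "kop K A one (\<lambda>_. a) y = a * kop K A one one y" for a y
    using kop_cmult[of A one one a y] by simp
  have lo': "lo * kop K A one one y \<le> kop K C one u y" for y
    unfolding ku using kop_mono[of A A "\<lambda>_. lo" "pot K A one f" one one y] lo
    by (simp add: kc[of lo])
  have hi': "kop K C one u y \<le> hi * kop K A one one y" for y
    unfolding ku using kop_mono[of A A "pot K A one f" "\<lambda>_. hi" one one y] hi
    by (simp add: kc[of hi])
  have "lo * ?v = lo * indicator A x + pot K C one (\<lambda>y. lo * (indicator (C - A) y * kop K A one one y)) x"
    by (simp add: pot_cmult distrib_left)
  also have "\<dots> \<le> ?p" unfolding main[symmetric]
  proof (intro add_mono pot_mono)
    show "lo * indicator A x \<le> u x" using lo by (auto simp: u_def indicator_def)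
    show "y \<in> C \<and> lo * (indicator (C - A) y * kop K A one one y) \<le> indicator (C - A) y * kop K C one u y"
      if "y \<in> C" for y using that lo' by (auto simp: indicator_def)
  qed (use x in auto)
  finally show "lo * ?v \<le> ?p" .
  have "hi * ?v = hi * indicator A x + pot K C one (\<lambda>y. hi * (indicator (C - A) y * kop K A one one y)) x"
    by (simp add: pot_cmult distrib_left)
  also have "\<dots> \<ge> ?p" unfolding main[symmetric]
  proof (intro add_mono pot_mono)
    show "u x \<le> hi * indicator A x" using hi by (auto simp: u_def indicator_def)
    show "y \<in> C \<and> indicator (C - A) y * kop K C one u y \<le> hi * (indicator (C - A) y * kop K A one one y)"
      if "y \<in> C" for y using that hi' by (auto simp: indicator_def)
  qed (use x in auto)
  finally show "?p \<le> hi * ?v" .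
qed

end

text \<open>Perturbation of the linear system for \<open>l\<close>, \<open>J\<close> and
  \<open>B\<close>, after division by \<open>h0\<close> or by the time scale. The term
  \<open>e\<close> is the weight lost on the exit step itself. In \<open>JB\<close> the quadratic
  term is the remainder of the linearised exponential and \<open>2 * \<theta> * \<delta>\<close>
  restores the exit steps, which \<open>B\<close> omits. The constant in the conclusion is the plain
  sum of the errors; what matters later is that the bound is linear in \<delta>.\<close>

lemma laplace_real_estimate:
  fixes h e X l m J X' B \<theta> \<delta> C2 :: real
  assumes th: "0 \<le> \<theta>" and d: "0 < \<delta>" "\<delta> \<le> 1" and C2: "0 \<le> C2"
    and h: "h = l + e + X" "\<bar>h - 1\<bar> \<le> \<delta>" and e: "0 \<le> e" "e \<le> 2 * \<theta> * \<delta> * h"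
    and X: "\<bar>X - B\<bar> \<le> \<delta> * B" and m: "m = J + X'" "\<bar>m - 1\<bar> \<le> \<delta>"
    and X': "0 \<le> X'" "\<bar>X' - B\<bar> \<le> \<delta> * B" and J: "0 \<le> J" and B: "B \<le> \<theta> * (1 + \<delta>) * J"
    and JB: "\<theta> * (1 - \<delta>) * J \<le> B + \<theta>\<^sup>2 / 2 * C2 * \<delta> * m + 2 * \<theta> * \<delta>"
  shows "\<bar>l - 1 / (1 + \<theta>)\<bar> \<le> (2 + 20 * \<theta> + 2 * \<theta>\<^sup>2 * C2) * \<delta>"
proof -
  have J2: "J \<le> 2" using m X' d by linarith
  have m2: "m \<le> 2" using m(2) d by linarith
  have h2: "h \<le> 2" using h(2) d by linarith
  have tJ: "\<theta> * J \<le> 2 * \<theta>" using mult_left_mono[OF J2 th] by simp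
  have tdJ: "\<theta> * J * \<delta> \<le> 2 * \<theta> * \<delta>" using tJ d by (intro mult_right_mono) auto
  have "\<theta> * J * \<delta> \<le> \<theta> * J * 1" using d th J by (intro mult_left_mono) auto
  then have B4: "B \<le> 4 * \<theta>" using B tJ by (simp add: algebra_simps)
  have dB: "\<delta> * B \<le> 4 * \<theta> * \<delta>" using mult_left_mono[OF B4, of \<delta>] d by (simp add: ac_simps)
  have cm: "\<theta>\<^sup>2 / 2 * C2 * \<delta> * m \<le> \<theta>\<^sup>2 * C2 * \<delta>"
    using mult_left_mono[OF m2, of "\<theta>\<^sup>2 / 2 * C2 * \<delta>"] C2 d by simp
  define k1 where "k1 = 4 * \<theta> + \<theta>\<^sup>2 * C2"
  have BJ: "\<bar>B - \<theta> * J\<bar> \<le> k1 * \<delta>"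
  proof -
    have "B - \<theta> * J \<le> 2 * \<theta> * \<delta>" using B tdJ by (simp add: algebra_simps)
    moreover have "\<theta> * J - B \<le> 4 * \<theta> * \<delta> + \<theta>\<^sup>2 * C2 * \<delta>"
      using JB tdJ cm by (simp add: algebra_simps)
    moreover have "0 \<le> \<theta> * \<delta>" "0 \<le> \<theta>\<^sup>2 * C2 * \<delta>" using th d C2 by auto
    moreover have "k1 * \<delta> = 4 * (\<theta> * \<delta>) + \<theta>\<^sup>2 * C2 * \<delta>" by (simp add: k1_def algebra_simps)
    ultimately show ?thesis by (intro abs_leI) linarith+
  qed
  have tri: "\<bar>a - c\<bar> \<le> p + q" if "\<bar>a - b\<bar> \<le> p" "\<bar>b - c\<bar> \<le> q" for a b c p q :: real
    using that by linarith
  have XB: "\<bar>X - \<theta> * J\<bar> \<le> 4 * \<theta> * \<delta> + k1 * \<delta>"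
    by (rule tri[OF order_trans[OF X dB] BJ])
  have X'B: "\<bar>X' - \<theta> * J\<bar> \<le> 4 * \<theta> * \<delta> + k1 * \<delta>"
    by (rule tri[OF order_trans[OF X'(2) dB] BJ])
  have tri2: "\<bar>a - b\<bar> \<le> p + q" if "\<bar>a\<bar> \<le> p" "\<bar>b\<bar> \<le> q" for a b p q :: real
    using that by linarith
  have "(1 + \<theta>) * J - 1 = (m - 1) - (X' - \<theta> * J)" using m(1) by (simp add: algebra_simps)
  then have J1: "\<bar>(1 + \<theta>) * J - 1\<bar> \<le> \<delta> + (4 * \<theta> * \<delta> + k1 * \<delta>)"
    using tri2[OF m(2) X'B] by simp
  have e4: "\<bar>e\<bar> \<le> 4 * \<theta> * \<delta>"
  proof -
    have "2 * \<theta> * \<delta> * h \<le> 2 * \<theta> * \<delta> * 2" by (rule mult_left_mono[OF h2]) (use th d in auto)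
    also have "\<dots> = 4 * \<theta> * \<delta>" by simp
    finally have "2 * \<theta> * \<delta> * h \<le> 4 * \<theta> * \<delta>" .
    from order_trans[OF e(2) this] show ?thesis using e(1) by (simp only: abs_of_nonneg)
  qed
  have "l - (1 - \<theta> * J) = (h - 1) - e - (X - \<theta> * J)" using h(1) by (simp add: algebra_simps)
  then have l1: "\<bar>l - (1 - \<theta> * J)\<bar> \<le> \<delta> + 4 * \<theta> * \<delta> + (4 * \<theta> * \<delta> + k1 * \<delta>)"
    using tri2[OF tri2[OF h(2) e4] XB] by simp
  have t0: "1 + \<theta> \<noteq> 0" using th by simp
  \<comment> \<open>\<open>(1 + \<theta>) * J\<close> is near 1; multiplying this defect by
    \<open>\<theta> / (1 + \<theta>)\<close>, which is at most 1, gives the distance of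
    \<open>1 - \<theta> * J\<close> from \<open>1 / (1 + \<theta>)\<close>.\<close>
  define y where "y = (1 + \<theta>) * J - 1"
  have p: "p / (1 + \<theta>) * ((1 + \<theta>) * J - 1) = p * J - p / (1 + \<theta>)" for p
    using t0 by (simp add: right_diff_distrib)
  have "\<theta> / (1 + \<theta>) * y = \<theta> * J - \<theta> / (1 + \<theta>)"
    unfolding y_def by (rule p)
  moreover have "\<theta> / (1 + \<theta>) = 1 - 1 / (1 + \<theta>)" using t0 by (simp add: divide_simps)
  ultimately have "1 - \<theta> * J - 1 / (1 + \<theta>) = - (\<theta> / (1 + \<theta>) * y)" by linarith
  then have "\<bar>1 - \<theta> * J - 1 / (1 + \<theta>)\<bar> = (\<theta> / (1 + \<theta>)) * \<bar>(1 + \<theta>) * J - 1\<bar>"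
    using th by (simp only: abs_minus_cancel abs_mult y_def abs_divide) simp
  also have "\<dots> \<le> 1 * \<bar>(1 + \<theta>) * J - 1\<bar>"
    using th by (intro mult_right_mono) auto
  finally have "\<bar>1 - \<theta> * J - 1 / (1 + \<theta>)\<bar> \<le> \<delta> + (4 * \<theta> * \<delta> + k1 * \<delta>)"
    using J1 by simp
  from tri[OF l1 this]
  have "\<bar>l - 1 / (1 + \<theta>)\<bar> \<le> \<delta> + 4 * \<theta> * \<delta> + (4 * \<theta> * \<delta> + k1 * \<delta>) + (\<delta> + (4 * \<theta> * \<delta> + k1 * \<delta>))" .
  also have "\<dots> = (2 + 20 * \<theta> + 2 * \<theta>\<^sup>2 * C2) * \<delta>"
    by (simp add: k1_def algebra_simps)
  finally show ?thesis .
qed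

lemma one_minus_exp_bounds:
  fixes z :: real assumes "0 \<le> z"
  shows "1 - exp (- z) \<le> z" "z \<le> 1 - exp (- z) + z\<^sup>2 / 2"
proof -
  show "1 - exp (- z) \<le> z" using exp_ge_add_one_self[of "- z"] by simp
  have "exp (- z) - (1 - z + z\<^sup>2 / 2) \<le> exp (- 0) - (1 - 0 + 0\<^sup>2 / 2)"
  proof (rule DERIV_nonpos_imp_nonincreasing[OF assms])
    fix t assume "0 \<le> t" "t \<le> z"
    then have "- exp (- t) + 1 - t \<le> 0" using exp_ge_add_one_self[of "- t"] by simp
    moreover have "((\<lambda>t. exp (- t) - (1 - t + t\<^sup>2 / 2)) has_real_derivative (- exp (- t) + 1 - t)) (at t)"
      by (auto intro!: derivative_eq_intros)
    ultimately show "\<exists>y. ((\<lambda>t. exp (- t) - (1 - t + t\<^sup>2 / 2)) has_real_derivative y) (at t) \<and> y \<le> 0"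
      by blast
  qed
  then show "z \<le> 1 - exp (- z) + z\<^sup>2 / 2" by simp
qed

section \<open>Laplace transform of the exit time\<close>

lemma ennreal_finite_enn2real:
  assumes "x \<le> ennreal a" shows "x = ennreal (enn2real x)"
  using assms by (metis ennreal_enn2real ennreal_less_top le_less_trans)

context renewal_kernel
begin

text \<open>All asymptotic input is frozen here at a single kernel with one error \<delta>;
  \<open>c\<close> stands for \<open>tauk\<close> and \<open>tf\<close> for the mean sojourn as a
  function of the state. The bounds \<open>mean_D\<close>, \<open>mean_C\<close> and
  \<open>sq\<close> express that \<open>tf\<close> is at most of order \<open>\<delta> * c\<close>
  on \<open>C\<close>. Finiteness is part of the conclusion because \<open>enn2real\<close> would
  otherwise hide an infinite value.\<close>

lemma exit_laplace_estimate:
  fixes tf :: "'a \<Rightarrow> real"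
  assumes C[measurable]: "C \<in> sets borel" and D[measurable]: "D \<in> sets borel"
    and tf[measurable]: "tf \<in> borel_measurable borel" and tf0: "\<And>y. 0 \<le> tf y"
    and th: "0 \<le> \<theta>" and d: "0 < \<delta>" "\<delta> \<le> 1" and C2: "0 \<le> C2" and c: "0 < c" and h0: "0 < h0"
    and fin: "pot K C one one x < \<infinity>" and x: "x \<in> C"
    and h_lo: "\<And>y. y \<in> C \<Longrightarrow> ennreal ((1 - \<delta>) * h0) \<le> pot K C one (kop K D one one) y"
    and h_hi: "\<And>y. y \<in> C \<Longrightarrow> pot K C one (kop K D one one) y \<le> ennreal ((1 + \<delta>) * h0)"
    and m_lo: "\<And>y. y \<in> C \<Longrightarrow> ennreal ((1 - \<delta>) * c) \<le> pot K C one (\<lambda>y. ennreal (tf y)) y"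
    and m_hi: "\<And>y. y \<in> C \<Longrightarrow> pot K C one (\<lambda>y. ennreal (tf y)) y \<le> ennreal ((1 + \<delta>) * c)"
    and mean_D: "\<And>y. y \<in> C \<Longrightarrow> kop K D ennreal one y \<le> ennreal (2 * \<delta> * c) * kop K D one one y"
    and mean_C: "\<And>y. y \<in> C \<Longrightarrow>
        kop K (- C) ennreal one y \<le> ennreal (2 * \<delta> * c) * kop K (- C) one one y"
    and mean_lo: "\<And>y. y \<in> C \<Longrightarrow> ennreal ((1 - \<delta>) * tf y) \<le> kop K UNIV ennreal one y"
    and mean_hi: "\<And>y. y \<in> C \<Longrightarrow> kop K UNIV ennreal one y \<le> ennreal ((1 + \<delta>) * tf y)"
    and sq: "\<And>y. y \<in> C \<Longrightarrow> kop K UNIV (\<lambda>t. ennreal (t\<^sup>2)) one y \<le> ennreal (C2 * \<delta> * c * tf y)"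
  defines "w \<equiv> \<lambda>t. ennreal (exp (- (\<theta> * t / c)))"
  shows "\<bar>enn2real (pot K C w (kop K D w one) x) / h0 - 1 / (1 + \<theta>)\<bar>
    \<le> (2 + 20 * \<theta> + 2 * \<theta>\<^sup>2 * C2) * \<delta>"
    and "pot K C w (kop K D w one) x < \<infinity>"
proof -
  define w' where "w' t = ennreal (1 - exp (- (\<theta> * t / c)))" for t
  have w[measurable]: "w \<in> borel_measurable borel" and w'[measurable]: "w' \<in> borel_measurable borel"
    unfolding w_def w'_def by measurable
  have z0: "0 \<le> \<theta> * t / c" if "0 \<le> t" for t using that th c by simp
  have ww': "1 = w t + w' t" if "0 \<le> t" for t
    using z0[OF that] unfolding w_def w'_def by (simp add: ennreal_plus[symmetric] del: ennreal_plus)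
  have w1: "w t \<le> 1" if "0 \<le> t" for t
    using z0[OF that] unfolding w_def by simp
  have w'_hi: "w' t \<le> ennreal (\<theta> / c) * ennreal t" if "0 \<le> t" for t
    using one_minus_exp_bounds(1)[OF z0[OF that]] that th c
    unfolding w'_def by (simp add: ennreal_mult[symmetric])
  have w'_lo: "ennreal (\<theta> / c) * ennreal t \<le> w' t + ennreal (\<theta>\<^sup>2 / (2 * c\<^sup>2)) * ennreal (t\<^sup>2)"
    if "0 \<le> t" for t
    using one_minus_exp_bounds(2)[OF z0[OF that]] z0[OF that] that th c
    unfolding w'_def
    by (simp add: ennreal_mult[symmetric] ennreal_plus[symmetric] power_divide power_mult_distrib
        del: ennreal_plus)
  define h where "h = pot K C one (kop K D one one)"
  define m where "m = pot K C one (\<lambda>y. ennreal (tf y))"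
  have [measurable]: "h \<in> borel_measurable borel" "m \<in> borel_measurable borel"
    unfolding h_def m_def by measurable
  define B where "B = pot K C w (kop K C w' one) x"
  define J where "J = pot K C w (\<lambda>y. ennreal (tf y)) x"
  have zero: "pot K C w (\<lambda>_. 0) x = 0" using pot_cmult[of C w one 0 x] by simp
  have wpot: "pot K C w f x \<le> pot K C one f x" for f
    by (rule pot_mono) (use w1 x in auto)
  \<comment> \<open>For a solution \<open>u\<close> of the undiscounted equation, writing
    \<open>1 = w + w'\<close> moves the lost part \<open>kop K C w' u\<close> into the source of a
    discounted equation, which telescopes. This is applied to \<open>h\<close> and to
    \<open>m\<close>.\<close>
  have id: "u x = pot K C w f x + pot K C w (kop K C w' u) x"
    if [measurable]: "u \<in> borel_measurable borel" "f \<in> borel_measurable borel"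
      and bd: "\<And>y. y \<in> C \<Longrightarrow> u y \<le> ennreal a" and eq: "\<And>y. u y = f y + kop K C one u y" for u f a
  proof -
    have eq': "u y + 0 = (f y + kop K C w' u y) + kop K C w u y" for y
      using kop_split_weight[of C w w' u one y] ww' by (subst eq) (simp add: ac_simps)
    have fin': "pot K C w u x < \<infinity>"
    proof -
      have "pot K C w u x \<le> pot K C one u x" by (rule wpot)
      also have "\<dots> \<le> ennreal a * pot K C one one x" by (rule pot_le_const) (use bd x in auto)
      also have "\<dots> < \<infinity>" using fin by (simp add: ennreal_mult_less_top)
      finally show ?thesis .
    qed
    have "u x + pot K C w (\<lambda>_. 0) x = pot K C w (\<lambda>y. f y + kop K C w' u y) x"
      by (rule pot_telescope[OF _ _ _ _ _ eq' fin' x]) measurable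
    then show ?thesis by (simp add: zero pot_add)
  qed
  \<comment> \<open>If \<open>u\<close> is nearly the constant \<open>a\<close> on \<open>C\<close>,
    its lost part is nearly \<open>a * B\<close>; this is how the equations of \<open>h\<close> and
    of \<open>m\<close> come to share the single quantity \<open>B\<close>.\<close>
  have bounds: "ennreal ((1 - \<delta>) * a) * B \<le> pot K C w (kop K C w' u) x"
      "pot K C w (kop K C w' u) x \<le> ennreal ((1 + \<delta>) * a) * B"
    if [measurable]: "u \<in> borel_measurable borel" and
      lo: "\<And>y. y \<in> C \<Longrightarrow> ennreal ((1 - \<delta>) * a) \<le> u y" and
      hi: "\<And>y. y \<in> C \<Longrightarrow> u y \<le> ennreal ((1 + \<delta>) * a)" for u a
  proof -
    have kc: "kop K C w' (\<lambda>_. b) y = b * kop K C w' one y" for b y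
      using kop_cmult[of C w' one b y] by simp
    show "ennreal ((1 - \<delta>) * a) * B \<le> pot K C w (kop K C w' u) x"
      unfolding B_def pot_cmult[OF C w kop_measurable[OF C w' borel_measurable_const], symmetric]
      using lo by (intro pot_mono) (auto simp: x kc[symmetric] intro!: kop_mono)
    show "pot K C w (kop K C w' u) x \<le> ennreal ((1 + \<delta>) * a) * B"
      unfolding B_def pot_cmult[OF C w kop_measurable[OF C w' borel_measurable_const], symmetric]
      using hi by (intro pot_mono) (auto simp: x kc[symmetric] intro!: kop_mono)
  qed
  define X where "X = pot K C w (kop K C w' h) x"
  define X' where "X' = pot K C w (kop K C w' m) x"
  define e where "e = pot K C w (kop K D w' one) x"
  define L where "L = pot K C w (kop K D w one) x"
  have heq: "h x = L + e + X"
  proof -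
    have "h x = pot K C w (kop K D one one) x + X" unfolding X_def
      by (rule id[where a="(1 + \<delta>) * h0"]) (use h_hi in \<open>auto simp: h_def intro!: pot_unfold\<close>)
    also have "pot K C w (kop K D one one) x = pot K C w (\<lambda>y. kop K D w one y + kop K D w' one y) x"
      by (rule pot_cong) (use ww' x in \<open>auto intro!: kop_split_weight\<close>)
    also have "\<dots> = L + e" unfolding L_def e_def by (rule pot_add) measurable
    finally show ?thesis .
  qed
  have meq: "m x = J + X'" unfolding X'_def J_def
    by (rule id[where a="(1 + \<delta>) * c"]) (use m_hi in \<open>auto simp: m_def intro!: pot_unfold\<close>)
  have X: "ennreal ((1 - \<delta>) * h0) * B \<le> X" "X \<le> ennreal ((1 + \<delta>) * h0) * B"
    unfolding X_def by (rule bounds; use h_lo h_hi in \<open>auto simp: h_def\<close>)+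
  have X': "ennreal ((1 - \<delta>) * c) * B \<le> X'" "X' \<le> ennreal ((1 + \<delta>) * c) * B"
    unfolding X'_def by (rule bounds; use m_lo m_hi in \<open>auto simp: m_def\<close>)+
  \<comment> \<open>The loss on the exit step is at most \<open>\<theta> / c\<close> times its mean
    duration, and \<open>mean_D\<close> bounds the latter by \<open>2 * \<delta> * c\<close> times
    the probability of the step.\<close>
  have e: "e \<le> ennreal (2 * \<theta> * \<delta>) * h x"
  proof -
    have "e \<le> pot K C one (kop K D w' one) x" unfolding e_def by (rule wpot)
    also have "\<dots> \<le> pot K C one (\<lambda>y. ennreal (2 * \<theta> * \<delta>) * kop K D one one y) x"
    proof (rule pot_mono)
      fix y assume y: "y \<in> C"
      have "kop K D w' one y \<le> kop K D (\<lambda>t. ennreal (\<theta> / c) * ennreal t) one y"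
        by (rule kop_mono) (use w'_hi in auto)
      also have "\<dots> = ennreal (\<theta> / c) * kop K D ennreal one y" by (rule kop_cmult_weight) measurable
      also have "\<dots> \<le> ennreal (\<theta> / c) * (ennreal (2 * \<delta> * c) * kop K D one one y)"
        by (intro mult_left_mono mean_D y) simp
      also have "\<dots> = ennreal (2 * \<theta> * \<delta>) * kop K D one one y"
        unfolding mult.assoc[symmetric]
        using th c d by (subst ennreal_mult[symmetric]) (auto simp: field_simps)
      finally show "y \<in> C \<and> kop K D w' one y \<le> ennreal (2 * \<theta> * \<delta>) * kop K D one one y"
        using y by simp
    qed (use x in auto)
    also have "\<dots> = ennreal (2 * \<theta> * \<delta>) * h x" unfolding h_def by (rule pot_cmult) measurable
    finally show ?thesis .
  qed
  have BJ: "B \<le> ennreal (\<theta> / c * (1 + \<delta>)) * J"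
  proof -
    have "B \<le> pot K C w (\<lambda>y. ennreal (\<theta> / c * (1 + \<delta>)) * ennreal (tf y)) x" unfolding B_def
    proof (rule pot_mono)
      fix y assume y: "y \<in> C"
      have "kop K C w' one y \<le> kop K UNIV (\<lambda>t. ennreal (\<theta> / c) * ennreal t) one y"
        by (rule kop_mono) (use w'_hi in auto)
      also have "\<dots> = ennreal (\<theta> / c) * kop K UNIV ennreal one y" by (rule kop_cmult_weight) measurable
      also have "\<dots> \<le> ennreal (\<theta> / c) * ennreal ((1 + \<delta>) * tf y)"
        by (intro mult_left_mono mean_hi y) simp
      also have "\<dots> = ennreal (\<theta> / c * (1 + \<delta>)) * ennreal (tf y)"
        using th c d tf0 by (simp add: ennreal_mult[symmetric] mult.assoc)
      finally show "y \<in> C \<and> kop K C w' one y \<le> ennreal (\<theta> / c * (1 + \<delta>)) * ennreal (tf y)"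
        using y by simp
    qed (use x in auto)
    also have "\<dots> = ennreal (\<theta> / c * (1 + \<delta>)) * J" unfolding J_def by (rule pot_cmult) measurable
    finally show ?thesis .
  qed
  \<comment> \<open>The mean sojourn counts all steps, \<open>B\<close> only those staying in
    \<open>C\<close>. The staying ones are compared through
    \<open>z \<le> 1 - exp (- z) + z^2 / 2\<close> and the bound on second moments; the leaving ones
    have total probability at most 1 and mean at most \<open>2 * \<delta> * c\<close> each, whence
    \<open>2 * \<theta> * \<delta>\<close>.\<close>
  have JB: "ennreal (\<theta> / c * (1 - \<delta>)) * J
      \<le> B + (ennreal (\<theta>\<^sup>2 / 2 * C2 * \<delta> / c) * m x + ennreal (2 * \<theta> * \<delta>))"
  proof -
    have pt: "ennreal (\<theta> / c * (1 - \<delta>)) * ennreal (tf y) \<le> kop K C w' one y +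
        (ennreal (\<theta>\<^sup>2 / 2 * C2 * \<delta> / c) * ennreal (tf y) + ennreal (2 * \<theta> * \<delta>) * kop K (- C) one one y)"
      if y: "y \<in> C" for y
    proof -
      let ?t2 = "\<lambda>t. ennreal (t\<^sup>2)"
      have "ennreal (\<theta> / c * (1 - \<delta>)) * ennreal (tf y) = ennreal (\<theta> / c) * ennreal ((1 - \<delta>) * tf y)"
        using th c d tf0 by (simp add: ennreal_mult[symmetric] mult.assoc)
      also have "\<dots> \<le> ennreal (\<theta> / c) * kop K UNIV ennreal one y"
        by (intro mult_left_mono mean_lo y) simp
      also have "kop K UNIV ennreal one y = kop K C ennreal one y + kop K (- C) ennreal one y"
        using kop_Un[of C "- C" ennreal one y] by simp
      also have "ennreal (\<theta> / c) * (kop K C ennreal one y + kop K (- C) ennreal one y)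
          = kop K C (\<lambda>t. ennreal (\<theta> / c) * ennreal t) one y + ennreal (\<theta> / c) * kop K (- C) ennreal one y"
        by (subst kop_cmult_weight) (auto simp: distrib_left)
      also have "kop K C (\<lambda>t. ennreal (\<theta> / c) * ennreal t) one y
          \<le> kop K C (\<lambda>t. w' t + ennreal (\<theta>\<^sup>2 / (2 * c\<^sup>2)) * ?t2 t) one y"
        by (rule kop_mono) (use w'_lo in auto)
      also have "\<dots> = kop K C w' one y + ennreal (\<theta>\<^sup>2 / (2 * c\<^sup>2)) * kop K C ?t2 one y"
        by (subst kop_add_weight) (auto simp: kop_cmult_weight)
      also have "kop K C ?t2 one y \<le> kop K UNIV ?t2 one y" by (rule kop_mono) auto
      also have "\<dots> \<le> ennreal (C2 * \<delta> * c * tf y)" by (rule sq[OF y])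
      also have "ennreal (\<theta>\<^sup>2 / (2 * c\<^sup>2)) * ennreal (C2 * \<delta> * c * tf y)
          = ennreal (\<theta>\<^sup>2 / 2 * C2 * \<delta> / c) * ennreal (tf y)"
        using th c d tf0 C2 by (simp add: ennreal_mult[symmetric] power2_eq_square field_simps)
      also have "kop K (- C) ennreal one y \<le> ennreal (2 * \<delta> * c) * kop K (- C) one one y"
        by (rule mean_C[OF y])
      also have "ennreal (\<theta> / c) * (ennreal (2 * \<delta> * c) * kop K (- C) one one y)
          = ennreal (2 * \<theta> * \<delta>) * kop K (- C) one one y"
        unfolding mult.assoc[symmetric]
        using th c d by (subst ennreal_mult[symmetric]) (auto simp: field_simps)
      finally show ?thesis by (simp add: add_mono mult_left_mono add.assoc)
    qed
    have "ennreal (\<theta> / c * (1 - \<delta>)) * J = pot K C w (\<lambda>y. ennreal (\<theta> / c * (1 - \<delta>)) * ennreal (tf y)) x"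
      unfolding J_def by (rule pot_cmult[symmetric]) measurable
    also have "\<dots> \<le> pot K C w (\<lambda>y. kop K C w' one y + (ennreal (\<theta>\<^sup>2 / 2 * C2 * \<delta> / c) * ennreal (tf y)
        + ennreal (2 * \<theta> * \<delta>) * kop K (- C) one one y)) x"
      by (rule pot_mono) (use pt x in auto)
    also have "\<dots> = B + (ennreal (\<theta>\<^sup>2 / 2 * C2 * \<delta> / c) * J
        + ennreal (2 * \<theta> * \<delta>) * pot K C w (kop K (- C) one one) x)"
      unfolding B_def J_def by (simp add: pot_add pot_cmult)
    also have "\<dots> \<le> B + (ennreal (\<theta>\<^sup>2 / 2 * C2 * \<delta> / c) * m x + ennreal (2 * \<theta> * \<delta>) * 1)"
      using wpot[of "kop K (- C) one one"] pot_exit_total[OF C fin x]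
        wpot[of "\<lambda>y. ennreal (tf y)"]
      by (intro add_mono mult_left_mono) (auto simp: J_def m_def)
    finally show ?thesis by simp
  qed
  have hfin: "h x = ennreal (enn2real (h x))" "m x = ennreal (enn2real (m x))"
    using h_hi[OF x] m_hi[OF x] unfolding h_def m_def by (auto intro: ennreal_finite_enn2real)
  have "L \<le> h x" "e \<le> h x" "X \<le> h x"
    unfolding heq by (auto intro: add_increasing2 add_increasing)
  note fin1 = this[THEN order_trans, OF h_hi[OF x, folded h_def], THEN ennreal_finite_enn2real]
  have "J \<le> m x" "X' \<le> m x"
    unfolding meq by (auto intro: add_increasing2 add_increasing)
  note fin2 = this[THEN order_trans, OF m_hi[OF x, folded m_def], THEN ennreal_finite_enn2real]
  have "B \<le> ennreal (\<theta> / c * (1 + \<delta>) * enn2real J)"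
    using BJ th c d by (subst ennreal_mult) (auto simp: fin2(1)[symmetric])
  note fin3 = ennreal_finite_enn2real[OF this]
  obtain hr where hr: "h x = ennreal hr" "0 \<le> hr" using hfin by auto
  obtain mr where mr: "m x = ennreal mr" "0 \<le> mr" using hfin by auto
  obtain Lr where Lr: "L = ennreal Lr" "0 \<le> Lr" using fin1 by auto
  obtain er where er: "e = ennreal er" "0 \<le> er" using fin1 by auto
  obtain Xr where Xr: "X = ennreal Xr" "0 \<le> Xr" using fin1 by auto
  obtain Jr where Jr: "J = ennreal Jr" "0 \<le> Jr" using fin2 by auto
  obtain Xr' where Xr': "X' = ennreal Xr'" "0 \<le> Xr'" using fin2 by auto
  obtain Br where Br: "B = ennreal Br" "0 \<le> Br" using fin3 by auto
  have R1: "hr = Lr + er + Xr" using heq hr Lr er Xr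
    by (simp add: ennreal_plus[symmetric] del: ennreal_plus)
  have R2: "mr = Jr + Xr'" using meq mr Jr Xr' by (simp add: ennreal_plus[symmetric] del: ennreal_plus)
  have R3: "(1 - \<delta>) * h0 * Br \<le> Xr" "Xr \<le> (1 + \<delta>) * h0 * Br"
    using X h0 d Xr Br by (simp_all add: ennreal_mult[symmetric])
  have R4: "(1 - \<delta>) * c * Br \<le> Xr'" "Xr' \<le> (1 + \<delta>) * c * Br"
    using X' c d Xr' Br by (simp_all add: ennreal_mult[symmetric])
  have R5: "er \<le> 2 * \<theta> * \<delta> * hr"
    using e th d er hr by (simp add: ennreal_mult[symmetric])
  have R6: "Br \<le> \<theta> / c * (1 + \<delta>) * Jr"
    using BJ th d c Br Jr by (simp add: ennreal_mult[symmetric])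
  have R7: "\<theta> / c * (1 - \<delta>) * Jr \<le> Br + (\<theta>\<^sup>2 / 2 * C2 * \<delta> / c * mr + 2 * \<theta> * \<delta>)"
    using JB th d c C2 Br Jr mr
    by (simp add: ennreal_mult[symmetric] ennreal_plus[symmetric] del: ennreal_plus)
  have R8: "(1 - \<delta>) * h0 \<le> hr" "hr \<le> (1 + \<delta>) * h0"
    using h_lo[OF x] h_hi[OF x] hr h0 d unfolding h_def by auto
  have R9: "(1 - \<delta>) * c \<le> mr" "mr \<le> (1 + \<delta>) * c"
    using m_lo[OF x] m_hi[OF x] mr c d unfolding m_def by auto
  have "\<bar>Lr / h0 - 1 / (1 + \<theta>)\<bar> \<le> (2 + 20 * \<theta> + 2 * \<theta>\<^sup>2 * C2) * \<delta>"
  proof (rule laplace_real_estimate[where h="hr / h0" and e="er / h0" and X="Xr / h0" and m="mr / c"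
        and J="Jr / c" and X'="Xr' / c" and B=Br, OF th d C2])
    show "hr / h0 = Lr / h0 + er / h0 + Xr / h0" using R1 by (simp add: add_divide_distrib)
    show "\<bar>hr / h0 - 1\<bar> \<le> \<delta>" using R8 h0 by (simp add: abs_le_iff field_simps)
    show "0 \<le> er / h0" using er h0 by simp
    show "er / h0 \<le> 2 * \<theta> * \<delta> * (hr / h0)" using R5 h0 by (simp add: divide_right_mono)
    show "\<bar>Xr / h0 - Br\<bar> \<le> \<delta> * Br" using R3 h0 by (simp add: abs_le_iff field_simps)
    show "mr / c = Jr / c + Xr' / c" using R2 by (simp add: add_divide_distrib)
    show "\<bar>mr / c - 1\<bar> \<le> \<delta>" using R9 c by (simp add: abs_le_iff field_simps)
    show "0 \<le> Xr' / c" using Xr' c by simp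
    show "\<bar>Xr' / c - Br\<bar> \<le> \<delta> * Br" using R4 c by (simp add: abs_le_iff field_simps)
    show "0 \<le> Jr / c" using Jr c by simp
    show "Br \<le> \<theta> * (1 + \<delta>) * (Jr / c)" using R6 by (simp add: mult_ac)
    show "\<theta> * (1 - \<delta>) * (Jr / c) \<le> Br + \<theta>\<^sup>2 / 2 * C2 * \<delta> * (mr / c) + 2 * \<theta> * \<delta>"
      using R7 by (simp add: mult_ac)
  qed
  then show "\<bar>enn2real (pot K C w (kop K D w one) x) / h0 - 1 / (1 + \<theta>)\<bar>
    \<le> (2 + 20 * \<theta> + 2 * \<theta>\<^sup>2 * C2) * \<delta>"
    using Lr unfolding L_def by simp
  show "pot K C w (kop K D w one) x < \<infinity>"
    using Lr unfolding L_def by simp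
qed

end

section \<open>The exit law\<close>

text \<open>For \<open>D\<close> disjoint from \<open>C\<close> this is the expectation of
  \<open>\<phi>\<close> of the exit time on the event of leaving through \<open>D\<close>, not
  divided by the probability of that event. The index \<open>n\<close> counts the steps that stay in
  \<open>C\<close>, so the exit happens at step \<open>n + 1\<close> and its sojourn is
  included.\<close>

definition exit_functional :: "('a::metric_space \<Rightarrow> ('a \<times> real) measure) \<Rightarrow> 'a \<Rightarrow> 'a set \<Rightarrow> 'a set
    \<Rightarrow> (real \<Rightarrow> ennreal) \<Rightarrow> ennreal" where
  "exit_functional K x C D \<phi> =
    (\<Sum>n. \<integral>\<^sup>+ z. indicator D (fst z) * \<phi> (snd z) \<partial>(stay_meas K x C n \<bind> step_kernel K))"

context renewal_kernel
begin

lemma step_kernel_eq: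
  "step_kernel K = (\<lambda>p. distr (K (fst p)) (borel \<Otimes>\<^sub>M borel) (\<lambda>z. (fst z, snd p + snd z)))"
  by (simp add: step_kernel_def case_prod_beta')

lemma step_kernel_measurable[measurable]:
  "step_kernel K \<in> (borel \<Otimes>\<^sub>M borel) \<rightarrow>\<^sub>M subprob_algebra (borel \<Otimes>\<^sub>M borel)"
  unfolding step_kernel_eq
  by (rule measurable_distr2[where M="borel \<Otimes>\<^sub>M borel"]) measurable

lemma nn_integral_step_kernel:
  assumes [measurable]: "F \<in> borel_measurable (borel \<Otimes>\<^sub>M borel)"
  shows "(\<integral>\<^sup>+ z. F z \<partial>step_kernel K p) = (\<integral>\<^sup>+ z. F (fst z, snd p + snd z) \<partial>K (fst p))"
  unfolding step_kernel_eq by (subst nn_integral_distr) auto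

lemma sets_stay_meas[simp, measurable_cong]:
  "sets (stay_meas K x C n) = sets (borel \<Otimes>\<^sub>M borel)"
proof (induction n)
  case (Suc n)
  then have "space (stay_meas K x C n) = space (borel \<Otimes>\<^sub>M borel)" by (rule sets_eq_imp_space_eq)
  then have ne: "space (stay_meas K x C n) \<noteq> {}" by (simp add: space_pair_measure)
  have "sets (stay_meas K x C n \<bind> step_kernel K) = sets (borel \<Otimes>\<^sub>M borel)"
    by (rule sets_bind[OF _ ne]) (simp add: step_kernel_eq)
  then show ?case by simp
qed simp

lemma step_kernel_measurable_stay:
  "step_kernel K \<in> stay_meas K x C n \<rightarrow>\<^sub>M subprob_algebra (borel \<Otimes>\<^sub>M borel)"
  using step_kernel_measurable by (simp cong: measurable_cong_sets)

lemma sets_stay_bind[simp, measurable_cong]: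
  "sets (stay_meas K x C n \<bind> step_kernel K) = sets (borel \<Otimes>\<^sub>M borel)"
proof -
  have "space (stay_meas K x C n) = space (borel \<Otimes>\<^sub>M borel)"
    by (rule sets_eq_imp_space_eq) simp
  then show ?thesis
    using step_kernel_measurable_stay
    by (intro sets_bind) (auto simp: space_pair_measure step_kernel_eq)
qed

lemma nn_integral_stay_bind:
  assumes [measurable]: "F \<in> borel_measurable (borel \<Otimes>\<^sub>M borel)"
  shows "(\<integral>\<^sup>+ z. F z \<partial>(stay_meas K x C n \<bind> step_kernel K))
    = (\<integral>\<^sup>+ p. \<integral>\<^sup>+ z. F (fst z, snd p + snd z) \<partial>K (fst p) \<partial>stay_meas K x C n)"
  by (subst nn_integral_bind[OF assms step_kernel_measurable_stay])
     (simp add: nn_integral_step_kernel)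

text \<open>Since \<open>w\<close> is multiplicative, the weight of the accumulated time is the
  product of the weights of the single steps, and the last step can be absorbed into
  \<open>f\<close>; hence the induction with \<open>f\<close> arbitrary.\<close>

lemma nn_integral_stay:
  assumes [measurable]: "C \<in> sets borel" "w \<in> borel_measurable borel" "f \<in> borel_measurable borel"
    and w: "w 0 = 1" "\<And>s t. w (s + t) = w s * w t"
  shows "(\<integral>\<^sup>+ z. w (snd z) * f (fst z) \<partial>stay_meas K x C n) = (kop K C w ^^ n) f x"
  using assms(3)
proof (induction n arbitrary: f)
  case 0
  note [measurable] = 0
  show ?case by (simp add: nn_integral_return w space_pair_measure)
next
  case (Suc n)
  note [measurable] = Suc.prems
  have "(\<integral>\<^sup>+ z. w (snd z) * f (fst z) \<partial>stay_meas K x C (Suc n))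
      = (\<integral>\<^sup>+ z. indicator C (fst z) * (w (snd z) * f (fst z)) \<partial>(stay_meas K x C n \<bind> step_kernel K))"
    by (simp add: nn_integral_density)
       (intro nn_integral_cong, auto simp: indicator_def split: prod.splits)
  also have "\<dots> = (\<integral>\<^sup>+ p. w (snd p) * kop K C w f (fst p) \<partial>stay_meas K x C n)"
    unfolding kop_def
    by (simp add: nn_integral_stay_bind w nn_integral_cmult[symmetric] mult_ac)
  also have "\<dots> = (kop K C w ^^ n) (kop K C w f) x"
    by (rule Suc.IH) measurable
  finally show ?case by (simp add: funpow_swap1)
qed

lemma expected_visits_eq:
  assumes [measurable]: "C \<in> sets borel" "B \<in> sets borel"
  shows "expected_visits K x C B = pot K C one (indicator B) x"
proof -
  have "emeasure (stay_meas K x C n) (B \<times> UNIV) = (kop K C one ^^ n) (indicator B) x" for n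
  proof -
    have "emeasure (stay_meas K x C n) (B \<times> UNIV)
        = (\<integral>\<^sup>+ z. indicator (B \<times> UNIV) z \<partial>stay_meas K x C n)" by simp
    also have "\<dots> = (\<integral>\<^sup>+ z. 1 * indicator B (fst z) \<partial>stay_meas K x C n)"
      by (intro nn_integral_cong) (auto simp: indicator_def split: prod.splits)
    also have "\<dots> = (kop K C one ^^ n) (indicator B) x"
      by (rule nn_integral_stay) auto
    finally show ?thesis .
  qed
  then show ?thesis by (simp add: expected_visits_def pot_def)
qed

lemma exit_functional_laplace:
  assumes [measurable]: "C \<in> sets borel" "D \<in> sets borel" "w \<in> borel_measurable borel"
    and w: "w 0 = 1" "\<And>s t. w (s + t) = w s * w t"
  shows "exit_functional K x C D w = pot K C w (kop K D w one) x"
proof -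
  have "(\<integral>\<^sup>+ z. indicator D (fst z) * w (snd z) \<partial>(stay_meas K x C n \<bind> step_kernel K))
      = (kop K C w ^^ n) (kop K D w one) x" for n
  proof -
    have "(\<integral>\<^sup>+ z. indicator D (fst z) * w (snd z) \<partial>(stay_meas K x C n \<bind> step_kernel K))
        = (\<integral>\<^sup>+ p. w (snd p) * kop K D w one (fst p) \<partial>stay_meas K x C n)"
      unfolding kop_def
      by (simp add: nn_integral_stay_bind w nn_integral_cmult[symmetric] mult_ac)
    also have "\<dots> = (kop K C w ^^ n) (kop K D w one) x"
      by (rule nn_integral_stay) (auto simp: w)
    finally show ?thesis .
  qed
  then show ?thesis by (simp add: exit_functional_def pot_def)
qed

text \<open>Places \<open>exp (- s / c)\<close> in the unit interval almost surely, the only range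
  on which the approximating polynomials are controlled.\<close>

lemma AE_stay_nonneg:
  assumes [measurable]: "C \<in> sets borel"
  shows "AE z in (stay_meas K x C n \<bind> step_kernel K). 0 \<le> snd z"
proof -
  have step: "AE z in (stay_meas K x C n \<bind> step_kernel K). 0 \<le> snd z"
    if "AE z in stay_meas K x C n. 0 \<le> snd z" for n
  proof -
    have "(\<integral>\<^sup>+ z. indicator {..<0} (snd z) \<partial>(stay_meas K x C n \<bind> step_kernel K))
        = (\<integral>\<^sup>+ p. \<integral>\<^sup>+ z. indicator {..<0} (snd p + snd z) \<partial>K (fst p) \<partial>stay_meas K x C n)"
      by (subst nn_integral_stay_bind) auto
    also have "\<dots> = (\<integral>\<^sup>+ p. 0 \<partial>stay_meas K x C n)"
    proof (rule nn_integral_cong_AE[OF AE_mp[OF that AE_I2[OF impI]]])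
      fix p :: "'a \<times> real" assume p: "0 \<le> snd p"
      have "(\<integral>\<^sup>+ z. indicator {..<0} (snd p + snd z) \<partial>K (fst p)) = (\<integral>\<^sup>+ z. 0 \<partial>K (fst p))"
        using p by (intro nn_integral_cong_AE[OF AE_mp[OF AE_time_nonneg AE_I2[OF impI]]]) auto
      then show "(\<integral>\<^sup>+ z. indicator {..<0} (snd p + snd z) \<partial>K (fst p)) = (0::ennreal)" by simp
    qed
    finally have "(\<integral>\<^sup>+ z. indicator {..<0} (snd z) \<partial>(stay_meas K x C n \<bind> step_kernel K)) = 0"
      by simp
    then have "AE z in (stay_meas K x C n \<bind> step_kernel K). indicator {..<0} (snd z) = (0::ennreal)"
      by (subst (asm) nn_integral_0_iff_AE) auto
    then show ?thesis by eventually_elim (auto simp: indicator_def split: if_splits)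
  qed
  have "AE z in stay_meas K x C n. 0 \<le> snd z" for n
  proof (induction n)
    case 0
    have "AE z in return (borel \<Otimes>\<^sub>M borel) (x, 0::real). 0 \<le> snd z"
      by (subst AE_return) (auto simp: space_pair_measure)
    then show ?case by (simp only: stay_meas.simps)
  next
    case (Suc n)
    have "AE z in (stay_meas K x C n \<bind> step_kernel K). 0 < (indicator (C \<times> UNIV) z :: ennreal) \<longrightarrow> 0 \<le> snd z"
      using step[OF Suc] by eventually_elim simp
    then show ?case unfolding stay_meas.simps by (subst AE_density) auto
  qed
  from step[OF this] show ?thesis .
qed

lemma exit_functional_mono:
  assumes [measurable]: "C \<in> sets borel" and le: "\<And>s. 0 \<le> s \<Longrightarrow> \<phi> s \<le> \<psi> s"
  shows "exit_functional K x C D \<phi> \<le> exit_functional K x C D \<psi>"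
  unfolding exit_functional_def
proof (intro suminf_le summableI nn_integral_mono_AE)
  fix n show "AE z in (stay_meas K x C n \<bind> step_kernel K).
      indicator D (fst z) * \<phi> (snd z) \<le> indicator D (fst z) * \<psi> (snd z)"
    using AE_stay_nonneg[OF assms(1)] by eventually_elim (use le in \<open>auto intro: mult_left_mono\<close>)
qed

lemma exit_functional_add:
  assumes [measurable]: "D \<in> sets borel" "\<phi> \<in> borel_measurable borel" "\<psi> \<in> borel_measurable borel"
  shows "exit_functional K x C D (\<lambda>s. \<phi> s + \<psi> s)
    = exit_functional K x C D \<phi> + exit_functional K x C D \<psi>"
  unfolding exit_functional_def
  by (simp add: distrib_left nn_integral_add suminf_add[symmetric] summableI)

lemma exit_functional_cmult:
  assumes [measurable]: "D \<in> sets borel" "\<phi> \<in> borel_measurable borel"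
  shows "exit_functional K x C D (\<lambda>s. a * \<phi> s) = a * exit_functional K x C D \<phi>"
  unfolding exit_functional_def
  by (simp add: mult.left_commute[of _ a] nn_integral_cmult)

lemma exit_functional_sum:
  assumes [measurable]: "D \<in> sets borel" "\<And>i. \<phi> i \<in> borel_measurable borel" and "finite I"
  shows "exit_functional K x C D (\<lambda>s. \<Sum>i\<in>I. \<phi> i s) = (\<Sum>i\<in>I. exit_functional K x C D (\<phi> i))"
  using assms(3)
proof (induction I rule: finite_induct)
  case empty
  show ?case using exit_functional_cmult[of D one x C 0] by simp
next
  case (insert i I)
  then show ?case by (simp add: exit_functional_add)
qed

lemma exit_prob_eq:
  assumes [measurable]: "D \<in> sets borel" "A \<in> sets borel" and dis: "D \<inter> C = {}"
  shows "exit_prob K x C (D \<times> A) = enn2real (exit_functional K x C D (indicator A))"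
proof -
  have "emeasure (stay_meas K x C n \<bind> step_kernel K) (D \<times> A \<inter> (- C) \<times> UNIV)
      = (\<integral>\<^sup>+ z. indicator D (fst z) * indicator A (snd z) \<partial>(stay_meas K x C n \<bind> step_kernel K))" for n
  proof -
    have "D \<times> A \<inter> (- C) \<times> UNIV = D \<times> A" using dis by auto
    then have "emeasure (stay_meas K x C n \<bind> step_kernel K) (D \<times> A \<inter> (- C) \<times> UNIV)
      = (\<integral>\<^sup>+ z. indicator (D \<times> A) z \<partial>(stay_meas K x C n \<bind> step_kernel K))" by simp
    also have "\<dots> = (\<integral>\<^sup>+ z. indicator D (fst z) * indicator A (snd z) \<partial>(stay_meas K x C n \<bind> step_kernel K))"
      by (intro nn_integral_cong) (auto simp: indicator_def split: prod.splits)
    finally show ?thesis .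
  qed
  then show ?thesis by (simp add: exit_prob_def exit_functional_def)
qed

end

section \<open>Convergence from moments\<close>

lemma unif_tendstoD:
  "unif_tendsto F L A \<Longrightarrow> 0 < \<delta> \<Longrightarrow> eventually (\<lambda>eps. \<forall>x\<in>A. \<bar>F eps x - L\<bar> < \<delta>) (at_right 0)"
  by (simp add: unif_tendsto_def)

text \<open>\<open>\<Sum>i\<le>N. a i / (real i + 1)\<close> is the integral of the polynomial over
  the unit interval, written in terms of the moments of the uniform law so that the limit of moments
  can be inserted directly.\<close>

lemma polynomial_approx_integral:
  fixes g :: "real \<Rightarrow> real"
  assumes g: "continuous_on {0..1} g" and \<eta>: "0 < \<eta>"
  obtains a N where "\<And>v. v \<in> {0..1} \<Longrightarrow> \<bar>g v - (\<Sum>i\<le>N. a i * v ^ i)\<bar> < \<eta>"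
    "\<bar>integral {0..1} g - (\<Sum>i\<le>N. a i / (real i + 1))\<bar> \<le> \<eta>"
proof -
  obtain q where q: "real_polynomial_function q" "\<And>v. v \<in> {0..1} \<Longrightarrow> \<bar>g v - q v\<bar> < \<eta>"
    using Stone_Weierstrass_real_polynomial_function[OF compact_Icc g \<eta>] by blast
  then obtain a N where a: "q = (\<lambda>x. \<Sum>i\<le>N. a i * x ^ i)"
    using real_polynomial_function_iff_sum by blast
  have "((\<lambda>x. \<Sum>i\<le>N. a i * x ^ i) has_integral (\<Sum>i\<le>N. a i / (real i + 1))) {0..1::real}"
  proof (rule has_integral_sum)
    fix i
    have "((\<lambda>x. x ^ i) has_integral (1 ^ Suc i / real (Suc i) - 0 ^ Suc i / real (Suc i))) {0..1::real}"
      by (rule fundamental_theorem_of_calculus)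
         (auto simp: has_real_derivative_iff_has_vector_derivative[symmetric]
               simp del: of_nat_Suc power_Suc intro!: derivative_eq_intros)
    then have "((\<lambda>x. a i * x ^ i) has_integral a i * (1 / (real i + 1))) {0..1::real}"
      by (intro has_integral_mult_right) (simp add: add.commute)
    then show "((\<lambda>x. a i * x ^ i) has_integral (a i / (real i + 1))) {0..1::real}" by simp
  qed simp
  then have qi: "(q has_integral (\<Sum>i\<le>N. a i / (real i + 1))) {0..1}" by (simp add: a)
  have gi: "(g has_integral integral {0..1} g) {0..1}"
    using integrable_continuous_real[OF g] by (rule integrable_integral)
  have "norm (integral {0..1} g - (\<Sum>i\<le>N. a i / (real i + 1))) \<le> \<eta> * measure lborel {0..1::real}"
  proof (rule has_integral_bound[OF _ has_integral_diff[OF gi qi, unfolded cbox_interval[symmetric]], unfolded cbox_interval])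
    show "norm (g v - q v) \<le> \<eta>" if "v \<in> {0..1}" for v using q(2)[OF that] by simp
  qed (use \<eta> in simp)
  then show ?thesis using that[of a N] q(2) by (simp add: a)
qed

lemma integral_le_step:
  fixes g :: "real \<Rightarrow> real"
  assumes g: "continuous_on {0..1} g" and e: "0 \<le> e" "e \<le> 1"
    and g1: "\<And>v. v \<in> {0..1} \<Longrightarrow> g v \<le> 1" and g0: "\<And>v. e \<le> v \<Longrightarrow> v \<le> 1 \<Longrightarrow> g v \<le> 0"
  shows "integral {0..1} g \<le> e"
proof -
  have int: "g integrable_on {0..1}" using g by (rule integrable_continuous_real)
  have "integral {0..1} g = integral {0..e} g + integral {e..1} g"
    using Henstock_Kurzweil_Integration.integral_combine[OF e int] by simp
  also have "integral {0..e} g \<le> integral {0..e} (\<lambda>_. 1)"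
    using e g1 by (intro integral_le integrable_subinterval_real[OF int]) auto
  also have "integral {e..1} g \<le> integral {e..1} (\<lambda>_. 0)"
    using e g0 by (intro integral_le integrable_subinterval_real[OF int]) auto
  finally show ?thesis using e by simp
qed

lemma integral_ge_step:
  fixes g :: "real \<Rightarrow> real"
  assumes g: "continuous_on {0..1} g" and e: "0 \<le> e" "e \<le> 1"
    and g1: "\<And>v. v \<in> {0..1} \<Longrightarrow> 0 \<le> g v" and g0: "\<And>v. 0 \<le> v \<Longrightarrow> v \<le> e \<Longrightarrow> 1 \<le> g v"
  shows "e \<le> integral {0..1} g"
proof -
  have int: "g integrable_on {0..1}" using g by (rule integrable_continuous_real)
  have "integral {0..e} (\<lambda>_. 1) \<le> integral {0..e} g"
    using e g0 by (intro integral_le integrable_subinterval_real[OF int]) auto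
  moreover have "integral {e..1} (\<lambda>_. 0) \<le> integral {e..1} g"
    using e g1 by (intro integral_le integrable_subinterval_real[OF int]) auto
  moreover have "integral {0..1} g = integral {0..e} g + integral {e..1} g"
    using Henstock_Kurzweil_Integration.integral_combine[OF e int] by simp
  ultimately show ?thesis using e by simp
qed

text \<open>A constant shift changes only the coefficient of degree 0, so an approximant moved to
  one side is again given by a coefficient list.\<close>

lemma sum_shift_coeff:
  fixes a :: "nat \<Rightarrow> real"
  shows "(\<Sum>i\<le>N. (a(0 := a 0 + z)) i * y i) = (\<Sum>i\<le>N. a i * y i) + z * y 0"
proof -
  have "(\<Sum>i\<le>N. (a(0 := a 0 + z)) i * y i) = (\<Sum>i\<le>N. a i * y i + (if i = 0 then z * y 0 else 0))"
    by (intro sum.cong) (auto simp: algebra_simps)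
  then show ?thesis by (simp add: sum.distrib)
qed

lemma sum_shift_coeff_moment:
  fixes a :: "nat \<Rightarrow> real"
  shows "(\<Sum>i\<le>N. (a(0 := a 0 + z)) i / (real i + 1)) = (\<Sum>i\<le>N. a i / (real i + 1)) + z"
  using sum_shift_coeff[of a z "\<lambda>i. 1 / (real i + 1)" N] by simp

text \<open>The error \<delta> is spent in three equal parts: replacing the step by a ramp of width
  \<open>\<delta> / 3\<close>, approximating the ramp by a polynomial, and shifting the polynomial
  so that it lies on one side of the step.\<close>

lemma polynomial_step_bounds:
  fixes b \<delta> :: real
  assumes b: "0 \<le> b" "b \<le> 1" and \<delta>: "0 < \<delta>"
  shows "\<exists>a N. (\<forall>v\<in>{0..1}. indicator {..b} v \<le> (\<Sum>i\<le>N. a i * v ^ i)) \<and>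
      (\<Sum>i\<le>N. a i / (real i + 1)) \<le> b + \<delta>"
    and "\<exists>a N. (\<forall>v\<in>{0..1}. (\<Sum>i\<le>N. a i * v ^ i) \<le> indicator {..b} v) \<and>
      b - \<delta> \<le> (\<Sum>i\<le>N. a i / (real i + 1))"
proof -
  define \<eta> where "\<eta> = \<delta> / 3"
  have \<eta>: "0 < \<eta>" using \<delta> by (simp add: \<eta>_def)
  define g where "g v = max 0 (min 1 ((b + \<eta> - v) / \<eta>))" for v
  have gc: "continuous_on {0..1} g" unfolding g_def using \<eta> by (intro continuous_intros) auto
  obtain a N where a: "\<And>v. v \<in> {0..1} \<Longrightarrow> \<bar>g v - (\<Sum>i\<le>N. a i * v ^ i)\<bar> < \<eta>"
    "\<bar>integral {0..1} g - (\<Sum>i\<le>N. a i / (real i + 1))\<bar> \<le> \<eta>"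
    using polynomial_approx_integral[OF gc \<eta>] by blast
  have "integral {0..1} g \<le> b + \<eta>"
  proof (cases "b + \<eta> \<le> 1")
    case True
    then show ?thesis
      using \<eta> b by (intro integral_le_step[OF gc]) (auto simp: g_def divide_nonpos_pos)
  next
    \<comment> \<open>The ramp reaches beyond the unit interval, but then the trivial bound 1 on the
      integral is already below \<open>b + \<eta>\<close>.\<close>
    case False
    have "integral {0..1} g \<le> integral {0..1::real} (\<lambda>_. 1)"
      using gc by (intro integral_le integrable_continuous_real) (auto simp: g_def)
    then show ?thesis using False by simp
  qed
  then have "(\<Sum>i\<le>N. (a(0 := a 0 + \<eta>)) i / (real i + 1)) \<le> b + \<delta>"
    using a(2) unfolding sum_shift_coeff_moment \<eta>_def by linarith
  moreover have "indicator {..b} v \<le> (\<Sum>i\<le>N. (a(0 := a 0 + \<eta>)) i * v ^ i)" if "v \<in> {0..1}" for v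
  proof -
    have "indicator {..b} v \<le> g v" using \<eta> by (auto simp: g_def indicator_def field_simps)
    then show ?thesis using a(1)[OF that] unfolding sum_shift_coeff by simp
  qed
  ultimately show "\<exists>a N. (\<forall>v\<in>{0..1}. indicator {..b} v \<le> (\<Sum>i\<le>N. a i * v ^ i)) \<and>
      (\<Sum>i\<le>N. a i / (real i + 1)) \<le> b + \<delta>" by blast
next
  define \<eta> where "\<eta> = \<delta> / 3"
  have \<eta>: "0 < \<eta>" using \<delta> by (simp add: \<eta>_def)
  define g where "g v = max 0 (min 1 ((b - v) / \<eta>))" for v
  have gc: "continuous_on {0..1} g" unfolding g_def using \<eta> by (intro continuous_intros) auto
  obtain a N where a: "\<And>v. v \<in> {0..1} \<Longrightarrow> \<bar>g v - (\<Sum>i\<le>N. a i * v ^ i)\<bar> < \<eta>"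
    "\<bar>integral {0..1} g - (\<Sum>i\<le>N. a i / (real i + 1))\<bar> \<le> \<eta>"
    using polynomial_approx_integral[OF gc \<eta>] by blast
  have "b - \<eta> \<le> integral {0..1} g"
  proof (cases "b \<le> \<eta>")
    case True
    have "0 \<le> integral {0..1} g" using gc
      by (intro integral_nonneg integrable_continuous_real) (auto simp: g_def)
    then show ?thesis using True by linarith
  next
    case False
    then show ?thesis using \<eta> b
      by (intro integral_ge_step[OF gc]) (auto simp: g_def field_simps)
  qed
  then have "b - \<delta> \<le> (\<Sum>i\<le>N. (a(0 := a 0 + - \<eta>)) i / (real i + 1))"
    using a(2) unfolding sum_shift_coeff_moment \<eta>_def by linarith
  moreover have "(\<Sum>i\<le>N. (a(0 := a 0 + - \<eta>)) i * v ^ i) \<le> indicator {..b} v" if "v \<in> {0..1}" for v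
  proof -
    have "g v \<le> indicator {..b} v"
      using \<eta> by (auto simp: g_def indicator_def divide_nonpos_pos)
    then show ?thesis using a(1)[OF that] unfolding sum_shift_coeff by simp
  qed
  ultimately show "\<exists>a N. (\<forall>v\<in>{0..1}. (\<Sum>i\<le>N. a i * v ^ i) \<le> indicator {..b} v) \<and>
      b - \<delta> \<le> (\<Sum>i\<le>N. a i / (real i + 1))" by blast
qed

text \<open>The moments \<open>1 / (n + 1)\<close> are those of the uniform law on the unit interval, which determine
  it by the Weierstrass approximation theorem.\<close>

lemma unif_tendsto_of_uniform_moments:
  fixes \<mu> :: "nat \<Rightarrow> real \<Rightarrow> 'b \<Rightarrow> real"
  assumes mom: "\<And>i. unif_tendsto (\<mu> i) (1 / (real i + 1)) A"
    and b: "0 \<le> b" "b \<le> 1"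
    and up: "\<And>a N. (\<And>v. v \<in> {0..1} \<Longrightarrow> indicator {..b} v \<le> (\<Sum>i\<le>N. a i * v ^ i)) \<Longrightarrow>
        eventually (\<lambda>eps. \<forall>x\<in>A. F eps x \<le> (\<Sum>i\<le>N. a i * \<mu> i eps x)) (at_right 0)"
    and lo: "\<And>a N. (\<And>v. v \<in> {0..1} \<Longrightarrow> (\<Sum>i\<le>N. a i * v ^ i) \<le> indicator {..b} v) \<Longrightarrow>
        eventually (\<lambda>eps. \<forall>x\<in>A. (\<Sum>i\<le>N. a i * \<mu> i eps x) \<le> F eps x) (at_right 0)"
  shows "unif_tendsto F b A"
  unfolding unif_tendsto_def
proof (intro allI impI)
  fix \<delta> :: real assume \<delta>: "0 < \<delta>"
  have close: "eventually (\<lambda>eps. \<forall>x\<in>A. \<bar>(\<Sum>i\<le>N. a i * \<mu> i eps x) - (\<Sum>i\<le>N. a i / (real i + 1))\<bar> < \<delta> / 2)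
      (at_right 0)" for a :: "nat \<Rightarrow> real" and N
  proof -
    \<comment> \<open>The summand 1 keeps \<open>s\<close> positive even if all coefficients vanish,
      and makes the final inequality strict.\<close>
    define s where "s = 1 + (\<Sum>i\<le>N. \<bar>a i\<bar>)"
    have s: "0 < s" unfolding s_def by (simp add: add_pos_nonneg sum_nonneg)
    have "eventually (\<lambda>eps. \<forall>i\<in>{..N}. \<forall>x\<in>A. \<bar>\<mu> i eps x - 1 / (real i + 1)\<bar> < \<delta> / (2 * s)) (at_right 0)"
      using s \<delta> by (intro eventually_ball_finite ballI unif_tendstoD[OF mom]) auto
    then show ?thesis
    proof eventually_elim
      fix eps assume H: "\<forall>i\<in>{..N}. \<forall>x\<in>A. \<bar>\<mu> i eps x - 1 / (real i + 1)\<bar> < \<delta> / (2 * s)"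
      show "\<forall>x\<in>A. \<bar>(\<Sum>i\<le>N. a i * \<mu> i eps x) - (\<Sum>i\<le>N. a i / (real i + 1))\<bar> < \<delta> / 2"
      proof
        fix x assume x: "x \<in> A"
        have "\<bar>(\<Sum>i\<le>N. a i * \<mu> i eps x) - (\<Sum>i\<le>N. a i / (real i + 1))\<bar>
            = \<bar>\<Sum>i\<le>N. a i * (\<mu> i eps x - 1 / (real i + 1))\<bar>"
          by (simp add: sum_subtractf right_diff_distrib)
        also have "\<dots> \<le> (\<Sum>i\<le>N. \<bar>a i\<bar> * (\<delta> / (2 * s)))"
        proof (intro order_trans[OF sum_abs] sum_mono)
          fix i assume "i \<in> {..N}"
          then have "\<bar>\<mu> i eps x - 1 / (real i + 1)\<bar> \<le> \<delta> / (2 * s)" using H x by (auto intro: less_imp_le)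
          then show "\<bar>a i * (\<mu> i eps x - 1 / (real i + 1))\<bar> \<le> \<bar>a i\<bar> * (\<delta> / (2 * s))"
            unfolding abs_mult by (rule mult_left_mono) simp
        qed
        also have "\<dots> = (s - 1) * (\<delta> / (2 * s))" unfolding s_def by (simp only: sum_distrib_right[symmetric]) simp
        also have "\<dots> < s * (\<delta> / (2 * s))" using s \<delta> by (intro mult_strict_right_mono) auto
        also have "\<dots> = \<delta> / 2" using s by simp
        finally show "\<bar>(\<Sum>i\<le>N. a i * \<mu> i eps x) - (\<Sum>i\<le>N. a i / (real i + 1))\<bar> < \<delta> / 2" .
      qed
    qed
  qed
  obtain a N where a: "\<And>v. v \<in> {0..1} \<Longrightarrow> indicator {..b} v \<le> (\<Sum>i\<le>N. a i * v ^ i)"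
      "(\<Sum>i\<le>N. a i / (real i + 1)) \<le> b + \<delta> / 2"
    using polynomial_step_bounds(1)[OF b, of "\<delta> / 2"] \<delta> by (metis half_gt_zero)
  obtain a' N' where a': "\<And>v. v \<in> {0..1} \<Longrightarrow> (\<Sum>i\<le>N'. a' i * v ^ i) \<le> indicator {..b} v"
      "b - \<delta> / 2 \<le> (\<Sum>i\<le>N'. a' i / (real i + 1))"
    using polynomial_step_bounds(2)[OF b, of "\<delta> / 2"] \<delta> by (metis half_gt_zero)
  have u: "eventually (\<lambda>eps. \<forall>x\<in>A. F eps x \<le> (\<Sum>i\<le>N. a i * \<mu> i eps x)) (at_right 0)"
    by (rule up) (rule a(1))
  have l: "eventually (\<lambda>eps. \<forall>x\<in>A. (\<Sum>i\<le>N'. a' i * \<mu> i eps x) \<le> F eps x) (at_right 0)"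
    by (rule lo) (rule a'(1))
  show "eventually (\<lambda>eps. \<forall>x\<in>A. \<bar>F eps x - b\<bar> < \<delta>) (at_right 0)"
    using u l close[where a=a and N=N] close[where a=a' and N=N']
  proof eventually_elim
    case (elim eps)
    show ?case
    proof
      fix x assume x: "x \<in> A"
      note elim = elim[THEN bspec, OF x]
      show "\<bar>F eps x - b\<bar> < \<delta>" using elim a(2) a'(2) by linarith
    qed
  qed
qed

section \<open>Tails of the exit time between polynomials in \<open>exp (- s / c)\<close>\<close>

context renewal_kernel
begin

lemma exit_functional_polynomial_bounds:
  fixes a :: "nat \<Rightarrow> real"
  assumes [measurable]: "C \<in> sets borel" "D \<in> sets borel" and c: "0 < c"
    and fin: "\<And>i. exit_functional K x C D (\<lambda>s. ennreal (exp (- (real i * s / c)))) < \<infinity>"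
  defines "\<mu> \<equiv> \<lambda>i. enn2real (exit_functional K x C D (\<lambda>s. ennreal (exp (- (real i * s / c)))))"
  shows "(\<And>v. v \<in> {0..1} \<Longrightarrow> indicator {..exp (- t)} v \<le> (\<Sum>i\<le>N. a i * v ^ i)) \<Longrightarrow>
      enn2real (exit_functional K x C D (indicator {s. t \<le> s / c})) \<le> (\<Sum>i\<le>N. a i * \<mu> i)"
    and "(\<And>v. v \<in> {0..1} \<Longrightarrow> (\<Sum>i\<le>N. a i * v ^ i) \<le> indicator {..exp (- t)} v) \<Longrightarrow>
      (\<Sum>i\<le>N. a i * \<mu> i) \<le> enn2real (exit_functional K x C D (indicator {s. t \<le> s / c}))"
proof -
  let ?L = "exit_functional K x C D" and ?A = "{s. t \<le> s / c}"
  define V where "V i s = exp (- (real i * s / c))" for i s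
  have [measurable]: "?A \<in> sets borel" by measurable
  have [measurable]: "V i \<in> borel_measurable borel" for i unfolding V_def by measurable
  have Vpow: "V i s = V 1 s ^ i" for i s by (simp add: V_def exp_of_nat_mult[symmetric])
  have V01: "V 1 s \<in> {0..1}" if "0 \<le> s" for s using that c by (simp add: V_def)
  \<comment> \<open>The tail event in \<open>s\<close> is the event that \<open>V 1 s\<close> is at
    most \<open>exp (- t)\<close>, so a polynomial bound on the indicator of
    \<open>{..exp (- t)}\<close> becomes one on the tail in terms of the functions
    \<open>V i\<close>.\<close>
  have ind: "indicator ?A s = (indicator {..exp (- t)} (V 1 s) :: real)" for s
    by (auto simp: V_def indicator_def)
  have mu: "?L (\<lambda>s. ennreal (V i s)) = ennreal (\<mu> i)" for i
    using fin[of i] by (simp add: \<mu>_def V_def)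
  have mu0: "0 \<le> \<mu> i" for i by (simp add: \<mu>_def)
  have "?L (indicator ?A) \<le> ?L (\<lambda>s. ennreal (V 0 s))"
    by (rule exit_functional_mono) (auto simp: V_def indicator_def)
  then have Ifin: "?L (indicator ?A) = ennreal (enn2real (?L (indicator ?A)))"
    unfolding mu by (rule ennreal_finite_enn2real)
  define I where "I = enn2real (?L (indicator ?A))"
  have I0: "0 \<le> I" by (simp add: I_def)
  have LS: "?L (\<lambda>s. ennreal (\<Sum>i\<le>N. g i * V i s)) = ennreal (\<Sum>i\<le>N. g i * \<mu> i)"
    if g: "\<And>i. 0 \<le> g i" for g
  proof -
    have "?L (\<lambda>s. ennreal (\<Sum>i\<le>N. g i * V i s)) = ?L (\<lambda>s. \<Sum>i\<le>N. ennreal (g i) * ennreal (V i s))"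
      using g by (intro arg_cong[of _ _ ?L] ext) (simp add: sum_ennreal[symmetric] ennreal_mult V_def del: sum_ennreal)
    also have "\<dots> = (\<Sum>i\<le>N. ennreal (g i) * ennreal (\<mu> i))"
      by (subst exit_functional_sum) (auto simp: exit_functional_cmult mu)
    also have "\<dots> = ennreal (\<Sum>i\<le>N. g i * \<mu> i)"
      using g mu0 by (simp add: sum_ennreal[symmetric] ennreal_mult del: sum_ennreal)
    finally show ?thesis .
  qed
  \<comment> \<open>In \<open>ennreal\<close> only nonnegative combinations can be integrated, so
    the coefficients are split by sign and the negative half is moved to the other side of the
    inequality.\<close>
  define P M where "P i = max 0 (a i)" and "M i = max 0 (- a i)" for i
  have PM: "0 \<le> P i" "0 \<le> M i" "a i = P i - M i" for i by (auto simp: P_def M_def max_def)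
  have split: "(\<Sum>i\<le>N. a i * y i) = (\<Sum>i\<le>N. P i * y i) - (\<Sum>i\<le>N. M i * y i)" for y
    by (simp add: PM(3) left_diff_distrib sum_subtractf)
  have nn: "0 \<le> (\<Sum>i\<le>N. g i * V i s)" "0 \<le> (\<Sum>i\<le>N. g i * \<mu> i)" if "\<And>i. 0 \<le> g i" for g s
    using that mu0 by (auto intro!: sum_nonneg simp: V_def)
  have indr: "indicator ?A s = ennreal (indicator {..exp (- t)} (V 1 s))" for s
    unfolding ind[symmetric] by (simp add: indicator_def)
  have LM: "?L (\<lambda>s. indicator ?A s + ennreal (\<Sum>i\<le>N. M i * V i s)) = ennreal I + ennreal (\<Sum>i\<le>N. M i * \<mu> i)"
    by (subst exit_functional_add) (auto simp: LS PM Ifin[folded I_def])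
  {
    assume up: "\<And>v. v \<in> {0..1} \<Longrightarrow> indicator {..exp (- t)} v \<le> (\<Sum>i\<le>N. a i * v ^ i)"
    have "?L (\<lambda>s. indicator ?A s + ennreal (\<Sum>i\<le>N. M i * V i s)) \<le> ?L (\<lambda>s. ennreal (\<Sum>i\<le>N. P i * V i s))"
    proof (rule exit_functional_mono)
      fix s :: real assume "0 \<le> s"
      from up[OF V01[OF this]] have "indicator {..exp (- t)} (V 1 s) + (\<Sum>i\<le>N. M i * V i s) \<le> (\<Sum>i\<le>N. P i * V i s)"
        unfolding Vpow[symmetric] split by linarith
      then show "indicator ?A s + ennreal (\<Sum>i\<le>N. M i * V i s) \<le> ennreal (\<Sum>i\<le>N. P i * V i s)"
        using nn PM unfolding indr by (simp add: ennreal_plus[symmetric] del: ennreal_plus)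
    qed simp
    then have "ennreal I + ennreal (\<Sum>i\<le>N. M i * \<mu> i) \<le> ennreal (\<Sum>i\<le>N. P i * \<mu> i)"
      unfolding LM LS[OF PM(1)] .
    then show "I \<le> (\<Sum>i\<le>N. a i * \<mu> i)"
      using nn PM I0 unfolding split by (simp add: ennreal_plus[symmetric] del: ennreal_plus)
  }
  {
    assume lo: "\<And>v. v \<in> {0..1} \<Longrightarrow> (\<Sum>i\<le>N. a i * v ^ i) \<le> indicator {..exp (- t)} v"
    have "?L (\<lambda>s. ennreal (\<Sum>i\<le>N. P i * V i s)) \<le> ?L (\<lambda>s. indicator ?A s + ennreal (\<Sum>i\<le>N. M i * V i s))"
    proof (rule exit_functional_mono)
      fix s :: real assume "0 \<le> s"
      from lo[OF V01[OF this]] have "(\<Sum>i\<le>N. P i * V i s) \<le> indicator {..exp (- t)} (V 1 s) + (\<Sum>i\<le>N. M i * V i s)"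
        unfolding Vpow[symmetric] split by linarith
      then show "ennreal (\<Sum>i\<le>N. P i * V i s) \<le> indicator ?A s + ennreal (\<Sum>i\<le>N. M i * V i s)"
        using nn PM unfolding indr by (simp add: ennreal_plus[symmetric] del: ennreal_plus)
    qed simp
    then have "ennreal (\<Sum>i\<le>N. P i * \<mu> i) \<le> ennreal I + ennreal (\<Sum>i\<le>N. M i * \<mu> i)"
      unfolding LM LS[OF PM(1)] .
    then show "(\<Sum>i\<le>N. a i * \<mu> i) \<le> I"
      using nn PM I0 unfolding split by (simp add: ennreal_plus[symmetric] del: ennreal_plus)
  }
qed

end

section \<open>Limits along the hierarchy\<close>

definition ratio_prod :: "(real \<Rightarrow> nat \<Rightarrow> nat \<Rightarrow> real) \<Rightarrow> (nat \<times> nat \<times> nat) list \<Rightarrow> real \<Rightarrow> real" where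
  "ratio_prod p trs eps = (\<Prod>(a, b, d)\<leftarrow>trs. p eps a b / p eps a d)"

text \<open>Numerators as well as denominators are required to be positive, whereas (f) asks only
  that the denominators not vanish identically; exchanging the two then inverts a monomial within
  the same class.\<close>

definition ratio_list :: "nat \<Rightarrow> (real \<Rightarrow> nat \<Rightarrow> nat \<Rightarrow> real) \<Rightarrow> (nat \<times> nat \<times> nat) list \<Rightarrow> bool" where
  "ratio_list M p trs \<longleftrightarrow> (\<forall>(a, b, d)\<in>set trs. a \<in> {1..M} \<and> b \<in> {1..M} \<and> d \<in> {1..M} \<and>
      (\<forall>eps>0. 0 < p eps a b \<and> 0 < p eps a d))"

text \<open>Positive functions asymptotic to a constant times a monomial in the ratios of (f). The
  class is closed under sums because (f) makes any two monomials comparable.\<close>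

definition regular :: "nat \<Rightarrow> (real \<Rightarrow> nat \<Rightarrow> nat \<Rightarrow> real) \<Rightarrow> (real \<Rightarrow> real) \<Rightarrow> bool" where
  "regular M p f \<longleftrightarrow> (\<forall>eps>0. 0 < f eps) \<and>
     (\<exists>trs c. ratio_list M p trs \<and> 0 < c \<and> ((\<lambda>eps. f eps / ratio_prod p trs eps) \<longlongrightarrow> c) (at_right 0))"

lemma eventually_at_right_pos: "eventually (\<lambda>eps. 0 < (eps::real)) (at_right 0)"
  by (simp add: eventually_at_right_less)

lemma ratio_prod_pos: "ratio_list M p trs \<Longrightarrow> 0 < eps \<Longrightarrow> 0 < ratio_prod p trs eps"
  unfolding ratio_prod_def ratio_list_def by (induction trs) auto

lemma ratio_prod_append: "ratio_prod p (xs @ ys) eps = ratio_prod p xs eps * ratio_prod p ys eps"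
  by (simp add: ratio_prod_def)

lemma ratio_prod_inverse:
  "ratio_prod p (map (\<lambda>(a, b, d). (a, d, b)) xs) eps = inverse (ratio_prod p xs eps)"
  unfolding ratio_prod_def by (induction xs) (auto simp: field_simps)

lemma regular_pos: "regular M p f \<Longrightarrow> 0 < eps \<Longrightarrow> 0 < f eps"
  by (simp add: regular_def)

lemma regularI_asymp:
  assumes g: "regular M p g" and pos: "\<And>eps. 0 < eps \<Longrightarrow> 0 < f eps"
    and lim: "((\<lambda>eps. f eps / g eps) \<longlongrightarrow> c) (at_right 0)" and c: "0 < c"
  shows "regular M p f"
proof -
  obtain trs c' where t: "ratio_list M p trs" "0 < c'"
      "((\<lambda>eps. g eps / ratio_prod p trs eps) \<longlongrightarrow> c') (at_right 0)"
    using g unfolding regular_def by blast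
  have "((\<lambda>eps. f eps / g eps * (g eps / ratio_prod p trs eps)) \<longlongrightarrow> c * c') (at_right 0)"
    by (rule tendsto_mult[OF lim t(3)])
  moreover have "eventually (\<lambda>eps. f eps / g eps * (g eps / ratio_prod p trs eps)
      = f eps / ratio_prod p trs eps) (at_right 0)"
    using eventually_at_right_pos by eventually_elim (use regular_pos[OF g] in force)
  ultimately have "((\<lambda>eps. f eps / ratio_prod p trs eps) \<longlongrightarrow> c * c') (at_right 0)"
    by (rule Lim_transform_eventually)
  then show ?thesis unfolding regular_def using pos t(1,2) c
    by (intro conjI exI[of _ trs] exI[of _ "c * c'"]) auto
qed

lemma regular_cong:
  assumes "regular M p g" "\<And>eps. 0 < eps \<Longrightarrow> f eps = g eps"
  shows "regular M p f"
proof (rule regularI_asymp[OF assms(1)])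
  have "eventually (\<lambda>eps. 1 = f eps / g eps) (at_right 0)"
    using eventually_at_right_pos
    by eventually_elim (use assms regular_pos[OF assms(1)] in force)
  from Lim_transform_eventually[OF tendsto_const this]
  show "((\<lambda>eps. f eps / g eps) \<longlongrightarrow> 1) (at_right 0)" .
qed (use assms regular_pos[OF assms(1)] in auto)

lemma regular_const: "0 < c \<Longrightarrow> regular M p (\<lambda>_. c)"
  unfolding regular_def
  by (intro conjI exI[of _ "[]"] exI[of _ c]) (auto simp: ratio_list_def ratio_prod_def)

lemma regular_ratio:
  assumes "ratio_list M p [(a, b, d)]"
  shows "regular M p (\<lambda>eps. p eps a b / p eps a d)"
  unfolding regular_def
proof (intro conjI exI[of _ "[(a, b, d)]"] exI[of _ 1] assms)
  show "\<forall>eps>0. 0 < p eps a b / p eps a d" using assms by (simp add: ratio_list_def)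
  have "eventually (\<lambda>eps. 1 = p eps a b / p eps a d / ratio_prod p [(a, b, d)] eps) (at_right 0)"
    using eventually_at_right_pos
    by eventually_elim (use assms in \<open>force simp: ratio_list_def ratio_prod_def\<close>)
  from Lim_transform_eventually[OF tendsto_const this]
  show "((\<lambda>eps. p eps a b / p eps a d / ratio_prod p [(a, b, d)] eps) \<longlongrightarrow> 1) (at_right 0)" .
qed simp

lemma regular_mult:
  assumes "regular M p f" "regular M p g"
  shows "regular M p (\<lambda>eps. f eps * g eps)"
proof -
  obtain t c where t: "ratio_list M p t" "0 < c" "((\<lambda>eps. f eps / ratio_prod p t eps) \<longlongrightarrow> c) (at_right 0)"
    using assms(1) unfolding regular_def by blast
  obtain t' c' where t': "ratio_list M p t'" "0 < c'" "((\<lambda>eps. g eps / ratio_prod p t' eps) \<longlongrightarrow> c') (at_right 0)"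
    using assms(2) unfolding regular_def by blast
  have "((\<lambda>eps. f eps * g eps / ratio_prod p (t @ t') eps) \<longlongrightarrow> c * c') (at_right 0)"
    using tendsto_mult[OF t(3) t'(3)] by (simp add: ratio_prod_append)
  moreover have "ratio_list M p (t @ t')" using t t' by (auto simp: ratio_list_def)
  ultimately show ?thesis
    unfolding regular_def using t(2) t'(2) regular_pos[OF assms(1)] regular_pos[OF assms(2)]
    by (intro conjI exI[of _ "t @ t'"] exI[of _ "c * c'"]) auto
qed

lemma regular_inverse:
  assumes "regular M p f"
  shows "regular M p (\<lambda>eps. inverse (f eps))"
proof -
  obtain t c where t: "ratio_list M p t" "0 < c" "((\<lambda>eps. f eps / ratio_prod p t eps) \<longlongrightarrow> c) (at_right 0)"
    using assms(1) unfolding regular_def by blast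
  have "((\<lambda>eps. inverse (f eps) / ratio_prod p (map (\<lambda>(a, b, d). (a, d, b)) t) eps) \<longlongrightarrow> inverse c) (at_right 0)"
    using tendsto_inverse[OF t(3)] t(2) by (simp add: ratio_prod_inverse field_simps)
  moreover have "ratio_list M p (map (\<lambda>(a, b, d). (a, d, b)) t)" using t by (force simp: ratio_list_def)
  ultimately show ?thesis
    unfolding regular_def using t(2) regular_pos[OF assms(1)]
    by (intro conjI exI[of _ "map (\<lambda>(a, b, d). (a, d, b)) t"] exI[of _ "inverse c"]) auto
qed

lemma regular_divide:
  "regular M p f \<Longrightarrow> regular M p g \<Longrightarrow> regular M p (\<lambda>eps. f eps / g eps)"
  using regular_mult[OF _ regular_inverse] by (simp add: divide_inverse)

section \<open>Comparability of monomials under condition (f)\<close>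

locale comparable_ratios =
  fixes M :: nat and p :: "real \<Rightarrow> nat \<Rightarrow> nat \<Rightarrow> real" and tau :: "real \<Rightarrow> nat \<Rightarrow> real"
  assumes cond_f: "cond_f M p tau" and tau_pos: "\<And>eps. 0 < eps \<Longrightarrow> 0 < tau eps 1" and M_ge: "1 \<le> M"
begin

lemma limit_cases:
  assumes reg: "regular M p f"
  obtains L where "0 \<le> L" "(f \<longlongrightarrow> L) (at_right 0)" | "filterlim f at_top (at_right 0)"
proof -
  obtain t c where t: "ratio_list M p t" "0 < c" "((\<lambda>eps. f eps / ratio_prod p t eps) \<longlongrightarrow> c) (at_right 0)"
    using reg unfolding regular_def by blast
  have "ak \<in> {1..M} \<and> bk \<in> {1..M} \<and> dk \<in> {1..M} \<and> not_ident_zero (\<lambda>e. p e ak dk)"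
    if "(ak, bk, dk) \<in> set t" for ak bk dk
  proof -
    have *: "ak \<in> {1..M}" "bk \<in> {1..M}" "dk \<in> {1..M}" "\<And>eps. 0 < eps \<Longrightarrow> 0 < p eps ak dk"
      using bspec[OF t(1)[unfolded ratio_list_def] that] by auto
    have "p 1 ak dk \<noteq> 0" using *(4)[of 1] by simp
    then show ?thesis using *(1-3) unfolding not_ident_zero_def by (auto intro: exI[of _ 1])
  qed
  then have valid: "\<forall>(ak, bk, dk)\<in>set t. ak \<in> {1..M} \<and> bk \<in> {1..M} \<and> dk \<in> {1..M} \<and> not_ident_zero (\<lambda>e. p e ak dk)"
    by blast
  \<comment> \<open>Taking index 1 for both \<open>a\<close> and \<open>c\<close> in (f) makes the
    quotient of the \<open>tau\<close> equal to 1 and leaves a statement about the product of ratios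
    alone.\<close>
  have one: "1 \<in> {1..M}" using M_ge by simp
  obtain L :: ereal where L: "((\<lambda>eps. ereal (ratio_prod p t eps * (tau eps 1 / tau eps 1))) \<longlongrightarrow> L) (at_right 0)" "0 \<le> L"
    using cond_f[unfolded cond_f_def, THEN bspec, OF one, THEN bspec, OF one, THEN spec, THEN mp, OF valid]
    unfolding ratio_prod_def by blast
  have "eventually (\<lambda>eps. ereal (ratio_prod p t eps * (tau eps 1 / tau eps 1)) = ereal (ratio_prod p t eps)) (at_right 0)"
    using eventually_at_right_pos by eventually_elim (use tau_pos in force)
  from Lim_transform_eventually[OF L(1) this]
  have L': "((\<lambda>eps. ereal (ratio_prod p t eps)) \<longlongrightarrow> L) (at_right 0)" .
  have ev: "eventually (\<lambda>eps. f eps / ratio_prod p t eps * ratio_prod p t eps = f eps) (at_right 0)"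
    using eventually_at_right_pos by eventually_elim (use ratio_prod_pos[OF t(1)] in force)
  show thesis
  proof (cases L)
    case (real l)
    then have "(ratio_prod p t \<longlongrightarrow> l) (at_right 0)" using L' by simp
    from Lim_transform_eventually[OF tendsto_mult[OF t(3) this] ev]
    show thesis using that(1)[of "c * l"] real L(2) t(2) by simp
  next
    case PInf
    then have "filterlim (ratio_prod p t) at_top (at_right 0)"
      using L' by (simp add: tendsto_PInfty_eq_at_top)
    from filterlim_tendsto_pos_mult_at_top[OF t(3) t(2) this]
    have "filterlim f at_top (at_right 0)"
      using filterlim_cong[OF refl refl ev, of at_top] by simp
    then show thesis by (rule that(2))
  next
    case MInf
    then show thesis using L(2) by simp
  qed
qed

text \<open>By (f) one of the quotients \<open>f / g\<close> and \<open>g / f\<close> has a finite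
  limit, so the sum is asymptotic to a positive multiple of the dominating summand.\<close>

lemma regular_add:
  assumes f: "regular M p f" and g: "regular M p g"
  shows "regular M p (\<lambda>eps. f eps + g eps)"
proof -
  have *: "regular M p (\<lambda>eps. f eps + g eps)"
    if f: "regular M p f" and g: "regular M p g" and q: "((\<lambda>eps. f eps / g eps) \<longlongrightarrow> L) (at_right 0)" "0 \<le> L" for f g L
  proof (rule regularI_asymp[OF g])
    have "eventually (\<lambda>eps. f eps / g eps + 1 = (f eps + g eps) / g eps) (at_right 0)"
      using eventually_at_right_pos
      by eventually_elim (use regular_pos[OF g] in \<open>force simp: add_divide_distrib\<close>)
    from Lim_transform_eventually[OF tendsto_add[OF q(1) tendsto_const] this]
    show "((\<lambda>eps. (f eps + g eps) / g eps) \<longlongrightarrow> L + 1) (at_right 0)" .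
  qed (use q regular_pos[OF f] regular_pos[OF g] in \<open>auto intro: add_pos_pos\<close>)
  show ?thesis
  proof (cases rule: limit_cases[OF regular_divide[OF f g]])
    case (1 L)
    then show ?thesis using *[OF f g] by blast
  next
    case 2
    have "((\<lambda>eps. g eps / f eps) \<longlongrightarrow> 0) (at_right 0)"
      using tendsto_inverse_0_at_top[OF 2] by (simp add: inverse_eq_divide)
    from *[OF g f this] show ?thesis by (simp add: add.commute)
  qed
qed

text \<open>Transition probabilities may vanish identically and are then not asymptotic to a
  monomial. Allowing the zero function gives a class closed under sums, in which a member that is
  nonzero at a single positive \<open>eps\<close> is already \<open>regular\<close>.\<close>

definition zreg :: "(real \<Rightarrow> real) \<Rightarrow> bool" where
  "zreg f \<longleftrightarrow> (\<forall>eps>0. f eps = 0) \<or> regular M p f"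

lemma zreg_nonneg: "zreg f \<Longrightarrow> 0 < eps \<Longrightarrow> 0 \<le> f eps"
  by (auto simp: zreg_def dest: regular_pos intro: less_imp_le)

lemma zreg_add: "zreg f \<Longrightarrow> zreg g \<Longrightarrow> zreg (\<lambda>eps. f eps + g eps)"
  unfolding zreg_def
  using regular_cong[of M p f "\<lambda>eps. f eps + g eps"] regular_cong[of M p g "\<lambda>eps. f eps + g eps"]
  by (elim disjE) (auto intro: regular_add)

lemma zreg_cmult: "0 \<le> c \<Longrightarrow> zreg f \<Longrightarrow> zreg (\<lambda>eps. c * f eps)"
  unfolding zreg_def using regular_mult[OF regular_const] by (cases "c = 0") auto

lemma zreg_sum:
  assumes "finite I" "\<And>i. i \<in> I \<Longrightarrow> zreg (f i)"
  shows "zreg (\<lambda>eps. \<Sum>i\<in>I. f i eps)"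
  using assms
proof (induction I rule: finite_induct)
  case empty
  show ?case by (simp add: zreg_def)
next
  case (insert i I)
  then show ?case by (simp add: zreg_add)
qed

lemma zreg_divide: "zreg f \<Longrightarrow> regular M p g \<Longrightarrow> zreg (\<lambda>eps. f eps / g eps)"
  unfolding zreg_def using regular_divide by auto

lemma zreg_regularI: "zreg f \<Longrightarrow> 0 < eps \<Longrightarrow> f eps \<noteq> 0 \<Longrightarrow> regular M p f"
  by (auto simp: zreg_def)

text \<open>The limit provided by (f) may be infinite; the bound by 1 excludes this case. Thus
  \<open>lim0\<close>, defined through \<open>Lim\<close>, is a genuine limit for transition
  probabilities.\<close>

lemma zreg_limit:
  assumes "zreg f" and le: "\<And>eps. 0 < eps \<Longrightarrow> f eps \<le> 1"
  shows "(f \<longlongrightarrow> lim0 f) (at_right 0)" "0 \<le> lim0 f"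
proof -
  have "\<exists>L\<ge>0. (f \<longlongrightarrow> L) (at_right 0)"
  proof (cases "\<forall>eps>0. f eps = 0")
    case True
    have "eventually (\<lambda>eps. 0 = f eps) (at_right 0)"
      using eventually_at_right_pos by eventually_elim (use True in auto)
    from Lim_transform_eventually[OF tendsto_const this] show ?thesis by auto
  next
    case False
    then have "regular M p f" using assms(1) by (auto simp: zreg_def)
    then show ?thesis
    proof (cases rule: limit_cases)
      case 2
      then have "eventually (\<lambda>eps. 1 < f eps) (at_right 0)" unfolding filterlim_at_top_dense by blast
      with eventually_at_right_pos have "eventually (\<lambda>eps::real. False) (at_right 0)"
        by eventually_elim (use le in force)
      then show ?thesis by simp
    qed auto
  qed
  then obtain L where L: "0 \<le> L" "(f \<longlongrightarrow> L) (at_right 0)" by blast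
  then have "lim0 f = L" unfolding lim0_def by (intro tendsto_Lim) auto
  then show "(f \<longlongrightarrow> lim0 f) (at_right 0)" "0 \<le> lim0 f" using L by auto
qed

end

section \<open>The blocks of one hierarchy step\<close>

lemma reach_refl: "reach Mr P0 i i"
  by (simp add: reach_def)

lemma reach_trans: "reach Mr P0 i j \<Longrightarrow> reach Mr P0 j l \<Longrightarrow> reach Mr P0 i l"
  unfolding reach_def by (rule rtrancl_trans)

lemma recurrent_comm_class:
  assumes rec: "recurrent Mr P0 i" and j: "j \<in> comm_class Mr P0 i"
  shows "recurrent Mr P0 j" "comm_class Mr P0 j = comm_class Mr P0 i"
proof -
  have ij: "reach Mr P0 i j" "reach Mr P0 j i" using j by (auto simp: comm_class_def)
  show "recurrent Mr P0 j" unfolding recurrent_def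
    using rec ij reach_trans unfolding recurrent_def by metis
  show "comm_class Mr P0 j = comm_class Mr P0 i" unfolding comm_class_def
    using ij reach_trans by blast
qed

lemma block_cases:
  assumes "B \<in> blocks Mr P0"
  obtains i where "i \<in> {1..Mr}" "recurrent Mr P0 i" "B = comm_class Mr P0 i"
  | i where "i \<in> {1..Mr}" "\<not> recurrent Mr P0 i" "B = {i}"
  using assms unfolding blocks_def by blast

lemma block_recurrent:
  assumes B: "B \<in> blocks Mr P0" and i: "i \<in> B" and r: "recurrent Mr P0 i"
  shows "B = comm_class Mr P0 i"
  using B
proof (cases rule: block_cases)
  case (1 j)
  then show ?thesis using recurrent_comm_class[of Mr P0 j i] i by simp
next
  case (2 j)
  then show ?thesis using i r by simp
qed

lemma block_transient:
  assumes B: "B \<in> blocks Mr P0" and i: "i \<in> B" and r: "\<not> recurrent Mr P0 i"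
  shows "B = {i}"
  using B
proof (cases rule: block_cases)
  case (1 j)
  then show ?thesis using recurrent_comm_class[of Mr P0 j i] i r by simp
qed (use i in simp)

lemma block_subset: "B \<in> blocks Mr P0 \<Longrightarrow> B \<subseteq> {1..Mr}"
  by (erule block_cases) (auto simp: comm_class_def)

lemma block_nonempty: "B \<in> blocks Mr P0 \<Longrightarrow> B \<noteq> {}"
  by (erule block_cases) (auto simp: comm_class_def intro: reach_refl)

lemma block_exists: "i \<in> {1..Mr} \<Longrightarrow> \<exists>B\<in>blocks Mr P0. i \<in> B"
proof -
  assume i: "i \<in> {1..Mr}"
  then have "i \<in> comm_class Mr P0 i" by (simp add: comm_class_def reach_refl)
  then show ?thesis using i unfolding blocks_def by (cases "recurrent Mr P0 i") blast+
qed

lemma block_unique: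
  assumes "B \<in> blocks Mr P0" "B' \<in> blocks Mr P0" "i \<in> B" "i \<in> B'"
  shows "B = B'"
proof (cases "recurrent Mr P0 i")
  case True
  from block_recurrent[OF assms(1,3) True] block_recurrent[OF assms(2,4) True] show ?thesis by blast
next
  case False
  from block_transient[OF assms(1,3) False] block_transient[OF assms(2,4) False] show ?thesis by blast
qed

lemma recurrent_block_closed:
  assumes B: "B \<in> blocks Mr P0" and i: "i \<in> B" and r: "recurrent Mr P0 i"
    and j: "j \<in> {1..Mr}" "0 < P0 i j"
  shows "j \<in> B"
proof -
  have "i \<in> {1..Mr}" using block_subset[OF B] i by auto
  then have ij: "reach Mr P0 i j" using j unfolding reach_def by auto
  then have "reach Mr P0 j i" using r unfolding recurrent_def by blast
  then show ?thesis using block_recurrent[OF B i r] ij j by (auto simp: comm_class_def)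
qed

text \<open>A recurrent block is closed under positive limiting probabilities, so a path between two
  of its states never leaves it; membership of the endpoint is carried through the induction for
  this purpose.\<close>

lemma recurrent_block_connected:
  assumes B: "B \<in> blocks Mr P0" and r: "\<And>i. i \<in> B \<Longrightarrow> recurrent Mr P0 i"
    and ab: "a \<in> B" "b \<in> B"
  shows "(a, b) \<in> {(x, y). x \<in> B \<and> y \<in> B \<and> 0 < P0 x y}\<^sup>*"
proof -
  have "(a, b) \<in> {(x, y). x \<in> {1..Mr} \<and> y \<in> {1..Mr} \<and> 0 < P0 x y}\<^sup>*"
    using block_recurrent[OF B ab(1) r[OF ab(1)]] ab(2) by (auto simp: comm_class_def reach_def)
  then have "(a, b) \<in> {(x, y). x \<in> B \<and> y \<in> B \<and> 0 < P0 x y}\<^sup>* \<and> b \<in> B"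
  proof (induction rule: rtrancl_induct)
    case (step y z)
    then have "z \<in> B" using recurrent_block_closed[OF B _ r] by blast
    with step show ?case by (auto intro: rtrancl_into_rtrancl)
  qed (use ab in simp)
  then show ?thesis ..
qed

text \<open>The invariants that pass from one rank to the next. Irreducibility appears as
  \<open>cut_Pr\<close>, an edge out of every proper nonempty set of indices, because this form
  transfers to unions of blocks at once, while paths would have to be projected.\<close>

locale hierarchy_step = comparable_ratios +
  fixes Mr :: nat and Pr :: "real \<Rightarrow> nat \<Rightarrow> nat \<Rightarrow> real" and Mr' :: nat and E :: "nat \<Rightarrow> nat set"
    and lam :: "nat \<Rightarrow> nat \<Rightarrow> real" and Pr' :: "real \<Rightarrow> nat \<Rightarrow> nat \<Rightarrow> real"
  assumes step: "hier_step Mr Pr Mr' E lam Pr'"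
    and zreg_Pr: "\<And>a b. a \<in> {1..Mr} \<Longrightarrow> b \<in> {1..Mr} \<Longrightarrow> zreg (\<lambda>eps. Pr eps a b)"
    and diag_Pr: "\<And>eps a. 0 < eps \<Longrightarrow> a \<in> {1..Mr} \<Longrightarrow> Pr eps a a = 0"
    and row_Pr: "\<And>eps a. 0 < eps \<Longrightarrow> a \<in> {1..Mr} \<Longrightarrow> (\<Sum>b\<in>{1..Mr}. Pr eps a b) = 1"
    and cut_Pr: "\<And>U. U \<noteq> {} \<Longrightarrow> U \<subset> {1..Mr} \<Longrightarrow> \<exists>a\<in>U. \<exists>b\<in>{1..Mr} - U. \<forall>eps>0. 0 < Pr eps a b"
begin

abbreviation P0 :: "nat \<Rightarrow> nat \<Rightarrow> real" where
  "P0 \<equiv> (\<lambda>i j. lim0 (\<lambda>eps. Pr eps i j))"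

lemma Pr_nonneg: "0 < eps \<Longrightarrow> a \<in> {1..Mr} \<Longrightarrow> b \<in> {1..Mr} \<Longrightarrow> 0 \<le> Pr eps a b"
  using zreg_nonneg[OF zreg_Pr] by blast

lemma Pr_le_one:
  assumes "0 < eps" "a \<in> {1..Mr}" "b \<in> {1..Mr}" shows "Pr eps a b \<le> 1"
proof -
  have "Pr eps a b \<le> (\<Sum>b\<in>{1..Mr}. Pr eps a b)"
    by (rule member_le_sum) (use assms Pr_nonneg in auto)
  then show ?thesis using row_Pr[OF assms(1,2)] by simp
qed

lemma Pr_tendsto:
  assumes "a \<in> {1..Mr}" "b \<in> {1..Mr}"
  shows "((\<lambda>eps. Pr eps a b) \<longlongrightarrow> P0 a b) (at_right 0)" and P0_nonneg: "0 \<le> P0 a b"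
  by (rule zreg_limit[OF zreg_Pr[OF assms] Pr_le_one[OF _ assms]]; assumption)+

lemma E_bij: "bij_betw E {1..Mr'} (blocks Mr P0)"
  using step[unfolded hier_step_def Let_def, THEN conjunct1] .

lemma E_block: "k \<in> {1..Mr'} \<Longrightarrow> E k \<in> blocks Mr P0"
  using bij_betw_apply[OF E_bij] .

lemma E_subset: "k \<in> {1..Mr'} \<Longrightarrow> E k \<subseteq> {1..Mr}"
  using block_subset[OF E_block] .

lemma E_mem: "k \<in> {1..Mr'} \<Longrightarrow> i \<in> E k \<Longrightarrow> i \<in> {1..Mr}"
  using E_subset by blast

lemma finite_E: "k \<in> {1..Mr'} \<Longrightarrow> finite (E k)"
  using E_subset finite_subset by blast

lemma E_nonempty: "k \<in> {1..Mr'} \<Longrightarrow> E k \<noteq> {}"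
  using block_nonempty[OF E_block] .

lemma E_disjoint:
  assumes "k \<in> {1..Mr'}" "l \<in> {1..Mr'}" "k \<noteq> l" shows "E k \<inter> E l = {}"
proof -
  have ne: "E k \<noteq> E l" using inj_onD[OF bij_betw_imp_inj_on[OF E_bij] _ assms(1,2)] assms(3) by blast
  show ?thesis
  proof (rule ccontr)
    assume "E k \<inter> E l \<noteq> {}"
    then obtain i where "i \<in> E k" "i \<in> E l" by auto
    from block_unique[OF E_block[OF assms(1)] E_block[OF assms(2)] this] ne show False by simp
  qed
qed

lemma E_cover: "(\<Union>k\<in>{1..Mr'}. E k) = {1..Mr}"
proof -
  have im: "E ` {1..Mr'} = blocks Mr P0" by (rule bij_betw_imp_surj_on[OF E_bij])
  show ?thesis
  proof (intro equalityI subsetI)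
    fix i assume "i \<in> {1..Mr}"
    then show "i \<in> (\<Union>k\<in>{1..Mr'}. E k)" using block_exists[of i Mr P0] unfolding im by blast
  qed (use E_mem in blast)
qed

lemma E_proper:
  assumes "k \<in> {1..Mr'}" "1 < Mr'" shows "E k \<subset> {1..Mr}"
proof -
  define l where "l = (if k = 1 then 2 else 1::nat)"
  have l: "l \<in> {1..Mr'}" "k \<noteq> l" using assms by (auto simp: l_def)
  obtain b where b: "b \<in> E l" using E_nonempty[OF l(1)] by auto
  then have "b \<in> {1..Mr}" "b \<notin> E k"
    using E_disjoint[OF assms(1) l] E_subset[OF l(1)] by auto
  then show ?thesis using E_subset[OF assms(1)] by auto
qed

definition ergodic :: "nat \<Rightarrow> bool" where
  "ergodic k \<longleftrightarrow> (\<exists>i\<in>E k. recurrent Mr P0 i)"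

lemma ergodic_recurrent:
  assumes "k \<in> {1..Mr'}" "ergodic k" "i \<in> E k" shows "recurrent Mr P0 i"
proof (rule ccontr)
  assume n: "\<not> recurrent Mr P0 i"
  from block_transient[OF E_block[OF assms(1)] assms(3) n] n assms(2) show False
    unfolding ergodic_def by simp
qed

lemma lam_spec:
  assumes "k \<in> {1..Mr'}"
  shows "if ergodic k then (\<forall>i. lam k i \<ge> 0) \<and> (\<forall>i. i \<notin> E k \<longrightarrow> lam k i = 0) \<and>
      (\<Sum>i\<in>E k. lam k i) = 1 \<and> (\<forall>j\<in>E k. (\<Sum>i\<in>E k. lam k i * P0 i j) = lam k j)
    else (\<forall>i. lam k i = (if i \<in> E k then 1 else 0))"
  using step[unfolded hier_step_def Let_def, THEN conjunct2, THEN conjunct1, THEN bspec, OF assms]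
  unfolding ergodic_def .

lemma not_ergodic_singleton:
  assumes "k \<in> {1..Mr'}" "\<not> ergodic k"
  obtains a where "a \<in> {1..Mr}" "E k = {a}" "lam k a = 1"
proof -
  obtain a where a: "a \<in> E k" using E_nonempty[OF assms(1)] by blast
  have "\<not> recurrent Mr P0 a" using assms(2) a unfolding ergodic_def by blast
  then have "E k = {a}" by (rule block_transient[OF E_block[OF assms(1)] a])
  moreover have "lam k a = 1"
    using lam_spec[OF assms(1)] a unfolding if_not_P[OF assms(2)] by simp
  ultimately show thesis using that[of a] E_subset[OF assms(1)] by auto
qed

lemma ergodic_lam:
  assumes "k \<in> {1..Mr'}" "ergodic k"
  shows "\<And>i. 0 \<le> lam k i" "(\<Sum>i\<in>E k. lam k i) = 1"
    "\<And>j. j \<in> E k \<Longrightarrow> (\<Sum>i\<in>E k. lam k i * P0 i j) = lam k j"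
  using lam_spec[OF assms(1)] unfolding if_P[OF assms(2)] by blast+

text \<open>On an ergodic class some state has positive mass, and by invariance positivity spreads
  along every edge of positive limiting probability.\<close>

lemma lam_pos:
  assumes k: "k \<in> {1..Mr'}" and i: "i \<in> E k" shows "0 < lam k i"
proof (cases "ergodic k")
  case True
  note lam = ergodic_lam[OF k True]
  obtain a where a: "a \<in> E k" "0 < lam k a"
  proof -
    have "\<exists>a\<in>E k. lam k a \<noteq> 0" using lam(2) by (metis sum.neutral zero_neq_one)
    then show thesis using that lam(1) by (metis less_eq_real_def)
  qed
  have "(a, i) \<in> {(x, y). x \<in> E k \<and> y \<in> E k \<and> 0 < P0 x y}\<^sup>*"
    using recurrent_block_connected[OF E_block[OF k] ergodic_recurrent[OF k True] a(1) i] by blast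
  then show ?thesis
  proof (induction rule: rtrancl_induct)
    case base show ?case by (rule a(2))
  next
    case (step y z)
    then have yz: "y \<in> E k" "z \<in> E k" "0 < P0 y z" by auto
    have "0 < lam k y * P0 y z" using step yz by simp
    also have "\<dots> \<le> (\<Sum>i\<in>E k. lam k i * P0 i z)"
      by (rule member_le_sum[of y "E k" "\<lambda>i. lam k i * P0 i z"])
         (use yz lam(1) finite_E[OF k] in \<open>auto intro!: mult_nonneg_nonneg P0_nonneg E_mem[OF k]
            simp del: atLeastAtMost_iff\<close>)
    finally show ?case using lam(3)[OF yz(2)] by simp
  qed
next
  case False
  then show ?thesis by (rule not_ergodic_singleton[OF k]) (use i in simp)
qed

lemma lam_Pr_nonneg:
  "0 < eps \<Longrightarrow> k \<in> {1..Mr'} \<Longrightarrow> i \<in> E k \<Longrightarrow> j \<in> {1..Mr} \<Longrightarrow> 0 \<le> lam k i * Pr eps i j"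
  using lam_pos[of k i] Pr_nonneg[of eps i j] E_mem[of k i] by simp

lemma zreg_lam_Pr:
  assumes "k \<in> {1..Mr'}" "i \<in> E k" "j \<in> {1..Mr}" shows "zreg (\<lambda>eps. lam k i * Pr eps i j)"
  by (rule zreg_cmult[OF less_imp_le[OF lam_pos[OF assms(1,2)]] zreg_Pr[OF E_mem[OF assms(1,2)] assms(3)]])

definition num :: "real \<Rightarrow> nat \<Rightarrow> nat \<Rightarrow> real" where
  "num eps k l = (\<Sum>i\<in>E k. \<Sum>j\<in>E l. lam k i * Pr eps i j)"

definition den :: "real \<Rightarrow> nat \<Rightarrow> real" where
  "den eps k = (\<Sum>i\<in>E k. \<Sum>j\<in>{1..Mr} - E k. lam k i * Pr eps i j)"

lemma Pr'_eq:
  assumes "0 < eps" "k \<in> {1..Mr'}" "l \<in> {1..Mr'}" "k \<noteq> l"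
  shows "Pr' eps k l = num eps k l / den eps k"
  using step[unfolded hier_step_def Let_def, THEN conjunct2, THEN conjunct2, THEN spec, THEN mp,
      OF assms(1), THEN bspec, OF assms(2), THEN bspec, OF assms(3)] assms(4)
  unfolding num_def den_def by simp

lemma Pr'_diag:
  assumes "0 < eps" "k \<in> {1..Mr'}" shows "Pr' eps k k = 0"
  using step[unfolded hier_step_def Let_def, THEN conjunct2, THEN conjunct2, THEN spec, THEN mp,
      OF assms(1), THEN bspec, OF assms(2), THEN bspec, OF assms(2)] by simp

text \<open>As a sum of members of \<open>zreg\<close>, the denominator is regular once it is
  nonzero at one value of \<open>eps\<close>; the edge leaving the block supplies this at
  \<open>eps = 1\<close>.\<close>

lemma regular_den:
  assumes k: "k \<in> {1..Mr'}" and M': "1 < Mr'"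
  shows "regular M p (\<lambda>eps. den eps k)"
proof -
  have z: "zreg (\<lambda>eps. den eps k)"
    unfolding den_def
    by (intro zreg_sum finite_E[OF k] zreg_lam_Pr[OF k]) (auto simp del: atLeastAtMost_iff)
  obtain a b where ab: "a \<in> E k" "b \<in> {1..Mr} - E k" "\<And>eps. 0 < eps \<Longrightarrow> 0 < Pr eps a b"
    using cut_Pr[OF E_nonempty[OF k] E_proper[OF k M']] by blast
  have "0 < lam k a * Pr 1 a b" using lam_pos[OF k ab(1)] ab(3)[of 1] by simp
  also have "\<dots> \<le> (\<Sum>j\<in>{1..Mr} - E k. lam k a * Pr 1 a j)"
    by (rule member_le_sum[of b _ "\<lambda>j. lam k a * Pr 1 a j"])
       (use ab in \<open>auto intro!: lam_Pr_nonneg[OF _ k] simp del: atLeastAtMost_iff\<close>)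
  also have "\<dots> \<le> den 1 k" unfolding den_def
    by (rule member_le_sum[of a _ "\<lambda>i. \<Sum>j\<in>{1..Mr} - E k. lam k i * Pr 1 i j"])
       (use ab finite_E[OF k] in \<open>auto intro!: sum_nonneg lam_Pr_nonneg[OF _ k] simp del: atLeastAtMost_iff\<close>)
  finally show ?thesis using zreg_regularI[OF z, of 1] by simp
qed

lemma zreg_num: "k \<in> {1..Mr'} \<Longrightarrow> l \<in> {1..Mr'} \<Longrightarrow> zreg (\<lambda>eps. num eps k l)"
  unfolding num_def by (intro zreg_sum finite_E zreg_lam_Pr E_mem[of l])

lemma zreg_cong: "zreg g \<Longrightarrow> (\<And>eps. 0 < eps \<Longrightarrow> f eps = g eps) \<Longrightarrow> zreg f"
  unfolding zreg_def using regular_cong[of M p g f] by (elim disjE) (simp, blast)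

lemma next_zreg:
  assumes "k \<in> {1..Mr'}" "l \<in> {1..Mr'}" and M': "1 < Mr'"
  shows "zreg (\<lambda>eps. Pr' eps k l)"
proof (cases "k = l")
  case True
  then show ?thesis using Pr'_diag[OF _ assms(1)] by (simp add: zreg_def)
next
  case False
  show ?thesis
    by (rule zreg_cong[OF zreg_divide[OF zreg_num[OF assms(1,2)] regular_den[OF assms(1) M']]])
       (rule Pr'_eq[OF _ assms(1,2) False])
qed

lemma sum_blocks:
  fixes f :: "nat \<Rightarrow> 'b::comm_monoid_add"
  assumes k: "k \<in> {1..Mr'}"
  shows "(\<Sum>j\<in>{1..Mr} - E k. f j) = (\<Sum>l\<in>{1..Mr'} - {k}. \<Sum>j\<in>E l. f j)"
proof -
  have "{1..Mr} - E k = (\<Union>l\<in>{1..Mr'} - {k}. E l)"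
  proof (intro equalityI subsetI)
    fix j assume j: "j \<in> {1..Mr} - E k"
    then obtain l where "l \<in> {1..Mr'}" "j \<in> E l" unfolding E_cover[symmetric] by blast
    then show "j \<in> (\<Union>l\<in>{1..Mr'} - {k}. E l)" using j by blast
  next
    fix j assume "j \<in> (\<Union>l\<in>{1..Mr'} - {k}. E l)"
    then obtain l where l: "l \<in> {1..Mr'}" "l \<noteq> k" "j \<in> E l" by blast
    then show "j \<in> {1..Mr} - E k" using E_subset[OF l(1)] E_disjoint[OF l(1) k l(2)] by blast
  qed
  moreover have "(\<Sum>j\<in>(\<Union>l\<in>{1..Mr'} - {k}. E l). f j) = (\<Sum>l\<in>{1..Mr'} - {k}. \<Sum>j\<in>E l. f j)"
    by (rule sum.UNION_disjoint) (use finite_E E_disjoint in \<open>auto simp del: atLeastAtMost_iff\<close>)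
  ultimately show ?thesis by simp
qed

lemma den_eq:
  assumes k: "k \<in> {1..Mr'}"
  shows "den eps k = (\<Sum>l\<in>{1..Mr'} - {k}. num eps k l)"
  unfolding den_def num_def sum_blocks[OF k] by (rule sum.swap)

lemma next_row:
  assumes eps: "0 < eps" and k: "k \<in> {1..Mr'}" and M': "1 < Mr'"
  shows "(\<Sum>l\<in>{1..Mr'}. Pr' eps k l) = 1"
proof -
  have "(\<Sum>l\<in>{1..Mr'}. Pr' eps k l) = (\<Sum>l\<in>{1..Mr'} - {k}. Pr' eps k l)"
    using Pr'_diag[OF eps k] k by (subst sum.remove[of _ k]) auto
  also have "\<dots> = (\<Sum>l\<in>{1..Mr'} - {k}. num eps k l / den eps k)"
    using Pr'_eq[OF eps k] by (intro sum.cong) auto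
  also have "\<dots> = den eps k / den eps k" by (simp add: sum_divide_distrib[symmetric] den_eq[OF k])
  finally show ?thesis using regular_pos[OF regular_den[OF k M'] eps] by simp
qed

text \<open>The union of the blocks indexed by \<open>U\<close> is a proper nonempty set at the
  lower rank. An edge leaving it starts in a block with positive mass at its source, hence shows up
  in the numerator of a transition out of \<open>U\<close>.\<close>

lemma next_cut:
  assumes U: "U \<noteq> {}" "U \<subset> {1..Mr'}" and M': "1 < Mr'"
  shows "\<exists>k\<in>U. \<exists>l\<in>{1..Mr'} - U. \<forall>eps>0. 0 < Pr' eps k l"
proof -
  let ?V = "\<Union>k\<in>U. E k"
  have U': "U \<subseteq> {1..Mr'}" using U by blast
  obtain k0 where k0: "k0 \<in> U" using U by blast
  obtain l0 where l0: "l0 \<in> {1..Mr'}" "l0 \<notin> U" using U by blast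
  have V1: "?V \<noteq> {}" using k0 E_nonempty[OF subsetD[OF U' k0]] by blast
  obtain b0 where b0: "b0 \<in> E l0" using E_nonempty[OF l0(1)] by auto
  have "b0 \<notin> ?V"
  proof
    assume "b0 \<in> ?V"
    then obtain k where k: "k \<in> U" "b0 \<in> E k" by blast
    then have "k \<noteq> l0" using l0 by blast
    from E_disjoint[OF subsetD[OF U' k(1)] l0(1) this] k b0 show False by blast
  qed
  moreover have "?V \<subseteq> {1..Mr}" by (intro UN_least E_subset subsetD[OF U'])
  moreover have "b0 \<in> {1..Mr}" by (rule E_mem[OF l0(1) b0])
  ultimately have V2: "?V \<subset> {1..Mr}" by blast
  obtain a b where ab: "a \<in> ?V" "b \<in> {1..Mr} - ?V" "\<And>eps. 0 < eps \<Longrightarrow> 0 < Pr eps a b"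
    using cut_Pr[OF V1 V2] by blast
  obtain k where k: "k \<in> U" "a \<in> E k" using ab by blast
  obtain l where l: "l \<in> {1..Mr'}" "b \<in> E l" using ab E_cover by blast
  have lU: "l \<notin> U" using ab l by blast
  have k': "k \<in> {1..Mr'}" using k U' by blast
  have ne: "k \<noteq> l" using k lU by blast
  have "0 < Pr' eps k l" if eps: "0 < eps" for eps
  proof -
    have "0 < lam k a * Pr eps a b" using lam_pos[OF k' k(2)] ab(3)[OF eps] by simp
    also have "\<dots> \<le> (\<Sum>j\<in>E l. lam k a * Pr eps a j)"
      by (rule member_le_sum[of b _ "\<lambda>j. lam k a * Pr eps a j"])
         (use l k finite_E[OF l(1)] in \<open>auto intro!: lam_Pr_nonneg[OF eps k'] E_mem[OF l(1)] simp del: atLeastAtMost_iff\<close>)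
    also have "\<dots> \<le> num eps k l" unfolding num_def
      by (rule member_le_sum[of a _ "\<lambda>i. \<Sum>j\<in>E l. lam k i * Pr eps i j"])
         (use k finite_E[OF k'] in \<open>auto intro!: sum_nonneg lam_Pr_nonneg[OF eps k'] E_mem[OF l(1)] simp del: atLeastAtMost_iff\<close>)
    finally show ?thesis
      unfolding Pr'_eq[OF eps k' l(1) ne] using regular_pos[OF regular_den[OF k' M'] eps] by simp
  qed
  then show ?thesis using k(1) l(1) lU by blast
qed

end

section \<open>Exit from an ergodic block\<close>

text \<open>A nonnegative vector that is almost excessive and vanishes at \<open>d\<close> is small
  at every state leading to \<open>d\<close>: along an edge from \<open>b\<close> to
  \<open>y\<close> one has \<open>z b * P0 b y \<le> z y + \<delta>\<close>, so smallness travels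
  backwards along the path. The constant depends on the path only.\<close>

lemma stationary_chain_bound:
  fixes P0 :: "nat \<Rightarrow> nat \<Rightarrow> real"
  assumes P0: "\<And>a b. a \<in> E \<Longrightarrow> b \<in> E \<Longrightarrow> 0 \<le> P0 a b" and fin: "finite E"
    and bd: "(b, d) \<in> {(x, y). x \<in> E \<and> y \<in> E \<and> 0 < P0 x y}\<^sup>*" and d: "d \<in> E"
  shows "\<exists>K\<ge>0. \<forall>\<delta>\<ge>0. \<forall>z. (\<forall>e\<in>E. 0 \<le> z e) \<longrightarrow> z d = 0 \<longrightarrow>
    (\<forall>e\<in>E. (\<Sum>b\<in>E. z b * P0 b e) \<le> z e + \<delta>) \<longrightarrow> z b \<le> K * \<delta>"
  using bd
proof (induction rule: converse_rtrancl_induct)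
  case base
  show ?case by (intro exI[of _ 0]) auto
next
  case (step b y)
  then obtain K where K: "0 \<le> K" "\<And>\<delta> z. 0 \<le> \<delta> \<Longrightarrow> (\<forall>e\<in>E. 0 \<le> z e) \<Longrightarrow> z d = 0 \<Longrightarrow>
    (\<forall>e\<in>E. (\<Sum>b\<in>E. z b * P0 b e) \<le> z e + \<delta>) \<Longrightarrow> z y \<le> K * \<delta>" by blast
  have by_: "b \<in> E" "y \<in> E" "0 < P0 b y" using step(1) by auto
  show ?case
  proof (intro exI[of _ "(K + 1) / P0 b y"] conjI allI impI)
    show "0 \<le> (K + 1) / P0 b y" using K(1) by_ by simp
    fix \<delta> z assume h: "(0::real) \<le> \<delta>" "\<forall>e\<in>E. 0 \<le> z e" "z d = 0" "\<forall>e\<in>E. (\<Sum>b\<in>E. z b * P0 b e) \<le> z e + \<delta>"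
    have "z b * P0 b y \<le> (\<Sum>b\<in>E. z b * P0 b y)"
      using by_ h(2) P0 fin by (intro member_le_sum[of b E "\<lambda>b. z b * P0 b y"]) auto
    also have "\<dots> \<le> z y + \<delta>" using h(4) by_ by blast
    also have "\<dots> \<le> K * \<delta> + \<delta>" using K(2)[OF h] by simp
    finally show "z b \<le> (K + 1) / P0 b y * \<delta>" using by_ by (simp add: field_simps)
  qed
qed

text \<open>A quantitative form of the uniqueness of the invariant law: the distance of a
  probability vector from \<open>lam\<close> is at most linear in its defect of invariance, with a
  constant fixed before the vector and the defect.\<close>

lemma stationary_stability:
  fixes P0 :: "nat \<Rightarrow> nat \<Rightarrow> real"
  assumes fin: "finite E" and ne: "E \<noteq> {}" and P0: "\<And>a b. a \<in> E \<Longrightarrow> b \<in> E \<Longrightarrow> 0 \<le> P0 a b"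
    and conn: "\<And>a b. a \<in> E \<Longrightarrow> b \<in> E \<Longrightarrow> (a, b) \<in> {(x, y). x \<in> E \<and> y \<in> E \<and> 0 < P0 x y}\<^sup>*"
    and lam: "\<And>i. i \<in> E \<Longrightarrow> 0 < lam i" "(\<Sum>i\<in>E. lam i) = 1"
      "\<And>j. j \<in> E \<Longrightarrow> (\<Sum>i\<in>E. lam i * P0 i j) = lam j"
  obtains K where "0 \<le> K" "\<And>\<delta> w d. (\<And>i. i \<in> E \<Longrightarrow> 0 \<le> w i) \<Longrightarrow> (\<Sum>i\<in>E. w i) = 1 \<Longrightarrow>
    (\<And>d. d \<in> E \<Longrightarrow> \<bar>w d - (\<Sum>b\<in>E. w b * P0 b d)\<bar> \<le> \<delta>) \<Longrightarrow> d \<in> E \<Longrightarrow> \<bar>w d - lam d\<bar> \<le> K * \<delta>"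
proof -
  \<comment> \<open>Constants for the finitely many pairs of states are chosen first and summed to
    \<open>K\<close>, so that \<open>K\<close> depends neither on \<delta> nor on
    \<open>w\<close>.\<close>
  define good where "good b d K \<longleftrightarrow> 0 \<le> K \<and> (\<forall>\<delta>\<ge>0. \<forall>z. (\<forall>e\<in>E. 0 \<le> z e) \<longrightarrow> z d = 0 \<longrightarrow>
    (\<forall>e\<in>E. (\<Sum>b\<in>E. z b * P0 b e) \<le> z e + \<delta>) \<longrightarrow> z b \<le> K * \<delta>)" for b d and K :: real
  define k where "k b d = (SOME K. good b d K)" for b d
  have kgood: "good b d (k b d)" if "b \<in> E" "d \<in> E" for b d
    unfolding k_def
    by (rule someI_ex) (use stationary_chain_bound[OF P0 fin conn[OF that] that(2)] in \<open>auto simp: good_def\<close>)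
  have k: "0 \<le> k b d" if "b \<in> E" "d \<in> E" for b d
    using kgood[OF that] by (simp add: good_def)
  have k2: "z b \<le> k b d * \<delta>" if "b \<in> E" "d \<in> E" "0 \<le> \<delta>" "\<forall>e\<in>E. 0 \<le> z e" "z d = 0"
    "\<forall>e\<in>E. (\<Sum>b\<in>E. z b * P0 b e) \<le> z e + \<delta>" for b d \<delta> z
    using kgood[OF that(1,2)] that(3-) unfolding good_def by blast
  define K where "K = (\<Sum>b\<in>E. \<Sum>d\<in>E. k b d)"
  have kK: "k b d \<le> K" if "b \<in> E" "d \<in> E" for b d
  proof -
    have "k b d \<le> (\<Sum>d\<in>E. k b d)" using that k fin by (intro member_le_sum) auto
    also have "\<dots> \<le> K" unfolding K_def
      using that k fin by (intro member_le_sum[of b E "\<lambda>b. \<Sum>d\<in>E. k b d"]) (auto intro: sum_nonneg)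
    finally show ?thesis .
  qed
  have K0: "0 \<le> K" unfolding K_def using k by (intro sum_nonneg) auto
  show thesis
  proof (rule that[of "K * (1 + real (card E))"])
    show "0 \<le> K * (1 + real (card E))" using K0 by simp
    fix \<delta> w d
    assume w: "\<And>i. i \<in> E \<Longrightarrow> 0 \<le> w i" "(\<Sum>i\<in>E. w i) = 1"
      and inv: "\<And>d. d \<in> E \<Longrightarrow> \<bar>w d - (\<Sum>b\<in>E. w b * P0 b d)\<bar> \<le> \<delta>" and d: "d \<in> E"
    have \<delta>: "0 \<le> \<delta>" using inv[OF d] by linarith
    \<comment> \<open>\<open>\<alpha> * lam\<close> is the largest multiple of \<open>lam\<close>
      below \<open>w\<close>. The remainder \<open>z\<close> vanishes at the minimiser
      \<open>d'\<close>, so every entry of \<open>z\<close> is at most \<open>K * \<delta>\<close>,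
      and summing them bounds the missing mass \<open>1 - \<alpha>\<close>; this explains the factor
      \<open>1 + real (card E)\<close>.\<close>
    obtain d' where d': "d' \<in> E" "\<And>b. b \<in> E \<Longrightarrow> w d' / lam d' \<le> w b / lam b"
      using arg_min_if_finite[OF fin ne, of "\<lambda>b. w b / lam b"]
      by (metis linorder_not_le)
    define \<alpha> where "\<alpha> = w d' / lam d'"
    define z where "z b = w b - \<alpha> * lam b" for b
    have z0: "\<forall>e\<in>E. 0 \<le> z e"
      using d'(2) lam(1) by (auto simp: z_def \<alpha>_def field_simps)
    have zd: "z d' = 0" using lam(1)[OF d'(1)] by (simp add: z_def \<alpha>_def)
    have zi: "\<forall>e\<in>E. (\<Sum>b\<in>E. z b * P0 b e) \<le> z e + \<delta>"
    proof
      fix e assume e: "e \<in> E"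
      have "(\<Sum>b\<in>E. z b * P0 b e) = (\<Sum>b\<in>E. w b * P0 b e) - \<alpha> * (\<Sum>b\<in>E. lam b * P0 b e)"
        by (simp add: z_def left_diff_distrib sum_subtractf sum_distrib_left mult.assoc)
      also have "\<dots> = (\<Sum>b\<in>E. w b * P0 b e) - \<alpha> * lam e" using lam(3)[OF e] by simp
      finally show "(\<Sum>b\<in>E. z b * P0 b e) \<le> z e + \<delta>" using inv[OF e] by (simp add: z_def)
    qed
    have zK: "z b \<le> K * \<delta>" if "b \<in> E" for b
      using k2[OF that d'(1) \<delta> z0 zd zi] mult_right_mono[OF kK[OF that d'(1)] \<delta>] by linarith
    have sz: "(\<Sum>b\<in>E. z b) = 1 - \<alpha>"
      by (simp add: z_def sum_subtractf sum_distrib_left[symmetric] w lam(2))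
    have a1: "0 \<le> 1 - \<alpha>" unfolding sz[symmetric] using z0 by (intro sum_nonneg) auto
    have a2: "1 - \<alpha> \<le> real (card E) * (K * \<delta>)"
      unfolding sz[symmetric] using sum_bounded_above[of E z "K * \<delta>"] zK by simp
    have l1: "lam d \<le> 1" unfolding lam(2)[symmetric]
      using d fin lam(1) by (intro member_le_sum) (auto intro: less_imp_le)
    have "w d - lam d = z d - (1 - \<alpha>) * lam d" by (simp add: z_def algebra_simps)
    moreover have "0 \<le> (1 - \<alpha>) * lam d" "(1 - \<alpha>) * lam d \<le> 1 - \<alpha>"
      using a1 l1 lam(1)[OF d] mult_left_mono[OF l1 a1] by auto
    moreover have "0 \<le> z d" "z d \<le> K * \<delta>" using z0 zK d by auto
    ultimately have "\<bar>w d - lam d\<bar> \<le> K * \<delta> + real (card E) * (K * \<delta>)" using a2 by linarith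
    then show "\<bar>w d - lam d\<bar> \<le> K * (1 + real (card E)) * \<delta>" by (simp add: algebra_simps)
  qed
qed

text \<open>\<open>v b\<close> is the expected number of entries into the cluster \<open>b\<close>
  and \<open>H\<close> the exit law. The exit probabilities add up to 1 although one entry leads out
  with probability at most about \<eta>, so the total \<open>V\<close> is at least
  \<open>1 / (2 * \<eta>)\<close>. The initial entry is then negligible, \<open>v / V\<close> is
  almost invariant and hence close to \<open>lam\<close>, and \<open>H\<close> is close to
  \<open>V\<close> times the flow out of \<open>lam\<close>. The same lower bound on
  \<open>V\<close> shows that every cluster of the class is entered often.\<close>

lemma ergodic_exit_estimate:
  fixes P P0 :: "nat \<Rightarrow> nat \<Rightarrow> real"
  assumes fin: "finite I" and EI: "E \<subseteq> I" and ne: "E \<noteq> {}"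
    and K: "0 \<le> K" "\<And>\<delta> w d. (\<And>i. i \<in> E \<Longrightarrow> 0 \<le> w i) \<Longrightarrow> (\<Sum>i\<in>E. w i) = 1 \<Longrightarrow>
      (\<And>d. d \<in> E \<Longrightarrow> \<bar>w d - (\<Sum>b\<in>E. w b * P0 b d)\<bar> \<le> \<delta>) \<Longrightarrow> d \<in> E \<Longrightarrow> \<bar>w d - lam d\<bar> \<le> K * \<delta>"
    and lam: "\<And>i. i \<in> E \<Longrightarrow> 0 < lam i"
    and \<eta>: "0 < \<eta>" "\<eta> \<le> \<zeta>" "\<zeta> \<le> 1/6" "\<And>i. i \<in> E \<Longrightarrow> 4 * K * \<eta> \<le> \<zeta> * lam i"
    and P: "\<And>b d. b \<in> E \<Longrightarrow> d \<in> I \<Longrightarrow> 0 \<le> P b d" "\<And>b d. b \<in> E \<Longrightarrow> d \<in> I \<Longrightarrow> P b d \<le> 1"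
    and PP0: "\<And>b d. b \<in> E \<Longrightarrow> d \<in> E \<Longrightarrow> \<bar>P b d - P0 b d\<bar> \<le> \<eta>"
    and out: "\<And>b. b \<in> E \<Longrightarrow> (\<Sum>d\<in>I - E. P b d) \<le> \<eta>"
    and v: "\<And>b. b \<in> E \<Longrightarrow> 0 \<le> v b"
    and vE: "\<And>d. d \<in> E \<Longrightarrow> \<bar>v d - (\<Sum>b\<in>E. v b * P b d)\<bar> \<le> 1 + \<eta> * (\<Sum>b\<in>E. v b * P b d)"
    and H: "\<And>d. d \<in> I - E \<Longrightarrow> \<bar>H d - (\<Sum>b\<in>E. v b * P b d)\<bar> \<le> \<eta> * (\<Sum>b\<in>E. v b * P b d)"
    and H1: "(\<Sum>d\<in>I - E. H d) = 1"
  shows "\<And>L. L \<subseteq> I - E \<Longrightarrow>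
      \<bar>(\<Sum>d\<in>L. H d) - (\<Sum>b\<in>E. \<Sum>d\<in>L. lam b * P b d) / (\<Sum>b\<in>E. \<Sum>d\<in>I - E. lam b * P b d)\<bar>
      \<le> 12 * \<zeta> * ((\<Sum>b\<in>E. \<Sum>d\<in>L. lam b * P b d) / (\<Sum>b\<in>E. \<Sum>d\<in>I - E. lam b * P b d))"
    and "\<And>b. b \<in> E \<Longrightarrow> lam b / (4 * \<eta>) \<le> v b"
proof -
  have finE: "finite E" using fin EI finite_subset by blast
  define V where "V = (\<Sum>b\<in>E. v b)"
  have V0: "0 \<le> V" unfolding V_def using v by (intro sum_nonneg) auto
  have vP: "0 \<le> (\<Sum>b\<in>E. v b * P b d)" if "d \<in> I" for d
    using v P that by (intro sum_nonneg) auto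
  have "1 = (\<Sum>d\<in>I - E. H d)" using H1 by simp
  also have "\<dots> \<le> (\<Sum>d\<in>I - E. (1 + \<eta>) * (\<Sum>b\<in>E. v b * P b d))"
  proof (rule sum_mono)
    fix d assume "d \<in> I - E"
    from H[OF this] show "H d \<le> (1 + \<eta>) * (\<Sum>b\<in>E. v b * P b d)" by (simp add: algebra_simps)
  qed
  also have "\<dots> = (1 + \<eta>) * (\<Sum>b\<in>E. v b * (\<Sum>d\<in>I - E. P b d))"
    unfolding sum_distrib_left[symmetric] by (subst sum.swap) (simp add: sum_distrib_left)
  also have "\<dots> \<le> (1 + \<eta>) * (\<Sum>b\<in>E. v b * \<eta>)"
    using \<eta> v out by (intro mult_left_mono sum_mono) auto
  also have "\<dots> = (1 + \<eta>) * (V * \<eta>)" by (simp add: V_def sum_distrib_right)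
  also have "\<dots> \<le> 2 * (V * \<eta>)" using \<eta> V0 by (intro mult_right_mono) auto
  finally have V1: "1 \<le> 2 * (V * \<eta>)" .
  then have V: "0 < V" using V0 by (cases "V = 0") auto
  define w where "w b = v b / V" for b
  have w0: "0 \<le> w b" if "b \<in> E" for b using v[OF that] V by (simp add: w_def)
  have w1: "(\<Sum>b\<in>E. w b) = 1" using V by (simp add: w_def V_def sum_divide_distrib[symmetric])
  have vw: "v b = V * w b" for b using V by (simp add: w_def)
  have invV: "1 / V \<le> 2 * \<eta>" using V1 V by (simp add: field_simps)
  \<comment> \<open>The defect has three sources: the initial entry, at most
    \<open>1 / V \<le> 2 * \<eta>\<close>; the relative error of the flow, \<eta>; and the
    replacement of \<open>P\<close> by its limit, again \<eta>.\<close>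
  have winv: "\<bar>w d - (\<Sum>b\<in>E. w b * P0 b d)\<bar> \<le> 4 * \<eta>" if d: "d \<in> E" for d
  proof -
    have dI: "d \<in> I" using d EI by auto
    have s: "(\<Sum>b\<in>E. v b * P b d) = V * (\<Sum>b\<in>E. w b * P b d)"
      by (simp add: vw sum_distrib_left mult.assoc)
    have sP: "(\<Sum>b\<in>E. w b * P b d) \<le> 1"
      unfolding w1[symmetric] using w0 P(2)[OF _ dI] by (intro sum_mono mult_left_le) auto
    have "V * \<bar>w d - (\<Sum>b\<in>E. w b * P b d)\<bar> = \<bar>V * w d - V * (\<Sum>b\<in>E. w b * P b d)\<bar>"
      using V by (simp add: abs_mult right_diff_distrib[symmetric])
    also have "\<dots> \<le> 1 + \<eta> * (V * (\<Sum>b\<in>E. w b * P b d))"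
      using vE[OF d] unfolding s vw[of d] .
    also have "\<dots> \<le> 1 + \<eta> * (V * 1)" using \<eta> V sP by (intro add_left_mono mult_left_mono) auto
    finally have "\<bar>w d - (\<Sum>b\<in>E. w b * P b d)\<bar> \<le> 1 / V + \<eta>" using V by (simp add: field_simps)
    then have a: "\<bar>w d - (\<Sum>b\<in>E. w b * P b d)\<bar> \<le> 3 * \<eta>" using invV by linarith
    have "\<bar>(\<Sum>b\<in>E. w b * P b d) - (\<Sum>b\<in>E. w b * P0 b d)\<bar> = \<bar>\<Sum>b\<in>E. w b * (P b d - P0 b d)\<bar>"
      by (simp add: right_diff_distrib sum_subtractf)
    also have "\<dots> \<le> (\<Sum>b\<in>E. w b * \<eta>)"
      using w0 PP0[OF _ d] by (intro order_trans[OF sum_abs] sum_mono) (auto simp: abs_mult intro!: mult_left_mono)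
    also have "\<dots> = \<eta>" using w1 by (simp add: sum_distrib_right[symmetric])
    finally show ?thesis using a by linarith
  qed
  \<comment> \<open>The assumption \<open>4 * K * \<eta> \<le> \<zeta> * lam i\<close> turns the
    additive error into a relative one, which is what very small exit probabilities require.\<close>
  have wl: "\<bar>w d - lam d\<bar> \<le> \<zeta> * lam d" if "d \<in> E" for d
    using K(2)[OF w0 w1 winv that] \<eta>(4)[OF that] by (simp add: mult.assoc mult.left_commute)
  show "lam b / (4 * \<eta>) \<le> v b" if b: "b \<in> E" for b
  proof -
    have "\<zeta> * lam b \<le> 1/6 * lam b" using \<eta> lam[OF b] by (intro mult_right_mono) auto
    then have "lam b / 2 \<le> w b" using wl[OF b] lam[OF b] by linarith
    then have "lam b / 2 * V \<le> v b" using V by (simp add: vw mult.commute)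
    moreover have "lam b / (4 * \<eta>) \<le> lam b / 2 * V"
      using mult_left_mono[OF V1, of "lam b"] lam[OF b] \<eta> by (simp add: field_simps)
    ultimately show ?thesis by linarith
  qed
  define s where "s d = (\<Sum>b\<in>E. lam b * P b d)" for d
  have s0: "0 \<le> s d" if "d \<in> I" for d
    unfolding s_def using lam P that by (intro sum_nonneg) (auto intro: less_imp_le mult_nonneg_nonneg)
  have Hd: "\<bar>H d - V * s d\<bar> \<le> 3 * \<zeta> * (V * s d)" if d: "d \<in> I - E" for d
  proof -
    define q where "q = (\<Sum>b\<in>E. w b * P b d)"
    have dI: "d \<in> I" using d by auto
    have e1: "\<bar>H d - V * q\<bar> \<le> \<eta> * (V * q)"
      using H[OF d] by (simp add: q_def vw sum_distrib_left mult.assoc)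
    have "\<bar>q - s d\<bar> = \<bar>\<Sum>b\<in>E. (w b - lam b) * P b d\<bar>"
      by (simp add: q_def s_def left_diff_distrib sum_subtractf)
    also have "\<dots> \<le> (\<Sum>b\<in>E. \<zeta> * lam b * P b d)"
      using wl P(1)[OF _ dI] by (intro order_trans[OF sum_abs] sum_mono) (auto simp: abs_mult intro!: mult_right_mono)
    also have "\<dots> = \<zeta> * s d" by (simp add: s_def sum_distrib_left mult.assoc)
    finally have e2: "\<bar>q - s d\<bar> \<le> \<zeta> * s d" .
    have "\<bar>V * q - V * s d\<bar> = V * \<bar>q - s d\<bar>"
      using V by (simp add: abs_mult right_diff_distrib[symmetric])
    also have "\<dots> \<le> V * (\<zeta> * s d)" using V e2 by (intro mult_left_mono) auto
    finally have e3: "\<bar>V * q - V * s d\<bar> \<le> \<zeta> * (V * s d)" by (simp add: mult.left_commute)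
    have Vs: "0 \<le> V * s d" using V s0[OF dI] by simp
    have "\<zeta> * (V * s d) \<le> 1 * (V * s d)" using \<eta> Vs by (intro mult_right_mono) auto
    then have Vq: "V * q \<le> 2 * (V * s d)" using e3 by linarith
    have "\<eta> * (V * q) \<le> \<eta> * (2 * (V * s d))" using \<eta> Vq by (intro mult_left_mono) auto
    also have "\<dots> \<le> \<zeta> * (2 * (V * s d))" using \<eta> Vs by (intro mult_right_mono) auto
    finally show ?thesis using e1 e3 by (simp add: abs_le_iff algebra_simps)
  qed
  have HL: "\<bar>(\<Sum>d\<in>L. H d) - V * (\<Sum>d\<in>L. s d)\<bar> \<le> 3 * \<zeta> * (V * (\<Sum>d\<in>L. s d))" if "L \<subseteq> I - E" for L
  proof -
    have "\<bar>(\<Sum>d\<in>L. H d) - V * (\<Sum>d\<in>L. s d)\<bar> = \<bar>\<Sum>d\<in>L. (H d - V * s d)\<bar>"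
      by (simp add: sum_subtractf sum_distrib_left)
    also have "\<dots> \<le> (\<Sum>d\<in>L. 3 * \<zeta> * (V * s d))"
      using Hd that by (intro order_trans[OF sum_abs] sum_mono) blast
    finally show ?thesis by (simp add: sum_distrib_left)
  qed
  define S where "S = (\<Sum>d\<in>I - E. s d)"
  have SL: "(\<Sum>b\<in>E. \<Sum>d\<in>L. lam b * P b d) = (\<Sum>d\<in>L. s d)" for L
    unfolding s_def by (rule sum.swap)
  fix L assume L: "L \<subseteq> I - E"
  define T where "T = (\<Sum>d\<in>L. s d)"
  have T0: "0 \<le> T" unfolding T_def using s0 L by (intro sum_nonneg) auto
  have S0: "0 \<le> S" unfolding S_def using s0 by (intro sum_nonneg) auto
  \<comment> \<open>Summing over all exits gives \<open>V * S\<close> close to 1, which eliminates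
    the unknown \<open>V\<close>: each exit probability becomes the quotient \<open>T / S\<close>.
    The error in \<open>V * S\<close> and the error of the flow contribute
    \<open>6 * \<zeta>\<close> each.\<close>
  have t1: "\<bar>1 - V * S\<bar> \<le> 3 * \<zeta> * (V * S)" using HL[of "I - E"] unfolding S_def H1 by simp
  have "S \<noteq> 0" using t1 by auto
  then have S: "0 < S" using S0 by simp
  define X where "X = V * S"
  have X: "0 < X" using V S by (simp add: X_def)
  define r where "r = T / S"
  have r0: "0 \<le> r" using T0 S by (simp add: r_def)
  have VT: "V * T = X * r" using S by (simp add: X_def r_def)
  have h: "\<bar>(\<Sum>d\<in>L. H d) - X * r\<bar> \<le> 3 * \<zeta> * X * r" using HL[OF L] unfolding T_def[symmetric] VT by (simp add: mult.assoc)
  have X1: "\<bar>1 - X\<bar> \<le> 3 * \<zeta> * X" using t1 by (simp add: X_def)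
  have z0: "0 < \<zeta>" using \<eta> by linarith
  have "\<zeta> * X \<le> 1/6 * X" using \<eta> X by (intro mult_right_mono) auto
  then have X2: "X \<le> 2" using X1 by linarith
  have "\<zeta> * X \<le> \<zeta> * 2" using X2 z0 by (intro mult_left_mono) auto
  then have k1: "3 * \<zeta> * X \<le> 6 * \<zeta>" by linarith
  then have "\<bar>X - 1\<bar> \<le> 6 * \<zeta>" using X1 by linarith
  then have "\<bar>X - 1\<bar> * r \<le> 6 * \<zeta> * r" using r0 by (intro mult_right_mono) auto
  then have "\<bar>X * r - r\<bar> \<le> 6 * \<zeta> * r" using r0 by (metis abs_mult abs_of_nonneg left_diff_distrib mult_1)
  moreover have "3 * \<zeta> * X * r \<le> 6 * \<zeta> * r" using k1 r0 by (intro mult_right_mono) auto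
  ultimately have "\<bar>(\<Sum>d\<in>L. H d) - r\<bar> \<le> 12 * \<zeta> * r" using h by linarith
  then show "\<bar>(\<Sum>d\<in>L. H d) - (\<Sum>b\<in>E. \<Sum>d\<in>L. lam b * P b d) / (\<Sum>b\<in>E. \<Sum>d\<in>I - E. lam b * P b d)\<bar>
      \<le> 12 * \<zeta> * ((\<Sum>b\<in>E. \<Sum>d\<in>L. lam b * P b d) / (\<Sum>b\<in>E. \<Sum>d\<in>I - E. lam b * P b d))"
    unfolding SL r_def T_def S_def .
qed

section \<open>Entry numbers of the clusters in a block\<close>

lemma indicator_union_minus:
  assumes "finite E" "disjoint_family_on A I" "E \<subseteq> I" "d \<in> I"
  shows "indicator ((\<Union>b\<in>E. A b) - A d) y = (\<Sum>b\<in>E - {d}. indicator (A b) y :: ennreal)"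
proof -
  have "(\<Union>b\<in>E. A b) - A d = (\<Union>b\<in>E - {d}. A b)"
    using assms(2-4) unfolding disjoint_family_on_def by blast
  moreover have "disjoint_family_on A (E - {d})"
    by (rule disjoint_family_on_mono[OF _ assms(2)]) (use assms(3) in auto)
  ultimately show ?thesis
    using indicator_UN_disjoint[of "E - {d}" A y] assms(1) by simp
qed

context renewal_kernel
begin

text \<open>\<open>v b\<close> is the expected number of entries into \<open>A b\<close>, a start in
  \<open>A b\<close> counting as one. Each stay in \<open>A b\<close> ends in \<open>A d\<close>
  with probability close to \<open>P b d\<close>, so the flow from \<open>b\<close> to
  \<open>d\<close> is close to \<open>v b * P b d\<close>, and balancing flows gives the equations.
  The last conclusion says that every entry into \<open>A b\<close> contributes at least
  \<open>c\<close> to the total of \<open>f\<close>.\<close>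

lemma entry_numbers:
  fixes A :: "nat \<Rightarrow> 'a set" and P :: "nat \<Rightarrow> nat \<Rightarrow> real"
  assumes I: "finite I" "disjoint_family_on A I" "(\<Union>b\<in>I. A b) = UNIV"
    and A[measurable]: "\<And>b. b \<in> I \<Longrightarrow> A b \<in> sets borel" and EI: "E \<subseteq> I"
    and x: "x \<in> (\<Union>b\<in>E. A b)"
    and bnd: "\<And>y. y \<in> (\<Union>b\<in>E. A b) \<Longrightarrow> pot K (\<Union>b\<in>E. A b) one one y \<le> ennreal B"
    and \<delta>: "0 \<le> \<delta>" "\<delta> \<le> 1" and P: "\<And>b d. b \<in> E \<Longrightarrow> d \<in> I \<Longrightarrow> 0 \<le> P b d" "\<And>b. b \<in> E \<Longrightarrow> P b b = 0"
    and lo: "\<And>b d y. b \<in> E \<Longrightarrow> d \<in> I \<Longrightarrow> b \<noteq> d \<Longrightarrow> y \<in> A b \<Longrightarrow>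
        ennreal ((1 - \<delta>) * P b d) \<le> pot K (A b) one (kop K (A d) one one) y"
    and hi: "\<And>b d y. b \<in> E \<Longrightarrow> d \<in> I \<Longrightarrow> b \<noteq> d \<Longrightarrow> y \<in> A b \<Longrightarrow>
        pot K (A b) one (kop K (A d) one one) y \<le> ennreal ((1 + \<delta>) * P b d)"
  defines "H \<equiv> \<lambda>d. enn2real (pot K (\<Union>b\<in>E. A b) one (kop K (A d) one one) x)"
  obtains v where "\<And>b. b \<in> E \<Longrightarrow> 0 \<le> v b"
    "\<And>d. d \<in> E \<Longrightarrow> \<bar>v d - (\<Sum>b\<in>E. v b * P b d)\<bar> \<le> 1 + \<delta> * (\<Sum>b\<in>E. v b * P b d)"
    "\<And>d. d \<in> I - E \<Longrightarrow> \<bar>H d - (\<Sum>b\<in>E. v b * P b d)\<bar> \<le> \<delta> * (\<Sum>b\<in>E. v b * P b d)"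
    "(\<Sum>d\<in>I - E. H d) = 1"
    "\<And>b f c. b \<in> E \<Longrightarrow> f \<in> borel_measurable borel \<Longrightarrow> (\<And>y. f y \<le> 1) \<Longrightarrow> 0 \<le> c \<Longrightarrow>
      (\<And>y. y \<in> A b \<Longrightarrow> ennreal c \<le> pot K (A b) one f y) \<Longrightarrow>
      ennreal (c * v b) \<le> pot K (\<Union>b\<in>E. A b) one f x"
proof -
  define C where "C = (\<Union>b\<in>E. A b)"
  note bnd = bnd[folded C_def] and x = x[folded C_def] and H_def = H_def[folded C_def]
  have finE: "finite E" using I(1) EI finite_subset by blast
  have [measurable]: "C \<in> sets borel" unfolding C_def using finE EI by (intro sets.finite_UN) auto
  have AC: "A b \<subseteq> C" if "b \<in> E" for b using that by (auto simp: C_def)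
  \<comment> \<open>Expected number of steps from \<open>C - A b\<close> into \<open>A b\<close>; a
    path that starts in \<open>A b\<close> has one further stay there, whence the indicator in
    \<open>v\<close>.\<close>
  define ent where "ent b = pot K C one (\<lambda>y. indicator (C - A b) y * kop K (A b) one one y) x" for b
  define v where "v b = enn2real (indicator (A b) x + ent b)" for b
  have ent_le: "ent b \<le> ennreal B" for b
  proof -
    have "ent b \<le> pot K C one one x" unfolding ent_def
      by (rule pot_mono) (use x kop_le_one[of "A b"] in \<open>auto simp: indicator_def\<close>)
    also have "\<dots> \<le> ennreal B" by (rule bnd[OF x])
    finally show ?thesis .
  qed
  have veq: "indicator (A b) x + ent b = ennreal (v b)" for b
  proof -
    have "indicator (A b) x + ent b \<le> 1 + ennreal B"
      by (intro add_mono ent_le) (simp add: indicator_def)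
    then have "indicator (A b) x + ent b < \<infinity>"
      by (rule le_less_trans) simp
    then show ?thesis by (simp add: v_def less_top)
  qed
  have v0: "0 \<le> v b" for b by (simp add: v_def)
  define F where "F b d = pot K C one (\<lambda>y. indicator (A b) y * kop K (A d) one one y) x" for b d
  define f where "f b d = enn2real (F b d)" for b d
  have F: "ennreal ((1 - \<delta>) * P b d) * ennreal (v b) \<le> F b d" "F b d \<le> ennreal ((1 + \<delta>) * P b d) * ennreal (v b)"
    if bd: "b \<in> E" "d \<in> I" "b \<noteq> d" for b d
  proof -
    have [measurable]: "A b \<in> sets borel" "A d \<in> sets borel" using A bd EI by auto
    have k1: "kop K (A d) one one y \<le> ennreal 1" for y using kop_le_one by simp
    show "ennreal ((1 - \<delta>) * P b d) * ennreal (v b) \<le> F b d"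
      unfolding veq[symmetric] F_def ent_def
      by (rule last_entry_bounds(1)[OF _ _ _ AC[OF bd(1)] x bnd k1 lo[OF bd] hi[OF bd]]) measurable
    show "F b d \<le> ennreal ((1 + \<delta>) * P b d) * ennreal (v b)"
      unfolding veq[symmetric] F_def ent_def
      by (rule last_entry_bounds(2)[OF _ _ _ AC[OF bd(1)] x bnd k1 lo[OF bd] hi[OF bd]]) measurable
  qed
  have f0: "0 \<le> f b d" for b d by (simp add: f_def)
  have feq: "F b d = ennreal (f b d)" if "b \<in> E" "d \<in> I" "b \<noteq> d" for b d
  proof -
    have "F b d < \<infinity>" by (rule le_less_trans[OF F(2)[OF that]]) (simp add: ennreal_mult_less_top)
    then show ?thesis by (simp add: f_def less_top)
  qed
  have f: "\<bar>f b d - v b * P b d\<bar> \<le> \<delta> * (v b * P b d)" if bd: "b \<in> E" "d \<in> I" "b \<noteq> d" for b d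
  proof -
    have p: "0 \<le> (1 - \<delta>) * P b d" "0 \<le> (1 + \<delta>) * P b d" using \<delta> P(1)[OF bd(1,2)] by auto
    have "(1 - \<delta>) * P b d * v b \<le> f b d"
      using F(1)[OF bd] p v0[of b] f0 unfolding feq[OF bd] by (simp add: ennreal_mult[symmetric])
    moreover have "f b d \<le> (1 + \<delta>) * P b d * v b"
      using F(2)[OF bd] p v0[of b] unfolding feq[OF bd] by (simp add: ennreal_mult[symmetric])
    ultimately show ?thesis by (simp add: abs_le_iff algebra_simps)
  qed
  \<comment> \<open>Entries into \<open>A d\<close> are sorted by the cluster they come
    from.\<close>
  have ent_sum: "ent d = ennreal (\<Sum>b\<in>E - {d}. f b d)" if d: "d \<in> I" for d
  proof -
    have [measurable]: "A d \<in> sets borel" using A d by auto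
    have "ent d = pot K C one (\<lambda>y. \<Sum>b\<in>E - {d}. indicator (A b) y * kop K (A d) one one y) x"
      unfolding ent_def C_def indicator_union_minus[OF finE I(2) EI d] by (simp add: sum_distrib_right)
    also have "\<dots> = (\<Sum>b\<in>E - {d}. F b d)" unfolding F_def
    proof (rule pot_sum)
      fix b assume "b \<in> E - {d}"
      then have [measurable]: "A b \<in> sets borel" using A EI by auto
      show "(\<lambda>y. indicator (A b) y * kop K (A d) one one y) \<in> borel_measurable borel" by measurable
    qed (use finE in auto)
    also have "\<dots> = (\<Sum>b\<in>E - {d}. ennreal (f b d))" using feq d by (intro sum.cong) auto
    also have "\<dots> = ennreal (\<Sum>b\<in>E - {d}. f b d)" by (rule sum_ennreal) (simp add: f_def)
    finally show ?thesis .
  qed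
  have sum_f: "\<bar>(\<Sum>b\<in>E - {d}. f b d) - (\<Sum>b\<in>E. v b * P b d)\<bar> \<le> \<delta> * (\<Sum>b\<in>E. v b * P b d)" if d: "d \<in> I" for d
  proof -
    have e: "(\<Sum>b\<in>E. v b * P b d) = (\<Sum>b\<in>E - {d}. v b * P b d)"
      using P(2)[of d] finE by (intro sum.mono_neutral_right) auto
    have "\<bar>(\<Sum>b\<in>E - {d}. f b d) - (\<Sum>b\<in>E - {d}. v b * P b d)\<bar> = \<bar>\<Sum>b\<in>E - {d}. (f b d - v b * P b d)\<bar>"
      by (simp add: sum_subtractf)
    also have "\<dots> \<le> (\<Sum>b\<in>E - {d}. \<delta> * (v b * P b d))"
      using f d by (intro order_trans[OF sum_abs] sum_mono) blast
    finally show ?thesis unfolding e by (simp add: sum_distrib_left)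
  qed
  have CA: "C \<inter> A d = {}" if d: "d \<in> I - E" for d
  proof -
    have "A b \<inter> A d = {}" if "b \<in> E" for b
      by (rule disjoint_family_onD[OF I(2)]) (use that d EI in auto)
    then show ?thesis unfolding C_def by blast
  qed
  \<comment> \<open>For \<open>d\<close> outside \<open>E\<close> an entry into \<open>A d\<close>
    is the exit from \<open>C\<close>, which happens at most once, so the expected number of entries
    is the exit probability.\<close>
  have Hsum: "pot K C one (kop K (A d) one one) x = ent d" if d: "d \<in> I - E" for d
    unfolding ent_def
  proof (rule pot_cong[OF _ x])
    fix y assume y: "y \<in> C"
    then have "y \<in> C - A d" using CA[OF d] by blast
    then show "kop K (A d) one one y = indicator (C - A d) y * kop K (A d) one one y" by simp
  qed
  show thesis
  proof (rule that[of v])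
    show "0 \<le> v b" for b by (rule v0)
    show "\<bar>v d - (\<Sum>b\<in>E. v b * P b d)\<bar> \<le> 1 + \<delta> * (\<Sum>b\<in>E. v b * P b d)" if d: "d \<in> E" for d
    proof -
      have dI: "d \<in> I" using d EI by auto
      have "ennreal (v d) = ennreal (indicator (A d) x + (\<Sum>b\<in>E - {d}. f b d))"
        unfolding veq[symmetric] ent_sum[OF dI]
        by (subst ennreal_plus) (auto simp: indicator_def f_def intro!: sum_nonneg)
      then have "v d = indicator (A d) x + (\<Sum>b\<in>E - {d}. f b d)"
        using v0[of d] by (subst (asm) ennreal_inj) (auto simp: f_def intro!: add_nonneg_nonneg sum_nonneg)
      moreover have "0 \<le> (indicator (A d) x :: real)" "(indicator (A d) x :: real) \<le> 1"
        by (auto simp: indicator_def)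
      ultimately show ?thesis using sum_f[OF dI] by linarith
    qed
    show "\<bar>H d - (\<Sum>b\<in>E. v b * P b d)\<bar> \<le> \<delta> * (\<Sum>b\<in>E. v b * P b d)" if d: "d \<in> I - E" for d
    proof -
      have dI: "d \<in> I" using d by auto
      have "H d = (\<Sum>b\<in>E - {d}. f b d)" unfolding H_def Hsum[OF d] ent_sum[OF dI]
        by (rule enn2real_ennreal) (auto simp: f_def intro: sum_nonneg)
      then show ?thesis using sum_f[OF dI] by simp
    qed
    show "(\<Sum>d\<in>I - E. H d) = 1"
    proof -
      have comp: "- C = (\<Union>d\<in>I - E. A d)"
      proof (intro equalityI subsetI)
        fix y assume y: "y \<in> - C"
        obtain d where d: "d \<in> I" "y \<in> A d" using I(3) by blast
        then show "y \<in> (\<Union>d\<in>I - E. A d)" using y by (auto simp: C_def)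
      next
        fix y assume "y \<in> (\<Union>d\<in>I - E. A d)"
        then obtain d where "d \<in> I - E" "y \<in> A d" by blast
        then show "y \<in> - C" using CA[of d] by blast
      qed
      have dis: "disjoint_family_on A (I - E)" by (rule disjoint_family_on_mono[OF _ I(2)]) auto
      have "pot K C one one x < \<infinity>" by (rule le_less_trans[OF bnd[OF x]]) simp
      then have "1 = pot K C one (kop K (- C) one one) x"
        by (intro pot_exit_total[symmetric] x) auto
      also have "kop K (- C) one one = (\<lambda>y. \<Sum>d\<in>I - E. kop K (A d) one one y)"
        unfolding comp by (intro ext kop_UN) (use I(1) dis A in auto)
      also have "pot K C one (\<lambda>y. \<Sum>d\<in>I - E. kop K (A d) one one y) x
          = (\<Sum>d\<in>I - E. pot K C one (kop K (A d) one one) x)"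
        by (rule pot_sum) (use I(1) A in auto)
      also have "\<dots> = (\<Sum>d\<in>I - E. ennreal (H d))"
      proof (rule sum.cong[OF refl])
        fix d assume d: "d \<in> I - E"
        have "ent d < \<infinity>" by (rule le_less_trans[OF ent_le]) simp
        then show "pot K C one (kop K (A d) one one) x = ennreal (H d)"
          unfolding H_def Hsum[OF d] by (simp add: less_top)
      qed
      also have "\<dots> = ennreal (\<Sum>d\<in>I - E. H d)" by (rule sum_ennreal) (simp add: H_def)
      finally have "ennreal 1 = ennreal (\<Sum>d\<in>I - E. H d)" by simp
      then show ?thesis by (subst (asm) ennreal_inj) (auto simp: H_def intro: sum_nonneg)
    qed
    show "ennreal (c * v b) \<le> pot K (\<Union>b\<in>E. A b) one g x"
      if b: "b \<in> E" and g[measurable]: "g \<in> borel_measurable borel" and g1: "\<And>y. g y \<le> 1" and c: "0 \<le> c"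
        and cg: "\<And>y. y \<in> A b \<Longrightarrow> ennreal c \<le> pot K (A b) one g y" for b g c
    proof -
      have [measurable]: "A b \<in> sets borel" using A b EI by auto
      have "ennreal (c * v b) = ennreal c * (indicator (A b) x + ent b)"
        unfolding veq using c v0 by (simp add: ennreal_mult)
      also have "\<dots> \<le> pot K C one (\<lambda>y. indicator (A b) y * g y) x"
        unfolding ent_def
        by (rule last_entry_bounds(1)[OF _ _ _ AC[OF b] x bnd _ cg, where F=1 and hi=top]) (use g1 in auto)
      also have "\<dots> \<le> pot K C one g x"
        by (rule pot_mono) (use x in \<open>auto simp: indicator_def\<close>)
      finally show ?thesis unfolding C_def .
    qed
  qed
qed

end

section \<open>Induction on the rank\<close>

locale renewal_hierarchy =
  fixes Q :: "'a::metric_space kernels" and S :: "nat \<Rightarrow> 'a set" and M :: nat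
    and p :: "real \<Rightarrow> nat \<Rightarrow> nat \<Rightarrow> real" and tau :: "real \<Rightarrow> nat \<Rightarrow> real"
    and Mh :: "nat \<Rightarrow> nat" and Ph :: "nat \<Rightarrow> real \<Rightarrow> nat \<Rightarrow> nat \<Rightarrow> real"
    and Eh :: "nat \<Rightarrow> nat \<Rightarrow> nat set" and lamh :: "nat \<Rightarrow> nat \<Rightarrow> nat \<Rightarrow> real" and R :: nat
  assumes base_ok: "base_ok Q S M" and cond_a: "cond_a Q S M p" and cond_b: "cond_b Q S M p tau"
    and cond_f: "cond_f M p tau" and hierarchy: "hierarchy M p Mh Ph Eh lamh R"
begin

lemma S_measurable: "i \<in> {1..M} \<Longrightarrow> S i \<in> sets borel"
  using base_ok unfolding base_ok_def by blast

lemma S_disjoint: "disjoint_family_on S {1..M}"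
  using base_ok unfolding base_ok_def disjoint_family_on_def by blast

lemma S_cover: "(\<Union>i\<in>{1..M}. S i) = UNIV"
  using base_ok unfolding base_ok_def by blast

lemma M_pos: "1 \<le> M"
proof (rule ccontr)
  assume "\<not> 1 \<le> M"
  then have "{1..M} = {}" by auto
  then show False using S_cover by simp
qed

lemma renewal_kernel: "0 < eps \<Longrightarrow> renewal_kernel (Q eps)"
  using base_ok unfolding base_ok_def by (intro renewal_kernel.intro) auto

lemma tau_pos: "0 < eps \<Longrightarrow> i \<in> {1..M} \<Longrightarrow> 0 < tau eps i"
  using cond_b unfolding cond_b_def by blast

lemma Mh_0: "Mh 0 = M" and Ph_0: "Ph 0 = p" and Mh_gt: "r < R \<Longrightarrow> 1 < Mh r"
  and hier_step: "r < R \<Longrightarrow> hier_step (Mh r) (Ph r) (Mh (Suc r)) (Eh r) (lamh r) (Ph (Suc r))"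
  using hierarchy unfolding hierarchy_def by blast+

lemma Pk_diag:
  assumes "0 < eps" "i \<in> {1..M}" "x \<in> S i" shows "Pk Q eps x (S i) = 0"
  using cond_a[unfolded cond_a_def, THEN conjunct1] assms by (metis (no_types))

lemma p_diag:
  assumes "0 < eps" "i \<in> {1..M}" shows "p eps i i = 0"
  using cond_a[unfolded cond_a_def, THEN conjunct2, THEN conjunct1] assms by (metis (no_types))

lemma p_row:
  assumes "0 < eps" "i \<in> {1..M}" shows "(\<Sum>j\<in>{1..M}. p eps i j) = 1"
  using cond_a[unfolded cond_a_def, THEN conjunct2, THEN conjunct2, THEN conjunct2, THEN conjunct1]
    assms by (metis (no_types))

lemma p_cases:
  assumes "i \<in> {1..M}" "j \<in> {1..M}" "i \<noteq> j"
  obtains "\<And>eps. 0 < eps \<Longrightarrow> p eps i j = 0" "\<And>eps x. 0 < eps \<Longrightarrow> x \<in> S i \<Longrightarrow> Pk Q eps x (S j) = 0"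
  | "\<And>eps. 0 < eps \<Longrightarrow> 0 < p eps i j" "\<And>eps x. 0 < eps \<Longrightarrow> x \<in> S i \<Longrightarrow> 0 < Pk Q eps x (S j)"
    "unif_tendsto (\<lambda>eps x. Pk Q eps x (S j) / p eps i j) 1 (S i)"
proof -
  have "(\<forall>eps>0. p eps i j = 0 \<and> (\<forall>x\<in>S i. Pk Q eps x (S j) = 0)) \<or>
      ((\<forall>eps>0. p eps i j > 0 \<and> (\<forall>x\<in>S i. Pk Q eps x (S j) > 0)) \<and>
       unif_tendsto (\<lambda>eps x. Pk Q eps x (S j) / p eps i j) 1 (S i))"
    using cond_a[unfolded cond_a_def, THEN conjunct2, THEN conjunct2, THEN conjunct1, THEN bspec,
        OF assms(1), THEN bspec, OF assms(2), THEN mp, OF assms(3)] .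
  then show thesis using that by blast
qed

lemma p_zero_or_pos:
  assumes "i \<in> {1..M}" "j \<in> {1..M}"
  shows "(\<forall>eps>0. p eps i j = 0) \<or> (\<forall>eps>0. 0 < p eps i j)"
proof (cases "i = j")
  case True
  then show ?thesis using p_diag assms by blast
next
  case False
  show ?thesis using assms False by (rule p_cases) blast+
qed

sublocale comparable_ratios M p tau
  by unfold_locales (use cond_f tau_pos M_pos in auto)

text \<open>Condition (f) speaks of ratios within a row, not of single entries. Since the row sums
  are 1, \<open>1 / p eps a b\<close> is the sum of the ratios \<open>p eps a d / p eps a b\<close>,
  so an entry that does not vanish is the inverse of a regular function.\<close>

lemma zreg_p:
  assumes a: "a \<in> {1..M}" and b: "b \<in> {1..M}"
  shows "zreg (\<lambda>eps. p eps a b)"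
proof (cases "\<forall>eps>0. p eps a b = 0")
  case True
  then show ?thesis by (simp add: zreg_def)
next
  case False
  then have pos: "\<And>eps. 0 < eps \<Longrightarrow> 0 < p eps a b" using p_zero_or_pos[OF a b] by blast
  have z: "zreg (\<lambda>eps. p eps a d / p eps a b)" if d: "d \<in> {1..M}" for d
  proof (cases "\<forall>eps>0. p eps a d = 0")
    case True
    then show ?thesis by (simp add: zreg_def)
  next
    case False
    then have "\<And>eps. 0 < eps \<Longrightarrow> 0 < p eps a d" using p_zero_or_pos[OF a d] by blast
    then have "ratio_list M p [(a, d, b)]" using a b d pos by (simp add: ratio_list_def)
    then show ?thesis using regular_ratio by (simp add: zreg_def)
  qed
  have s: "(\<Sum>d\<in>{1..M}. p eps a d / p eps a b) = inverse (p eps a b)" if "0 < eps" for eps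
    using p_row[OF that a] by (simp add: sum_divide_distrib[symmetric] inverse_eq_divide)
  have "zreg (\<lambda>eps. \<Sum>d\<in>{1..M}. p eps a d / p eps a b)" by (intro zreg_sum z) auto
  then have "regular M p (\<lambda>eps. \<Sum>d\<in>{1..M}. p eps a d / p eps a b)"
    by (rule zreg_regularI[where eps=1]) (use pos[of 1] s[of 1] in simp_all)
  from regular_inverse[OF this] have "regular M p (\<lambda>eps. p eps a b)"
    by (rule regular_cong) (subst s, assumption, simp)
  then show ?thesis by (simp add: zreg_def)
qed

lemma cut_p:
  assumes U: "U \<noteq> {}" "U \<subset> {1..M}"
  shows "\<exists>a\<in>U. \<exists>b\<in>{1..M} - U. \<forall>eps>0. 0 < p eps a b"
proof (rule ccontr)
  assume no: "\<not> ?thesis"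
  obtain i where i: "i \<in> U" using U by blast
  obtain j where j: "j \<in> {1..M}" "j \<notin> U" using U by blast
  have iM: "i \<in> {1..M}" using i U by blast
  have ij: "i \<noteq> j" using i j by blast
  let ?G = "{(a, b). a \<in> {1..M} \<and> b \<in> {1..M} \<and> not_ident_zero (\<lambda>eps. p eps a b)}"
  have "(i, j) \<in> ?G\<^sup>+"
    using cond_a[unfolded cond_a_def, THEN conjunct2, THEN conjunct2, THEN conjunct2, THEN conjunct2,
        THEN bspec, OF iM, THEN bspec, OF j(1), THEN mp, OF ij] .
  moreover have closed: "b \<in> U" if "(a, b) \<in> ?G" "a \<in> U" for a b
  proof (rule ccontr)
    assume b: "b \<notin> U"
    have "a \<in> {1..M}" "b \<in> {1..M}" "\<not> (\<forall>eps>0. p eps a b = 0)"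
      using that unfolding not_ident_zero_def by auto
    then have "\<forall>eps>0. 0 < p eps a b" using p_zero_or_pos[of a b] by blast
    then show False using no that(2) b \<open>b \<in> {1..M}\<close> by blast
  qed
  ultimately have "j \<in> U"
  proof (induction rule: trancl_induct)
    case (base y)
    then show ?case using closed i by blast
  next
    case (step y z)
    then show ?case using closed by blast
  qed
  then show False using j by blast
qed

lemma hierarchy_step:
  assumes "r < R"
  shows "hierarchy_step M p tau (Mh r) (Ph r) (Mh (Suc r)) (Eh r) (lamh r) (Ph (Suc r))"
  using assms
proof (induction r)
  case 0
  have h: "hier_step M p (Mh (Suc 0)) (Eh 0) (lamh 0) (Ph (Suc 0))"
    using hier_step[OF 0] by (simp add: Mh_0 Ph_0)
  show ?case unfolding Mh_0 Ph_0
    by (unfold_locales; fact h zreg_p p_diag p_row cut_p)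
next
  case (Suc r)
  then interpret h: hierarchy_step M p tau "Mh r" "Ph r" "Mh (Suc r)" "Eh r" "lamh r" "Ph (Suc r)"
    by simp
  have gt: "1 < Mh (Suc r)" using Mh_gt Suc by simp
  show ?case
    by (unfold_locales; (rule hier_step[OF Suc.prems] | erule (1) h.next_zreg[OF _ _ gt]
        | erule (1) h.Pr'_diag | erule (1) h.next_row[OF _ _ gt] | erule (1) h.next_cut[OF _ _ gt]))
qed

abbreviation Srk :: "nat \<Rightarrow> nat \<Rightarrow> 'a set" where
  "Srk \<equiv> Sr S Eh"

lemma Sr_0: "Srk 0 k = S k"
  by (simp add: Sr_def)

lemma Sr_Suc: "Srk (Suc r) k = (\<Union>i\<in>Eh r k. Srk r i)"
  by (auto simp: Sr_def)

lemma Sr_partition: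
  assumes "r < R"
  shows "\<And>k. k \<in> {1..Mh r} \<Longrightarrow> Srk r k \<in> sets borel"
    and "disjoint_family_on (Srk r) {1..Mh r}" and "(\<Union>k\<in>{1..Mh r}. Srk r k) = UNIV"
proof -
  have "(\<forall>k\<in>{1..Mh r}. Srk r k \<in> sets borel) \<and> disjoint_family_on (Srk r) {1..Mh r} \<and>
      (\<Union>k\<in>{1..Mh r}. Srk r k) = UNIV"
    using assms
  proof (induction r)
    case 0
    show ?case unfolding Mh_0 Sr_0 using S_measurable S_cover S_disjoint
      by (auto simp: disjoint_family_on_def Sr_0)
  next
    case (Suc r)
    then interpret h: hierarchy_step M p tau "Mh r" "Ph r" "Mh (Suc r)" "Eh r" "lamh r" "Ph (Suc r)"
      by (intro hierarchy_step) simp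
    have IH: "\<And>k. k \<in> {1..Mh r} \<Longrightarrow> Srk r k \<in> sets borel" "disjoint_family_on (Srk r) {1..Mh r}"
      "(\<Union>k\<in>{1..Mh r}. Srk r k) = UNIV" using Suc by auto
    have "Srk (Suc r) k \<in> sets borel" if k: "k \<in> {1..Mh (Suc r)}" for k
      unfolding Sr_Suc by (intro sets.finite_UN h.finite_E[OF k] IH(1) h.E_mem[OF k])
    moreover have "disjoint_family_on (Srk (Suc r)) {1..Mh (Suc r)}"
      unfolding disjoint_family_on_def
    proof (intro ballI impI)
      fix k l assume kl: "k \<in> {1..Mh (Suc r)}" "l \<in> {1..Mh (Suc r)}" "k \<noteq> l"
      have "Srk r i \<inter> Srk r j = {}" if ij: "i \<in> Eh r k" "j \<in> Eh r l" for i j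
      proof -
        have "i \<noteq> j" using h.E_disjoint[OF kl] ij by blast
        then show ?thesis
          using disjoint_family_onD[OF IH(2) h.E_mem[OF kl(1) ij(1)] h.E_mem[OF kl(2) ij(2)]] by blast
      qed
      then show "Srk (Suc r) k \<inter> Srk (Suc r) l = {}" unfolding Sr_Suc by blast
    qed
    moreover have "(\<Union>k\<in>{1..Mh (Suc r)}. Srk (Suc r) k) = UNIV"
    proof -
      have "(\<Union>k\<in>{1..Mh (Suc r)}. Srk (Suc r) k) = (\<Union>i\<in>(\<Union>k\<in>{1..Mh (Suc r)}. Eh r k). Srk r i)"
        unfolding Sr_Suc by blast
      then show ?thesis unfolding h.E_cover IH(3) .
    qed
    ultimately show ?case by blast
  qed
  then show "\<And>k. k \<in> {1..Mh r} \<Longrightarrow> Srk r k \<in> sets borel"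
    "disjoint_family_on (Srk r) {1..Mh r}" "(\<Union>k\<in>{1..Mh r}. Srk r k) = UNIV" by blast+
qed

lemma cl_subset:
  assumes "r < R" "k \<in> {1..Mh r}" shows "cl Eh r k \<subseteq> {1..M}" "cl Eh r k \<noteq> {}"
proof -
  have "cl Eh r k \<subseteq> {1..M} \<and> cl Eh r k \<noteq> {}" using assms
  proof (induction r arbitrary: k)
    case 0
    then show ?case by (simp add: Mh_0)
  next
    case (Suc r)
    then interpret h: hierarchy_step M p tau "Mh r" "Ph r" "Mh (Suc r)" "Eh r" "lamh r" "Ph (Suc r)"
      by (intro hierarchy_step) simp
    have "cl Eh r i \<subseteq> {1..M} \<and> cl Eh r i \<noteq> {}" if "i \<in> Eh r k" for i
      by (rule Suc.IH) (use Suc.prems h.E_mem that in auto)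
    then show ?case using h.E_nonempty[OF Suc.prems(2)] by auto
  qed
  then show "cl Eh r k \<subseteq> {1..M}" "cl Eh r k \<noteq> {}" by auto
qed

end

section \<open>Exits and visits of a single cluster\<close>

context renewal_kernel
begin

lemma kop_null:
  assumes [measurable]: "C \<in> sets borel" "w \<in> borel_measurable borel" "g \<in> borel_measurable borel"
    and z: "kop K C one one x = 0"
  shows "kop K C w g x = 0"
proof -
  have "AE z in K x. indicator C (fst z) * (1 * 1) = (0::ennreal)"
    using z unfolding kop_def by (subst (asm) nn_integral_0_iff_AE) auto
  then have "AE z in K x. indicator C (fst z) * (w (snd z) * g (fst z)) = 0"
    by eventually_elim (auto simp: indicator_def split: if_splits)
  then show ?thesis unfolding kop_def by (subst nn_integral_0_iff_AE) auto
qed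

end

context renewal_hierarchy
begin

text \<open>\<open>B\<close> may depend on \<open>eps\<close> in any way. Only finiteness, uniformly
  over the cluster at fixed \<open>eps\<close>, is recorded, to justify cancellation in
  \<open>ennreal\<close>.\<close>

definition pot_bounded :: "nat \<Rightarrow> nat \<Rightarrow> bool" where
  "pot_bounded r k \<longleftrightarrow>
    eventually (\<lambda>eps. \<exists>B. \<forall>x\<in>Srk r k. pot (Q eps) (Srk r k) one one x \<le> ennreal B) (at_right 0)"

text \<open>The asymptotics are stated as a product inequality rather than as a limit of quotients,
  so that identically vanishing transitions are covered too: there the exit probability has to be
  0.\<close>

definition exit_asymp :: "nat \<Rightarrow> nat \<Rightarrow> bool" where
  "exit_asymp r k \<longleftrightarrow> (\<forall>l\<in>{1..Mh r}. l \<noteq> k \<longrightarrow> (\<forall>\<delta>. 0 < \<delta> \<longrightarrow> \<delta> < 1 \<longrightarrow> eventually (\<lambda>eps. \<forall>x\<in>Srk r k.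
      ennreal ((1 - \<delta>) * Ph r eps k l) \<le> pot (Q eps) (Srk r k) one (kop (Q eps) (Srk r l) one one) x \<and>
      pot (Q eps) (Srk r k) one (kop (Q eps) (Srk r l) one one) x \<le> ennreal ((1 + \<delta>) * Ph r eps k l))
      (at_right 0)))"

definition visits_ge :: "nat \<Rightarrow> nat \<Rightarrow> nat \<Rightarrow> real \<Rightarrow> bool" where
  "visits_ge r k i c \<longleftrightarrow>
    eventually (\<lambda>eps. \<forall>x\<in>Srk r k. ennreal c \<le> pot (Q eps) (Srk r k) one (indicator (S i)) x) (at_right 0)"

text \<open>By (a) the chain leaves \<open>S k\<close> at its first step, so only the initial term
  of the potential remains.\<close>

lemma pot_base:
  assumes eps: "0 < eps" and k: "k \<in> {1..M}" and x: "x \<in> S k" and f[measurable]: "f \<in> borel_measurable borel"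
  shows "pot (Q eps) (S k) one f x = f x"
proof -
  interpret renewal_kernel "Q eps" by (rule renewal_kernel[OF eps])
  note [measurable] = S_measurable[OF k]
  have "kop (Q eps) (S k) one one x = emeasure (Q eps x) (S k \<times> UNIV)" by (rule kop_one) measurable
  also have "\<dots> = ennreal (Pk Q eps x (S k))"
    unfolding Pk_def
    by (rule finite_measure.emeasure_eq_measure[OF prob_space.finite_measure[OF prob_space_kernel]])
  finally have "kop (Q eps) (S k) one one x = 0" using Pk_diag[OF eps k x] by simp
  then show ?thesis using pot_unfold[of "S k" one f x] by (simp add: kop_null)
qed

lemma kop_Pk:
  assumes eps: "0 < eps" and j: "j \<in> {1..M}"
  shows "kop (Q eps) (S j) one one x = ennreal (Pk Q eps x (S j))"
proof -
  interpret renewal_kernel "Q eps" by (rule renewal_kernel[OF eps])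
  note [measurable] = S_measurable[OF j]
  have "kop (Q eps) (S j) one one x = emeasure (Q eps x) (S j \<times> UNIV)" by (rule kop_one) measurable
  then show ?thesis
    unfolding Pk_def
    by (simp add: finite_measure.emeasure_eq_measure[OF prob_space.finite_measure[OF prob_space_kernel]])
qed

lemma rank_base:
  assumes k: "k \<in> {1..Mh 0}"
  shows "exit_asymp 0 k" "\<And>i. i \<in> cl Eh 0 k \<Longrightarrow> visits_ge 0 k i 1"
proof -
  have kM: "k \<in> {1..M}" using k by (simp add: Mh_0)
  show "exit_asymp 0 k"
    unfolding exit_asymp_def Mh_0 Ph_0 Sr_0
  proof (intro ballI impI allI)
    fix l and \<delta> :: real assume l: "l \<in> {1..M}" "l \<noteq> k" and \<delta>: "0 < \<delta>" "\<delta> < 1"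
    note [measurable] = S_measurable[OF kM] S_measurable[OF l(1)]
    have pot: "pot (Q eps) (S k) one (kop (Q eps) (S l) one one) x = ennreal (Pk Q eps x (S l))"
      if "0 < eps" "x \<in> S k" for eps x
    proof -
      interpret renewal_kernel "Q eps" by (rule renewal_kernel[OF that(1)])
      show ?thesis by (subst pot_base[OF that(1) kM that(2)]) (auto simp: kop_Pk[OF that(1) l(1)])
    qed
    show "eventually (\<lambda>eps. \<forall>x\<in>S k.
        ennreal ((1 - \<delta>) * p eps k l) \<le> pot (Q eps) (S k) one (kop (Q eps) (S l) one one) x \<and>
        pot (Q eps) (S k) one (kop (Q eps) (S l) one one) x \<le> ennreal ((1 + \<delta>) * p eps k l)) (at_right 0)"
    proof (cases rule: p_cases[OF kM l(1) l(2)[symmetric]])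
      case 1
      show ?thesis using eventually_at_right_pos
        by eventually_elim (simp add: pot 1)
    next
      case 2
      show ?thesis using eventually_at_right_pos unif_tendstoD[OF 2(3) \<delta>(1)]
      proof eventually_elim
        case (elim eps)
        show ?case
        proof
          fix x assume x: "x \<in> S k"
          have p: "0 < p eps k l" using 2(1) elim by blast
          have "\<bar>Pk Q eps x (S l) / p eps k l - 1\<bar> < \<delta>" using elim x by blast
          then have "(1 - \<delta>) * p eps k l \<le> Pk Q eps x (S l)" "Pk Q eps x (S l) \<le> (1 + \<delta>) * p eps k l"
            using p by (simp_all add: abs_less_iff field_simps)
          then show "ennreal ((1 - \<delta>) * p eps k l) \<le> pot (Q eps) (S k) one (kop (Q eps) (S l) one one) x \<and>
            pot (Q eps) (S k) one (kop (Q eps) (S l) one one) x \<le> ennreal ((1 + \<delta>) * p eps k l)"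
            unfolding pot[OF elim(1) x] by (simp add: ennreal_leI)
        qed
      qed
    qed
  qed
  show "visits_ge 0 k i 1" if "i \<in> cl Eh 0 k" for i
    unfolding visits_ge_def Sr_0 using eventually_at_right_pos
  proof eventually_elim
    case (elim eps)
    then show ?case using that S_measurable[OF kM] by (auto simp: pot_base[OF elim kM])
  qed
qed

text \<open>The cluster itself does not change and the denominator is a full row sum, hence 1,
  because the diagonal vanishes. Only the target clusters are merged, and the estimates add up over
  the members of a block.\<close>

lemma rank_transient:
  assumes r: "Suc r < R" and k: "k \<in> {1..Mh (Suc r)}" and a: "a \<in> {1..Mh r}" "Eh r k = {a}" "lamh r k a = 1"
    and IH: "exit_asymp r a"
  shows "exit_asymp (Suc r) k"
proof -
  interpret h: hierarchy_step M p tau "Mh r" "Ph r" "Mh (Suc r)" "Eh r" "lamh r" "Ph (Suc r)"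
    using r by (intro hierarchy_step) simp
  have rR: "r < R" using r by simp
  have Sk: "Srk (Suc r) k = Srk r a" by (simp add: Sr_Suc a(2))
  note meas = Sr_partition(1)[OF rR]
  show ?thesis
    unfolding exit_asymp_def Sk
  proof (intro ballI impI allI)
    fix l and \<delta> :: real assume l: "l \<in> {1..Mh (Suc r)}" "l \<noteq> k" and \<delta>: "0 < \<delta>" "\<delta> < 1"
    have aj: "j \<noteq> a" if "j \<in> Eh r l" for j
      using h.E_disjoint[OF l(1) k l(2)] a(2) that by auto
    have den: "h.den eps k = 1" if eps: "0 < eps" for eps
    proof -
      have "h.den eps k = (\<Sum>j\<in>{1..Mh r} - {a}. Ph r eps a j)" by (simp add: h.den_def a(2,3))
      also have "\<dots> = (\<Sum>j\<in>{1..Mh r}. Ph r eps a j)"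
        using h.diag_Pr[OF eps a(1)] by (intro sum.mono_neutral_left) auto
      finally show ?thesis using h.row_Pr[OF eps a(1)] by simp
    qed
    have Ph: "Ph (Suc r) eps k l = (\<Sum>j\<in>Eh r l. Ph r eps a j)" if eps: "0 < eps" for eps
      using h.Pr'_eq[OF eps k l(1) l(2)[symmetric]] by (simp add: den[OF eps] h.num_def a(2,3))
    have "eventually (\<lambda>eps. \<forall>j\<in>Eh r l. \<forall>x\<in>Srk r a.
        ennreal ((1 - \<delta>) * Ph r eps a j) \<le> pot (Q eps) (Srk r a) one (kop (Q eps) (Srk r j) one one) x \<and>
        pot (Q eps) (Srk r a) one (kop (Q eps) (Srk r j) one one) x \<le> ennreal ((1 + \<delta>) * Ph r eps a j)) (at_right 0)"
    proof (rule eventually_ball_finite[OF h.finite_E[OF l(1)]], rule ballI)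
      fix j assume j: "j \<in> Eh r l"
      show "eventually (\<lambda>eps. \<forall>x\<in>Srk r a.
        ennreal ((1 - \<delta>) * Ph r eps a j) \<le> pot (Q eps) (Srk r a) one (kop (Q eps) (Srk r j) one one) x \<and>
        pot (Q eps) (Srk r a) one (kop (Q eps) (Srk r j) one one) x \<le> ennreal ((1 + \<delta>) * Ph r eps a j)) (at_right 0)"
        using IH h.E_mem[OF l(1) j] aj[OF j] \<delta> unfolding exit_asymp_def by blast
    qed
    then show "eventually (\<lambda>eps. \<forall>x\<in>Srk r a.
        ennreal ((1 - \<delta>) * Ph (Suc r) eps k l) \<le> pot (Q eps) (Srk r a) one (kop (Q eps) (Srk (Suc r) l) one one) x \<and>
        pot (Q eps) (Srk r a) one (kop (Q eps) (Srk (Suc r) l) one one) x \<le> ennreal ((1 + \<delta>) * Ph (Suc r) eps k l)) (at_right 0)"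
      using eventually_at_right_pos
    proof eventually_elim
      case (elim eps)
      interpret renewal_kernel "Q eps" by (rule renewal_kernel[OF elim(2)])
      note [measurable] = meas[OF a(1)] meas[OF h.E_mem[OF l(1)]]
      have dis: "disjoint_family_on (Srk r) (Eh r l)"
        by (rule disjoint_family_on_mono[OF h.E_subset[OF l(1)] Sr_partition(2)[OF rR]])
      have eq: "pot (Q eps) (Srk r a) one (kop (Q eps) (Srk (Suc r) l) one one) x
          = (\<Sum>j\<in>Eh r l. pot (Q eps) (Srk r a) one (kop (Q eps) (Srk r j) one one) x)" for x
      proof -
        have "kop (Q eps) (Srk (Suc r) l) one one = (\<lambda>y. \<Sum>j\<in>Eh r l. kop (Q eps) (Srk r j) one one y)"
          unfolding Sr_Suc by (intro ext kop_UN h.finite_E[OF l(1)] dis) measurable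
        then show ?thesis by (simp only:) (rule pot_sum, use h.finite_E[OF l(1)] in auto)
      qed
      have s: "ennreal (c * Ph (Suc r) eps k l) = (\<Sum>j\<in>Eh r l. ennreal (c * Ph r eps a j))" if "0 \<le> c" for c
        unfolding Ph[OF elim(2)] sum_distrib_left
        by (rule sum_ennreal[symmetric])
           (use that h.Pr_nonneg[OF elim(2) a(1) h.E_mem[OF l(1)]] in \<open>auto intro: mult_nonneg_nonneg\<close>)
      show ?case
      proof (intro ballI conjI)
        fix x assume "x \<in> Srk r a"
        then show "ennreal ((1 - \<delta>) * Ph (Suc r) eps k l) \<le> pot (Q eps) (Srk r a) one (kop (Q eps) (Srk (Suc r) l) one one) x"
          "pot (Q eps) (Srk r a) one (kop (Q eps) (Srk (Suc r) l) one one) x \<le> ennreal ((1 + \<delta>) * Ph (Suc r) eps k l)"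
          unfolding eq using elim(1) \<delta> by (simp_all add: s sum_mono)
      qed
    qed
  qed
qed

text \<open>Exit law and lower bounds on visits are obtained together, since both rest on the same
  entry numbers. The parameter \<eta>1 may be taken arbitrarily small, so the second half says that
  the number of entries into each member of the class exceeds every bound.\<close>

lemma rank_ergodic:
  assumes r: "Suc r < R" and k: "k \<in> {1..Mh (Suc r)}"
    and erg: "hierarchy_step.ergodic (Mh r) (Ph r) (Eh r) k"
    and bounded: "pot_bounded (Suc r) k" and IH: "\<And>b. b \<in> Eh r k \<Longrightarrow> exit_asymp r b"
    and \<zeta>: "0 < \<zeta>" "\<zeta> \<le> 1/6" and \<eta>1: "0 < \<eta>1"
  shows "eventually (\<lambda>eps. \<forall>x\<in>Srk (Suc r) k.
      (\<forall>l\<in>{1..Mh (Suc r)}. l \<noteq> k \<longrightarrow>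
        ennreal ((1 - 12 * \<zeta>) * Ph (Suc r) eps k l)
          \<le> pot (Q eps) (Srk (Suc r) k) one (kop (Q eps) (Srk (Suc r) l) one one) x \<and>
        pot (Q eps) (Srk (Suc r) k) one (kop (Q eps) (Srk (Suc r) l) one one) x
          \<le> ennreal ((1 + 12 * \<zeta>) * Ph (Suc r) eps k l)) \<and>
      (\<forall>b\<in>Eh r k. \<forall>f c. f \<in> borel_measurable borel \<longrightarrow> (\<forall>y. f y \<le> 1) \<longrightarrow> 0 \<le> c \<longrightarrow>
        (\<forall>y\<in>Srk r b. ennreal c \<le> pot (Q eps) (Srk r b) one f y) \<longrightarrow>
        ennreal (c * (lamh r k b / (4 * \<eta>1))) \<le> pot (Q eps) (Srk (Suc r) k) one f x)) (at_right 0)"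
proof -
  interpret h: hierarchy_step M p tau "Mh r" "Ph r" "Mh (Suc r)" "Eh r" "lamh r" "Ph (Suc r)"
    using r by (intro hierarchy_step) simp
  have rR: "r < R" using r by simp
  let ?I = "{1..Mh r}" and ?E = "Eh r k" and ?lam = "lamh r k" and ?C = "Srk (Suc r) k"
  note fin = h.finite_E[OF k] and ne = h.E_nonempty[OF k] and sub = h.E_subset[OF k] and mem = h.E_mem[OF k]
  note lam_pos = h.lam_pos[OF k] and lam = h.ergodic_lam[OF k erg]
  have rec: "recurrent (Mh r) h.P0 i" if "i \<in> ?E" for i by (rule h.ergodic_recurrent[OF k erg that])
  have P0nn: "0 \<le> h.P0 a b" if "a \<in> ?E" "b \<in> ?E" for a b by (rule h.P0_nonneg[OF mem[OF that(1)] mem[OF that(2)]])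
  have conn: "(a, b) \<in> {(x, y). x \<in> ?E \<and> y \<in> ?E \<and> 0 < h.P0 x y}\<^sup>*" if "a \<in> ?E" "b \<in> ?E" for a b
    by (rule recurrent_block_connected[OF h.E_block[OF k] rec that])
  obtain K where K: "0 \<le> K" "\<And>\<delta> w d. (\<And>i. i \<in> ?E \<Longrightarrow> 0 \<le> w i) \<Longrightarrow> (\<Sum>i\<in>?E. w i) = 1 \<Longrightarrow>
    (\<And>d. d \<in> ?E \<Longrightarrow> \<bar>w d - (\<Sum>b\<in>?E. w b * h.P0 b d)\<bar> \<le> \<delta>) \<Longrightarrow> d \<in> ?E \<Longrightarrow> \<bar>w d - ?lam d\<bar> \<le> K * \<delta>"
    using stationary_stability[OF fin ne P0nn conn lam_pos lam(2) lam(3)] by blast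
  define lm where "lm = Min (?lam ` ?E)"
  have lm: "0 < lm" "\<And>i. i \<in> ?E \<Longrightarrow> lm \<le> ?lam i"
    using fin ne lam_pos by (auto simp: lm_def)
  \<comment> \<open>The bound 1/2 makes \<eta> admissible in \<open>exit_asymp\<close>, \<eta>1
    serves the bound on entries, and the last two terms meet the conditions of
    \<open>ergodic_exit_estimate\<close>. Adding 1 to \<open>4 * K\<close> avoids division by zero
    when \<open>K\<close> is 0.\<close>
  define \<eta> where "\<eta> = min (min (1/2) \<eta>1) (min \<zeta> (\<zeta> * lm / (4 * K + 1)))"
  have K4: "0 < 4 * K + 1" using K(1) by simp
  have \<eta>: "0 < \<eta>" "\<eta> \<le> \<zeta>" "\<eta> \<le> \<eta>1" "\<eta> < 1" using \<zeta> \<eta>1 lm K4 by (auto simp: \<eta>_def)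
  have \<eta>K: "4 * K * \<eta> \<le> \<zeta> * ?lam i" if "i \<in> ?E" for i
  proof -
    have "4 * K * \<eta> \<le> (4 * K + 1) * (\<zeta> * lm / (4 * K + 1))"
      using K(1) \<eta>(1) by (intro mult_mono) (auto simp: \<eta>_def)
    also have "\<dots> = \<zeta> * lm" using K4 by simp
    also have "\<dots> \<le> \<zeta> * ?lam i" using \<zeta> lm(2)[OF that] by simp
    finally show ?thesis .
  qed
  have ev1: "eventually (\<lambda>eps. \<forall>b\<in>?E. \<forall>d\<in>?E. \<bar>Ph r eps b d - h.P0 b d\<bar> < \<eta>) (at_right 0)"
  proof (intro eventually_ball_finite ballI fin)
    fix b d assume bd: "b \<in> ?E" "d \<in> ?E"
    show "eventually (\<lambda>eps. \<bar>Ph r eps b d - h.P0 b d\<bar> < \<eta>) (at_right 0)"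
      using tendstoD[OF h.Pr_tendsto(1)[OF mem[OF bd(1)] mem[OF bd(2)]] \<eta>(1)] by (simp add: dist_real_def)
  qed
  \<comment> \<open>A recurrent class is closed for the limiting chain, so the one-step
    probabilities of leaving it tend to 0.\<close>
  have ev2: "eventually (\<lambda>eps. \<forall>b\<in>?E. (\<Sum>d\<in>?I - ?E. Ph r eps b d) < \<eta>) (at_right 0)"
  proof (intro eventually_ball_finite ballI fin)
    fix b assume b: "b \<in> ?E"
    have "h.P0 b d = 0" if d: "d \<in> ?I - ?E" for d
    proof -
      have dI: "d \<in> ?I" using d by blast
      have "\<not> 0 < h.P0 b d"
        using recurrent_block_closed[OF h.E_block[OF k] b rec[OF b] dI] d by blast
      then show ?thesis using h.P0_nonneg[OF mem[OF b] dI] by linarith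
    qed
    then have "((\<lambda>eps. \<Sum>d\<in>?I - ?E. Ph r eps b d) \<longlongrightarrow> (\<Sum>d\<in>?I - ?E. 0)) (at_right 0)"
    proof (intro tendsto_sum)
      fix d assume z: "\<And>d. d \<in> ?I - ?E \<Longrightarrow> h.P0 b d = 0" and d: "d \<in> ?I - ?E"
      have "d \<in> ?I" using d by blast
      from h.Pr_tendsto(1)[OF mem[OF b] this] show "((\<lambda>eps. Ph r eps b d) \<longlongrightarrow> 0) (at_right 0)"
        unfolding z[OF d] .
    qed
    then have "((\<lambda>eps. \<Sum>d\<in>?I - ?E. Ph r eps b d) \<longlongrightarrow> 0) (at_right 0)" by simp
    from order_tendstoD(2)[OF this \<eta>(1)]
    show "eventually (\<lambda>eps. (\<Sum>d\<in>?I - ?E. Ph r eps b d) < \<eta>) (at_right 0)" .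
  qed
  have ev3: "eventually (\<lambda>eps. \<forall>b\<in>?E. \<forall>d\<in>?I. d \<noteq> b \<longrightarrow> (\<forall>x\<in>Srk r b.
      ennreal ((1 - \<eta>) * Ph r eps b d) \<le> pot (Q eps) (Srk r b) one (kop (Q eps) (Srk r d) one one) x \<and>
      pot (Q eps) (Srk r b) one (kop (Q eps) (Srk r d) one one) x \<le> ennreal ((1 + \<eta>) * Ph r eps b d))) (at_right 0)"
  proof (intro eventually_ball_finite ballI fin)
    fix b d assume b: "b \<in> ?E" and d: "d \<in> ?I"
    show "eventually (\<lambda>eps. d \<noteq> b \<longrightarrow> (\<forall>x\<in>Srk r b.
      ennreal ((1 - \<eta>) * Ph r eps b d) \<le> pot (Q eps) (Srk r b) one (kop (Q eps) (Srk r d) one one) x \<and>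
      pot (Q eps) (Srk r b) one (kop (Q eps) (Srk r d) one one) x \<le> ennreal ((1 + \<eta>) * Ph r eps b d))) (at_right 0)"
      using IH[OF b, unfolded exit_asymp_def, THEN bspec, OF d] \<eta>(1,4)
      by (cases "d = b") auto
  qed simp
  show ?thesis
    using ev1 ev2 ev3 bounded[unfolded pot_bounded_def] eventually_at_right_pos
  proof eventually_elim
    case (elim eps)
    note eps = elim(5)
    obtain B where B: "\<And>y. y \<in> ?C \<Longrightarrow> pot (Q eps) ?C one one y \<le> ennreal B" using elim(4) by blast
    interpret renewal_kernel "Q eps" by (rule renewal_kernel[OF eps])
    note part = Sr_partition[OF rR]
    have Cu: "?C = (\<Union>b\<in>?E. Srk r b)" by (rule Sr_Suc)
    show ?case
    proof (rule ballI)
      fix x assume x: "x \<in> ?C"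
      define H where "H d = enn2real (pot (Q eps) ?C one (kop (Q eps) (Srk r d) one one) x)" for d
      obtain v where v: "\<And>b. b \<in> ?E \<Longrightarrow> 0 \<le> v b"
        "\<And>d. d \<in> ?E \<Longrightarrow> \<bar>v d - (\<Sum>b\<in>?E. v b * Ph r eps b d)\<bar> \<le> 1 + \<eta> * (\<Sum>b\<in>?E. v b * Ph r eps b d)"
        "\<And>d. d \<in> ?I - ?E \<Longrightarrow> \<bar>H d - (\<Sum>b\<in>?E. v b * Ph r eps b d)\<bar> \<le> \<eta> * (\<Sum>b\<in>?E. v b * Ph r eps b d)"
        "(\<Sum>d\<in>?I - ?E. H d) = 1"
        "\<And>b f c. b \<in> ?E \<Longrightarrow> f \<in> borel_measurable borel \<Longrightarrow> (\<And>y. f y \<le> 1) \<Longrightarrow> 0 \<le> c \<Longrightarrow>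
          (\<And>y. y \<in> Srk r b \<Longrightarrow> ennreal c \<le> pot (Q eps) (Srk r b) one f y) \<Longrightarrow>
          ennreal (c * v b) \<le> pot (Q eps) ?C one f x"
      proof (rule entry_numbers[of ?I "Srk r" ?E x B \<eta> "Ph r eps", folded Cu, folded H_def])
        show "\<And>b d. b \<in> ?E \<Longrightarrow> d \<in> ?I \<Longrightarrow> 0 \<le> Ph r eps b d" by (rule h.Pr_nonneg[OF eps mem])
        show "\<And>b. b \<in> ?E \<Longrightarrow> Ph r eps b b = 0" by (rule h.diag_Pr[OF eps mem])
        show "\<And>b d y. b \<in> ?E \<Longrightarrow> d \<in> ?I \<Longrightarrow> b \<noteq> d \<Longrightarrow> y \<in> Srk r b \<Longrightarrow>
            ennreal ((1 - \<eta>) * Ph r eps b d) \<le> pot (Q eps) (Srk r b) one (kop (Q eps) (Srk r d) one one) y"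
          "\<And>b d y. b \<in> ?E \<Longrightarrow> d \<in> ?I \<Longrightarrow> b \<noteq> d \<Longrightarrow> y \<in> Srk r b \<Longrightarrow>
            pot (Q eps) (Srk r b) one (kop (Q eps) (Srk r d) one one) y \<le> ennreal ((1 + \<eta>) * Ph r eps b d)"
          using elim(3) by metis+
      qed (use part sub x B \<eta> in \<open>auto simp del: atLeastAtMost_iff\<close>)
      have finI: "finite ?I" by simp
      have Pnn: "0 \<le> Ph r eps b d" and Ple: "Ph r eps b d \<le> 1" if "b \<in> ?E" "d \<in> ?I" for b d
        by (rule h.Pr_nonneg[OF eps mem[OF that(1)] that(2)], rule h.Pr_le_one[OF eps mem[OF that(1)] that(2)])
      have close: "\<bar>Ph r eps b d - h.P0 b d\<bar> \<le> \<eta>" if "b \<in> ?E" "d \<in> ?E" for b d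
        using elim(1) that by (auto intro: less_imp_le)
      have out: "(\<Sum>d\<in>?I - ?E. Ph r eps b d) \<le> \<eta>" if "b \<in> ?E" for b
        using elim(2) that by (auto intro: less_imp_le)
      have est: "\<bar>(\<Sum>d\<in>L. H d) - (\<Sum>b\<in>?E. \<Sum>d\<in>L. ?lam b * Ph r eps b d) / (\<Sum>b\<in>?E. \<Sum>d\<in>?I - ?E. ?lam b * Ph r eps b d)\<bar>
          \<le> 12 * \<zeta> * ((\<Sum>b\<in>?E. \<Sum>d\<in>L. ?lam b * Ph r eps b d) / (\<Sum>b\<in>?E. \<Sum>d\<in>?I - ?E. ?lam b * Ph r eps b d))"
        if "L \<subseteq> ?I - ?E" for L
        by (rule ergodic_exit_estimate(1)[where I="?I" and E="?E" and K=K and ?P0.0="h.P0" and lam="?lam"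
              and \<eta>=\<eta> and \<zeta>=\<zeta> and P="Ph r eps" and v=v and H=H];
            (fact finI sub ne K lam_pos \<eta>(1,2) \<zeta>(2) \<eta>K Pnn Ple close out v(1-4) that))
      have vlo: "?lam b / (4 * \<eta>) \<le> v b" if "b \<in> ?E" for b
        by (rule ergodic_exit_estimate(2)[where I="?I" and E="?E" and K=K and ?P0.0="h.P0" and lam="?lam"
              and \<eta>=\<eta> and \<zeta>=\<zeta> and P="Ph r eps" and v=v and H=H];
            (fact finI sub ne K lam_pos \<eta>(1,2) \<zeta>(2) \<eta>K Pnn Ple close out v(1-4) that))
      have A: "ennreal ((1 - 12 * \<zeta>) * Ph (Suc r) eps k l) \<le> pot (Q eps) ?C one (kop (Q eps) (Srk (Suc r) l) one one) x"
        "pot (Q eps) ?C one (kop (Q eps) (Srk (Suc r) l) one one) x \<le> ennreal ((1 + 12 * \<zeta>) * Ph (Suc r) eps k l)"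
        if l: "l \<in> {1..Mh (Suc r)}" "l \<noteq> k" for l
      proof -
        note [measurable] = part(1)[OF h.E_mem[OF l(1)]]
        have [measurable]: "?C \<in> sets borel" unfolding Cu by (intro sets.finite_UN fin part(1) mem)
        have dis: "disjoint_family_on (Srk r) (Eh r l)"
          by (rule disjoint_family_on_mono[OF h.E_subset[OF l(1)] part(2)])
        have keq: "kop (Q eps) (Srk (Suc r) l) one one = (\<lambda>y. \<Sum>j\<in>Eh r l. kop (Q eps) (Srk r j) one one y)"
          unfolding Sr_Suc by (intro ext kop_UN h.finite_E[OF l(1)] dis) measurable
        have "pot (Q eps) ?C one (kop (Q eps) (Srk (Suc r) l) one one) x
            = (\<Sum>j\<in>Eh r l. pot (Q eps) ?C one (kop (Q eps) (Srk r j) one one) x)"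
          unfolding keq by (rule pot_sum) (use h.finite_E[OF l(1)] in auto)
        also have "\<dots> = (\<Sum>j\<in>Eh r l. ennreal (H j))"
        proof (rule sum.cong[OF refl])
          fix j assume j: "j \<in> Eh r l"
          have "pot (Q eps) ?C one (kop (Q eps) (Srk r j) one one) x \<le> pot (Q eps) ?C one one x"
            by (rule pot_mono) (use x kop_le_one in auto)
          also have "\<dots> \<le> ennreal B" by (rule B[OF x])
          finally show "pot (Q eps) ?C one (kop (Q eps) (Srk r j) one one) x = ennreal (H j)"
            unfolding H_def by (rule ennreal_finite_enn2real)
        qed
        also have "\<dots> = ennreal (\<Sum>j\<in>Eh r l. H j)" by (rule sum_ennreal) (simp add: H_def)
        finally have eq: "pot (Q eps) ?C one (kop (Q eps) (Srk (Suc r) l) one one) x = ennreal (\<Sum>j\<in>Eh r l. H j)" .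
        have "Eh r l \<subseteq> ?I - ?E"
          using h.E_subset[OF l(1)] h.E_disjoint[OF l(1) k l(2)] by blast
        from est[OF this]
        have "\<bar>(\<Sum>j\<in>Eh r l. H j) - Ph (Suc r) eps k l\<bar> \<le> 12 * \<zeta> * Ph (Suc r) eps k l"
          unfolding h.Pr'_eq[OF eps k l(1) l(2)[symmetric]] h.num_def h.den_def .
        then have "(1 - 12 * \<zeta>) * Ph (Suc r) eps k l \<le> (\<Sum>j\<in>Eh r l. H j)"
          "(\<Sum>j\<in>Eh r l. H j) \<le> (1 + 12 * \<zeta>) * Ph (Suc r) eps k l" by (simp_all add: abs_le_iff algebra_simps)
        then show "ennreal ((1 - 12 * \<zeta>) * Ph (Suc r) eps k l) \<le> pot (Q eps) ?C one (kop (Q eps) (Srk (Suc r) l) one one) x"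
          "pot (Q eps) ?C one (kop (Q eps) (Srk (Suc r) l) one one) x \<le> ennreal ((1 + 12 * \<zeta>) * Ph (Suc r) eps k l)"
          unfolding eq by (simp_all add: ennreal_leI)
      qed
      have V: "ennreal (c * (?lam b / (4 * \<eta>1))) \<le> pot (Q eps) ?C one f x"
        if b: "b \<in> ?E" and f: "f \<in> borel_measurable borel" "\<And>y. f y \<le> 1" and c: "0 \<le> c"
          and lo: "\<And>y. y \<in> Srk r b \<Longrightarrow> ennreal c \<le> pot (Q eps) (Srk r b) one f y" for b f c
      proof -
        have "?lam b / (4 * \<eta>1) \<le> ?lam b / (4 * \<eta>)"
          using \<eta>(1,3) lam_pos[OF b] by (intro divide_left_mono) auto
        also have "\<dots> \<le> v b" by (rule vlo[OF b])
        finally have "ennreal (c * (?lam b / (4 * \<eta>1))) \<le> ennreal (c * v b)"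
          using c by (intro ennreal_leI mult_left_mono)
        also have "\<dots> \<le> pot (Q eps) ?C one f x" by (rule v(5)[OF b f c lo])
        finally show ?thesis .
      qed
      show "(\<forall>l\<in>{1..Mh (Suc r)}. l \<noteq> k \<longrightarrow>
          ennreal ((1 - 12 * \<zeta>) * Ph (Suc r) eps k l) \<le> pot (Q eps) ?C one (kop (Q eps) (Srk (Suc r) l) one one) x \<and>
          pot (Q eps) ?C one (kop (Q eps) (Srk (Suc r) l) one one) x \<le> ennreal ((1 + 12 * \<zeta>) * Ph (Suc r) eps k l)) \<and>
        (\<forall>b\<in>?E. \<forall>f c. f \<in> borel_measurable borel \<longrightarrow> (\<forall>y. f y \<le> 1) \<longrightarrow> 0 \<le> c \<longrightarrow>
          (\<forall>y\<in>Srk r b. ennreal c \<le> pot (Q eps) (Srk r b) one f y) \<longrightarrow>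
          ennreal (c * (?lam b / (4 * \<eta>1))) \<le> pot (Q eps) ?C one f x)"
        by (intro conjI ballI impI allI A V) auto
    qed
  qed
qed

end

text \<open>Serves to pass from functionals normalised by the transition probability of the
  hierarchy to the law conditioned on the exit cluster.\<close>

lemma unif_tendsto_divide_one:
  assumes F: "unif_tendsto F L A" and G: "unif_tendsto G 1 A"
  shows "unif_tendsto (\<lambda>eps x. F eps x / G eps x) L A"
  unfolding unif_tendsto_def
proof (intro allI impI)
  fix \<rho> :: real assume \<rho>: "0 < \<rho>"
  define \<delta> where "\<delta> = min (1/2) (\<rho> / (2 * (1 + \<bar>L\<bar>)))"
  have \<delta>: "0 < \<delta>" using \<rho> by (simp add: \<delta>_def add_pos_nonneg)
  have \<delta>2: "\<delta> \<le> 1/2" unfolding \<delta>_def by (rule min.cobounded1)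
  have \<delta>L: "2 * (\<delta> * (1 + \<bar>L\<bar>)) \<le> \<rho>"
  proof -
    have "\<delta> * (1 + \<bar>L\<bar>) \<le> \<rho> / (2 * (1 + \<bar>L\<bar>)) * (1 + \<bar>L\<bar>)"
      by (intro mult_right_mono) (auto simp: \<delta>_def)
    also have "\<dots> = \<rho> / 2" by (simp add: field_simps)
    finally show ?thesis by simp
  qed
  show "eventually (\<lambda>eps. \<forall>x\<in>A. \<bar>F eps x / G eps x - L\<bar> < \<rho>) (at_right 0)"
    using unif_tendstoD[OF F \<delta>] unif_tendstoD[OF G \<delta>]
  proof eventually_elim
    case (elim eps)
    show ?case
    proof
      fix x assume x: "x \<in> A"
      have f: "\<bar>F eps x - L\<bar> < \<delta>" and g: "\<bar>G eps x - 1\<bar> < \<delta>" using elim x by auto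
      have G2: "1/2 \<le> G eps x" using g \<delta>2 by linarith
      have "\<bar>F eps x - L * G eps x\<bar> = \<bar>(F eps x - L) - L * (G eps x - 1)\<bar>" by (simp add: algebra_simps)
      also have "\<dots> \<le> \<bar>F eps x - L\<bar> + \<bar>L\<bar> * \<bar>G eps x - 1\<bar>"
        using abs_triangle_ineq4[of "F eps x - L" "L * (G eps x - 1)"] by (simp add: abs_mult)
      also have "\<dots> < \<delta> + \<bar>L\<bar> * \<delta>"
        using f g by (intro add_less_le_mono mult_left_mono) auto
      finally have num: "\<bar>F eps x - L * G eps x\<bar> < \<delta> * (1 + \<bar>L\<bar>)" by (simp add: algebra_simps)
      have G0: "0 < G eps x" using G2 by linarith
      then have "F eps x / G eps x - L = (F eps x - L * G eps x) / G eps x" by (simp add: diff_divide_distrib)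
      then have "\<bar>F eps x / G eps x - L\<bar> = \<bar>F eps x - L * G eps x\<bar> / G eps x"
        using G0 by (simp add: abs_divide)
      also have "\<dots> \<le> \<bar>F eps x - L * G eps x\<bar> / (1/2)"
        using G2 by (intro divide_left_mono) auto
      also have "\<dots> < 2 * (\<delta> * (1 + \<bar>L\<bar>))" using num by simp
      finally show "\<bar>F eps x / G eps x - L\<bar> < \<rho>" using \<delta>L by linarith
    qed
  qed
qed

section \<open>From one rank to the next, and the moments of a single sojourn\<close>

context renewal_hierarchy
begin

text \<open>The visit statement comes in two strengths. A cluster consisting of one set may have
  just one visit, so only some positive bound is available there; this suffices to start an ergodic
  step, which makes all visits unbounded. Transient steps leave the cluster as it is, so a cluster
  with more than one set must have passed through an ergodic step.\<close>

lemma rank_asymptotics: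
  assumes "r < R" "k \<in> {1..Mh r}" "pot_bounded r k"
  shows "exit_asymp r k \<and> (\<forall>i\<in>cl Eh r k. \<exists>c>0. visits_ge r k i c) \<and>
    ((\<forall>i. cl Eh r k \<noteq> {i}) \<longrightarrow> (\<forall>i\<in>cl Eh r k. \<forall>c. visits_ge r k i c))"
  using assms
proof (induction r arbitrary: k)
  case 0
  then show ?case using rank_base[OF 0(2)] by (auto intro: exI[of _ 1])
next
  case (Suc r)
  interpret h: hierarchy_step M p tau "Mh r" "Ph r" "Mh (Suc r)" "Eh r" "lamh r" "Ph (Suc r)"
    using Suc.prems by (intro hierarchy_step) simp
  note k = Suc.prems(2)
  have rR: "r < R" using Suc.prems by simp
  \<comment> \<open>A stay in a subcluster is part of a stay in the cluster, so finiteness descends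
    to lower ranks; the induction can therefore assume it instead of proving it.\<close>
  have bnd: "pot_bounded r b" if b: "b \<in> Eh r k" for b
    unfolding pot_bounded_def using Suc.prems(3)[unfolded pot_bounded_def] eventually_at_right_pos
  proof eventually_elim
    case (elim eps)
    obtain B where B: "\<forall>x\<in>Srk (Suc r) k. pot (Q eps) (Srk (Suc r) k) one one x \<le> ennreal B"
      using elim by blast
    interpret renewal_kernel "Q eps" by (rule renewal_kernel[OF elim(2)])
    have sub: "Srk r b \<subseteq> Srk (Suc r) k" unfolding Sr_Suc using b by blast
    have "pot (Q eps) (Srk r b) one one x \<le> ennreal B" if "x \<in> Srk r b" for x
    proof -
      have "pot (Q eps) (Srk r b) one one x \<le> pot (Q eps) (Srk (Suc r) k) one one x"
        by (rule pot_mono) (use sub that in auto)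
      also have "\<dots> \<le> ennreal B" using B sub that by blast
      finally show ?thesis .
    qed
    then show ?case by blast
  qed
  have IH: "exit_asymp r b" "\<And>i. i \<in> cl Eh r b \<Longrightarrow> \<exists>c>0. visits_ge r b i c"
    "(\<forall>i. cl Eh r b \<noteq> {i}) \<longrightarrow> (\<forall>i\<in>cl Eh r b. \<forall>c. visits_ge r b i c)" if b: "b \<in> Eh r k" for b
    using Suc.IH[OF rR h.E_mem[OF k b] bnd[OF b]] by blast+
  show ?case
  proof (cases "h.ergodic k")
    case False
    obtain a where a: "a \<in> {1..Mh r}" "Eh r k = {a}" "lamh r k a = 1"
      using h.not_ergodic_singleton[OF k False] by blast
    have aE: "a \<in> Eh r k" using a by simp
    have "exit_asymp (Suc r) k"
      by (rule rank_transient[OF Suc.prems(1) k a IH(1)[OF aE]])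
    moreover have "visits_ge (Suc r) k = visits_ge r a" unfolding visits_ge_def fun_eq_iff Sr_Suc by (simp add: a(2))
    moreover have "cl Eh (Suc r) k = cl Eh r a" by (simp add: a(2))
    ultimately show ?thesis using IH(2,3)[OF aE] by simp
  next
    case True
    note erg = rank_ergodic[OF Suc.prems(1) k True Suc.prems(3) IH(1)]
    have "exit_asymp (Suc r) k" unfolding exit_asymp_def
    proof (intro ballI impI allI)
      fix l and \<delta> :: real assume l: "l \<in> {1..Mh (Suc r)}" "l \<noteq> k" and \<delta>: "0 < \<delta>" "\<delta> < 1"
      have "0 < \<delta> / 12" "\<delta> / 12 \<le> 1/6" using \<delta> by auto
      from erg[OF _ this, of 1]
      show "eventually (\<lambda>eps. \<forall>x\<in>Srk (Suc r) k.
        ennreal ((1 - \<delta>) * Ph (Suc r) eps k l) \<le> pot (Q eps) (Srk (Suc r) k) one (kop (Q eps) (Srk (Suc r) l) one one) x \<and>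
        pot (Q eps) (Srk (Suc r) k) one (kop (Q eps) (Srk (Suc r) l) one one) x \<le> ennreal ((1 + \<delta>) * Ph (Suc r) eps k l)) (at_right 0)"
      proof (rule eventually_mono, goal_cases)
        case (3 eps)
        show ?case using 3[THEN bspec, THEN conjunct1, THEN bspec, OF _ l(1), THEN mp, OF _ l(2)] by simp
      qed auto
    qed
    moreover have "visits_ge (Suc r) k i c" if i: "i \<in> cl Eh (Suc r) k" for i c
    proof -
      obtain b where b: "b \<in> Eh r k" "i \<in> cl Eh r b" using i by auto
      obtain c0 where c0: "0 < c0" "visits_ge r b i c0" using IH(2)[OF b] by blast
      have lp: "0 < lamh r k b" by (rule h.lam_pos[OF k b(1)])
      \<comment> \<open>Solves \<open>c0 * (lamh r k b / (4 * \<eta>1)) = max c 1\<close>; the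
        maximum keeps \<eta>1 positive for every real \<open>c\<close>.\<close>
      define \<eta>1 where "\<eta>1 = c0 * lamh r k b / (4 * max c 1)"
      have e1: "0 < \<eta>1" using c0 lp by (simp add: \<eta>1_def)
      have "c0 * (lamh r k b / (4 * \<eta>1)) = max c 1"
        using c0 lp by (simp add: \<eta>1_def field_simps)
      then have cc: "c \<le> c0 * (lamh r k b / (4 * \<eta>1))" by simp
      have iM: "i \<in> {1..M}" using cl_subset(1)[OF Suc.prems(1) k] i by blast
      have ev: "eventually (\<lambda>eps. \<forall>x\<in>Srk (Suc r) k. \<forall>b\<in>Eh r k. \<forall>f c. f \<in> borel_measurable borel \<longrightarrow> (\<forall>y. f y \<le> 1) \<longrightarrow> 0 \<le> c \<longrightarrow>
        (\<forall>y\<in>Srk r b. ennreal c \<le> pot (Q eps) (Srk r b) one f y) \<longrightarrow>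
        ennreal (c * (lamh r k b / (4 * \<eta>1))) \<le> pot (Q eps) (Srk (Suc r) k) one f x) (at_right 0)"
        by (rule eventually_mono[OF erg[where \<zeta>="1/6", OF _ _ _ e1]]) auto
      show ?thesis unfolding visits_ge_def
        using ev c0(2)[unfolded visits_ge_def]
      proof eventually_elim
        case (elim eps)
        show ?case
        proof
          fix x assume x: "x \<in> Srk (Suc r) k"
          have m: "indicator (S i) \<in> borel_measurable borel" using S_measurable[OF iM] by measurable
          have i1: "\<forall>y. indicator (S i) y \<le> (1::ennreal)" by (simp add: indicator_def)
          have "ennreal c \<le> ennreal (c0 * (lamh r k b / (4 * \<eta>1)))" using cc by (rule ennreal_leI)
          also have "\<dots> \<le> pot (Q eps) (Srk (Suc r) k) one (indicator (S i)) x"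
            using elim(1)[THEN bspec, OF x, THEN bspec, OF b(1), THEN spec, THEN spec, THEN mp, OF m, THEN mp, OF i1,
                THEN mp, OF less_imp_le[OF c0(1)], THEN mp, OF elim(2)] .
          finally show "ennreal c \<le> pot (Q eps) (Srk (Suc r) k) one (indicator (S i)) x" .
        qed
      qed
    qed
    ultimately show ?thesis by (auto intro: exI[of _ 1])
  qed
qed

text \<open>The conditional moments in (b) and (c) are rewritten as inequalities without a
  denominator. In this form they also hold for targets of probability 0, where both sides vanish,
  and they can be added over unions of the sets \<open>S j\<close>.\<close>

lemma sojourn_moments:
  assumes c: "cond_c Q S M p tau"
  obtains C2 where "0 \<le> C2" "\<And>\<delta>. 0 < \<delta> \<Longrightarrow> \<delta> \<le> 1/2 \<Longrightarrow> eventually (\<lambda>eps. \<forall>i\<in>{1..M}. \<forall>y\<in>S i. \<forall>j\<in>{1..M}.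
      ennreal ((1 - \<delta>) * tau eps i) * kop (Q eps) (S j) one one y \<le> kop (Q eps) (S j) ennreal one y \<and>
      kop (Q eps) (S j) ennreal one y \<le> ennreal ((1 + \<delta>) * tau eps i) * kop (Q eps) (S j) one one y \<and>
      kop (Q eps) (S j) (\<lambda>t. ennreal (t\<^sup>2)) one y \<le> ennreal (C2 * (tau eps i)\<^sup>2) * kop (Q eps) (S j) one one y)
      (at_right 0)"
proof -
  obtain Cc e0 where e0: "0 < e0" and var: "\<And>eps i j x. 0 < eps \<Longrightarrow> eps \<le> e0 \<Longrightarrow> i \<in> {1..M} \<Longrightarrow> j \<in> {1..M} \<Longrightarrow>
      not_ident_zero (\<lambda>e. p e i j) \<Longrightarrow> x \<in> S i \<Longrightarrow> VarT Q eps x (S j) \<le> ennreal (Cc * (tau eps i)\<^sup>2)"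
    using c unfolding cond_c_def by blast
  \<comment> \<open>The variance contributes \<open>2 * \<bar>Cc\<bar>\<close>; the squared mean
    contributes 8, since \<open>e \<le> 2 * T\<close> gives \<open>2 * e^2 \<le> 8 * T^2\<close>.
    The absolute value is taken because the constant in (c) is not assumed nonnegative.\<close>
  define C2 where "C2 = 2 * \<bar>Cc\<bar> + 8"
  show thesis
  proof (rule that[of C2])
    show "0 \<le> C2" by (simp add: C2_def)
    fix \<delta> :: real assume \<delta>: "0 < \<delta>" "\<delta> \<le> 1/2"
    have "eventually (\<lambda>eps. \<forall>i\<in>{1..M}. \<forall>j\<in>{1..M}. not_ident_zero (\<lambda>e. p e i j) \<longrightarrow>
        (\<forall>x\<in>S i. \<bar>ET Q eps x (S j) / tau eps i - 1\<bar> < \<delta>)) (at_right 0)"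
    proof (intro eventually_ball_finite ballI finite_atLeastAtMost)
      fix i j assume ij: "i \<in> {1..M}" "j \<in> {1..M}"
      show "eventually (\<lambda>eps. not_ident_zero (\<lambda>e. p e i j) \<longrightarrow>
        (\<forall>x\<in>S i. \<bar>ET Q eps x (S j) / tau eps i - 1\<bar> < \<delta>)) (at_right 0)"
      proof (cases "not_ident_zero (\<lambda>e. p e i j)")
        case True
        have "unif_tendsto (\<lambda>eps x. ET Q eps x (S j) / tau eps i) 1 (S i)"
          using cond_b ij True unfolding cond_b_def by blast
        from unif_tendstoD[OF this \<delta>(1)] True show ?thesis by simp
      qed simp
    qed
    moreover have "eventually (\<lambda>eps. eps < e0) (at_right 0)"
      by (rule order_tendstoD(2)[OF tendsto_ident_at e0])
    ultimately show "eventually (\<lambda>eps. \<forall>i\<in>{1..M}. \<forall>y\<in>S i. \<forall>j\<in>{1..M}.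
      ennreal ((1 - \<delta>) * tau eps i) * kop (Q eps) (S j) one one y \<le> kop (Q eps) (S j) ennreal one y \<and>
      kop (Q eps) (S j) ennreal one y \<le> ennreal ((1 + \<delta>) * tau eps i) * kop (Q eps) (S j) one one y \<and>
      kop (Q eps) (S j) (\<lambda>t. ennreal (t\<^sup>2)) one y \<le> ennreal (C2 * (tau eps i)\<^sup>2) * kop (Q eps) (S j) one one y)
      (at_right 0)"
      using eventually_at_right_pos
    proof eventually_elim
      case (elim eps)
      note eps = elim(3)
      interpret renewal_kernel "Q eps" by (rule renewal_kernel[OF eps])
      show ?case
      proof (intro ballI)
        fix i y j assume i: "i \<in> {1..M}" and y: "y \<in> S i" and j: "j \<in> {1..M}"
        note [measurable] = S_measurable[OF j]
        define P where "P = Pk Q eps y (S j)"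
        define T where "T = tau eps i"
        have T: "0 < T" unfolding T_def by (rule tau_pos[OF eps i])
        have kP: "kop (Q eps) (S j) one one y = ennreal P" unfolding P_def by (rule kop_Pk[OF eps j])
        show "ennreal ((1 - \<delta>) * tau eps i) * kop (Q eps) (S j) one one y \<le> kop (Q eps) (S j) ennreal one y \<and>
          kop (Q eps) (S j) ennreal one y \<le> ennreal ((1 + \<delta>) * tau eps i) * kop (Q eps) (S j) one one y \<and>
          kop (Q eps) (S j) (\<lambda>t. ennreal (t\<^sup>2)) one y \<le> ennreal (C2 * (tau eps i)\<^sup>2) * kop (Q eps) (S j) one one y"
        proof (cases "P = 0")
          case True
          then have z: "kop (Q eps) (S j) one one y = 0" using kP by simp
          then show ?thesis by (simp add: kop_null)
        next
          case False
          have ij: "i \<noteq> j" using False Pk_diag[OF eps i y] unfolding P_def by blast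
          have "not_ident_zero (\<lambda>e. p e i j) \<and> 0 < P"
          proof (cases rule: p_cases[OF i j ij])
            case 1
            then show ?thesis using False 1(2)[OF eps y] unfolding P_def by blast
          next
            case 2
            have "p eps i j \<noteq> 0" using 2(1)[OF eps] by simp
            then show ?thesis using 2(2)[OF eps y] eps unfolding P_def not_ident_zero_def by blast
          qed
          then have nz: "not_ident_zero (\<lambda>e. p e i j)" and P: "0 < P" by auto
          have kw: "kop (Q eps) (S j) w one y = (\<integral>\<^sup>+ z. indicator (S j \<times> UNIV) z * w (snd z) \<partial>Q eps y)" for w
            unfolding kop_def by (intro nn_integral_cong) (auto simp: indicator_def split: prod.splits)
          have sq_meas: "(\<lambda>t. ennreal ((t - e')\<^sup>2)) \<in> borel_measurable borel" for e' :: real by measurable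
          have enn_lin: "ennreal a * (ennreal b * ennreal c) + ennreal d * ennreal c = ennreal ((a * b + d) * c)"
            if "0 \<le> a" "0 \<le> b" "0 \<le> c" "0 \<le> d" for a b c d
          proof -
            have "ennreal ((a * b + d) * c) = ennreal (a * (b * c) + d * c)" by (simp only: distrib_right mult.assoc)
            also have "\<dots> = ennreal (a * (b * c)) + ennreal (d * c)" using that by (intro ennreal_plus) auto
            finally show ?thesis using that by (simp only: ennreal_mult mult_nonneg_nonneg)
          qed
          define e where "e = ET Q eps y (S j)"
          have e1: "\<bar>e / T - 1\<bar> < \<delta>" using elim(1) i j nz y unfolding e_def T_def by blast
          have "1/2 < e / T" using e1 \<delta> by linarith
          then have e_pos: "0 < e" using T by (simp add: field_simps)
          have eb: "(1 - \<delta>) * T \<le> e" "e \<le> (1 + \<delta>) * T" using e1 T by (simp_all add: abs_less_iff field_simps)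
          have eN: "e = enn2real (kop (Q eps) (S j) ennreal one y) / P"
            unfolding e_def ET_def kw P_def ..
          \<comment> \<open>\<open>enn2real\<close> sends infinity to 0, so positivity of the mean,
            which follows from (b), is what shows that the integral is finite.\<close>
          have "0 < enn2real (kop (Q eps) (S j) ennreal one y)"
            using e_pos P unfolding eN by (simp add: zero_less_divide_iff)
          then have "kop (Q eps) (S j) ennreal one y \<noteq> \<infinity>" by auto
          then have N: "kop (Q eps) (S j) ennreal one y = ennreal (e * P)"
            using P unfolding eN by (simp add: less_top)
          have v: "kop (Q eps) (S j) (\<lambda>t. ennreal ((t - e)\<^sup>2)) one y / ennreal P \<le> ennreal (Cc * T\<^sup>2)"
            using var[OF eps less_imp_le[OF elim(2)] i j nz y] unfolding VarT_def kw P_def T_def e_def .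
          have X: "kop (Q eps) (S j) (\<lambda>t. ennreal ((t - e)\<^sup>2)) one y \<le> ennreal (\<bar>Cc\<bar> * T\<^sup>2) * ennreal P"
          proof -
            have "kop (Q eps) (S j) (\<lambda>t. ennreal ((t - e)\<^sup>2)) one y
                = kop (Q eps) (S j) (\<lambda>t. ennreal ((t - e)\<^sup>2)) one y / ennreal P * ennreal P"
              using P by (simp add: ennreal_divide_times mult_divide_eq_ennreal)
            also have "\<dots> \<le> ennreal (Cc * T\<^sup>2) * ennreal P" by (intro mult_right_mono v) simp
            also have "\<dots> \<le> ennreal (\<bar>Cc\<bar> * T\<^sup>2) * ennreal P"
              by (intro mult_right_mono ennreal_leI) auto
            finally show ?thesis .
          qed
          have "kop (Q eps) (S j) (\<lambda>t. ennreal (t\<^sup>2)) one y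
              \<le> kop (Q eps) (S j) (\<lambda>t. ennreal 2 * ennreal ((t - e)\<^sup>2) + ennreal (2 * e\<^sup>2) * 1) one y"
          proof (rule kop_mono)
            fix t :: real
            \<comment> \<open>Expanding this square is the inequality
              \<open>t^2 \<le> 2 * (t - e)^2 + 2 * e^2\<close>, which trades the second moment for
              variance and mean.\<close>
            have "0 \<le> (t - 2 * e)\<^sup>2" by simp
            then have "t\<^sup>2 \<le> 2 * (t - e)\<^sup>2 + 2 * e\<^sup>2" by (simp add: power2_eq_square algebra_simps)
            from ennreal_leI[OF this] have "ennreal (t\<^sup>2) \<le> ennreal (2 * (t - e)\<^sup>2 + 2 * e\<^sup>2)" .
            also have "\<dots> = ennreal (2 * (t - e)\<^sup>2) + ennreal (2 * e\<^sup>2)" by (rule ennreal_plus) auto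
            also have "ennreal (2 * (t - e)\<^sup>2) = ennreal 2 * ennreal ((t - e)\<^sup>2)" by (rule ennreal_mult) auto
            finally show "ennreal (t\<^sup>2) \<le> ennreal 2 * ennreal ((t - e)\<^sup>2) + ennreal (2 * e\<^sup>2) * 1"
              by (simp only: mult_1_right)
          qed auto
          also have "\<dots> = ennreal 2 * kop (Q eps) (S j) (\<lambda>t. ennreal ((t - e)\<^sup>2)) one y + ennreal (2 * e\<^sup>2) * ennreal P"
            unfolding kP[symmetric] kop_cmult_weight[symmetric, OF S_measurable[OF j] sq_meas borel_measurable_const]
              kop_cmult_weight[symmetric, OF S_measurable[OF j] borel_measurable_const borel_measurable_const]
            by (rule kop_add_weight) measurable
          also have "\<dots> \<le> ennreal 2 * (ennreal (\<bar>Cc\<bar> * T\<^sup>2) * ennreal P) + ennreal (2 * e\<^sup>2) * ennreal P"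
            by (intro add_mono mult_left_mono X order_refl) simp
          also have "\<dots> = ennreal ((2 * (\<bar>Cc\<bar> * T\<^sup>2) + 2 * e\<^sup>2) * P)"
            by (rule enn_lin) (use P in auto)
          also have "\<dots> \<le> ennreal (C2 * T\<^sup>2 * P)"
          proof (intro ennreal_leI mult_right_mono)
            have "e \<le> 2 * T" using eb \<delta> T mult_right_mono[of "1 + \<delta>" 2 T] by linarith
            then have "e\<^sup>2 \<le> (2 * T)\<^sup>2" using e_pos by (intro power_mono) auto
            then show "2 * (\<bar>Cc\<bar> * T\<^sup>2) + 2 * e\<^sup>2 \<le> C2 * T\<^sup>2" by (simp add: C2_def power_mult_distrib algebra_simps)
          qed (use P in simp)
          finally have sq: "kop (Q eps) (S j) (\<lambda>t. ennreal (t\<^sup>2)) one y \<le> ennreal (C2 * T\<^sup>2) * ennreal P"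
            by (subst ennreal_mult[symmetric]) (use P in \<open>auto simp: C2_def\<close>)
          have "ennreal ((1 - \<delta>) * T) * ennreal P \<le> ennreal (e * P)" "ennreal (e * P) \<le> ennreal ((1 + \<delta>) * T) * ennreal P"
            using eb P T \<delta>
            by (simp_all add: ennreal_mult[symmetric] ennreal_leI mult_right_mono del: ennreal_le_iff)
          then show ?thesis using sq unfolding kP N T_def by simp
        qed
      qed
    qed
  qed
qed

end

section \<open>The exponential limit\<close>

context renewal_hierarchy
begin

lemma tail_limit:
  assumes c: "cond_c Q S M p tau" and r: "r < R" and k: "k \<in> {1..Mh r}"
    and multi: "\<forall>i\<in>{1..M}. Srk r k \<noteq> S i" and tauk: "\<And>eps. 0 < eps \<Longrightarrow> 0 < tauk eps"
    and hyp: "\<forall>\<delta>>0. eventually (\<lambda>eps. \<forall>x\<in>Srk r k.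
            (let s = (\<Sum>i\<in>{i\<in>{1..M}. S i \<subseteq> Srk r k}.
                        ennreal (tau eps i) * expected_visits (Q eps) x (Srk r k) (S i))
             in s \<noteq> \<infinity> \<and> \<bar>enn2real s / tauk eps - 1\<bar> < \<delta>)) (at_right 0)"
    and t: "0 \<le> t" and l: "l \<in> {1..Mh r}" and nz: "not_ident_zero (\<lambda>eps. Ph r eps k l)"
  shows "unif_tendsto (\<lambda>eps x. exit_time_tail (Q eps) x (Srk r k) (Srk r l) (tauk eps) t)
             (exp (- t)) (Srk r k)"
proof -
  interpret h: hierarchy_step M p tau "Mh r" "Ph r" "Mh (Suc r)" "Eh r" "lamh r" "Ph (Suc r)"
    by (rule hierarchy_step[OF r])
  note part = Sr_partition[OF r]
  define C where "C = Srk r k"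
  define D where "D = Srk r l"
  \<comment> \<open>\<open>J\<close> is the index set of the hypothesis on \<open>tauk\<close>,
    \<open>Ck\<close> that of the hierarchy. \<open>J\<close> can be larger, as an empty
    \<open>S i\<close> is contained in every cluster.\<close>
  define J where "J = {i\<in>{1..M}. S i \<subseteq> C}"
  define Ck where "Ck = cl Eh r k"
  define h0 where "h0 eps = Ph r eps k l" for eps
  have C[measurable]: "C \<in> sets borel" and D[measurable]: "D \<in> sets borel"
    unfolding C_def D_def using part(1) k l by auto
  obtain e' where e': "0 < e'" "Ph r e' k l \<noteq> 0" using nz unfolding not_ident_zero_def by blast
  have lk: "l \<noteq> k" using e' h.diag_Pr[OF e'(1) k] by blast
  have h0: "0 < h0 eps" if "0 < eps" for eps
    unfolding h0_def using regular_pos[OF zreg_regularI[OF h.zreg_Pr[OF k l] e'] that] .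
  have DC: "D \<inter> C = {}" unfolding C_def D_def using disjoint_family_onD[OF part(2) l k lk] .
  have JM: "J \<subseteq> {1..M}" by (auto simp: J_def)
  have finJ: "finite J" using JM finite_subset by blast
  have CkJ: "Ck \<subseteq> J" using cl_subset(1)[OF r k] by (auto simp: J_def Ck_def C_def Sr_def)
  have CkM: "Ck \<subseteq> {1..M}" using cl_subset(1)[OF r k] by (simp add: Ck_def)
  have CU: "C = (\<Union>i\<in>Ck. S i)" by (simp add: C_def Ck_def Sr_def)
  have DU: "D = (\<Union>j\<in>cl Eh r l. S j)" by (simp add: D_def Sr_def)
  have lM: "cl Eh r l \<subseteq> {1..M}" by (rule cl_subset(1)[OF r l])
  have disj: "S i \<inter> S j = {}" if "i \<in> {1..M}" "j \<in> {1..M}" "i \<noteq> j" for i j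
    by (rule disjoint_family_onD[OF S_disjoint that])
  have mCU: "- C = (\<Union>j\<in>{1..M} - Ck. S j)"
  proof (intro equalityI subsetI)
    fix y assume y: "y \<in> - C"
    have "y \<in> (\<Union>i\<in>{1..M}. S i)" unfolding S_cover by simp
    then obtain j where "j \<in> {1..M}" "y \<in> S j" by blast
    then show "y \<in> (\<Union>j\<in>{1..M} - Ck. S j)" using y unfolding CU by blast
  next
    fix y assume "y \<in> (\<Union>j\<in>{1..M} - Ck. S j)"
    then obtain j where j: "j \<in> {1..M}" "j \<notin> Ck" "y \<in> S j" by blast
    show "y \<in> - C"
    proof
      assume "y \<in> C"
      then obtain i where i: "i \<in> Ck" "y \<in> S i" unfolding CU by blast
      have "i \<noteq> j" using i j by blast
      from disj[OF subsetD[OF CkM i(1)] j(1) this] i j show False by blast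
    qed
  qed
  have not_single: "\<forall>i. cl Eh r k \<noteq> {i}"
  proof (intro allI notI)
    fix i assume i: "cl Eh r k = {i}"
    then have "i \<in> {1..M}" "Srk r k = S i" using cl_subset(1)[OF r k] by (auto simp: Sr_def)
    then show False using multi by blast
  qed
  \<comment> \<open>The mean sojourn as a function of the state. Its potential is the sum in the
    hypothesis on \<open>tauk\<close>, that is, the approximate mean exit time
    \<open>m\<close>.\<close>
  define tf where "tf eps y = (\<Sum>i\<in>J. tau eps i * indicator (S i) y)" for eps y
  have tf_meas[measurable]: "tf eps \<in> borel_measurable borel" for eps
    unfolding tf_def using S_measurable JM by (intro borel_measurable_sum borel_measurable_times) auto
  have tf0: "0 \<le> tf eps y" if "0 < eps" for eps y
    unfolding tf_def
    by (intro sum_nonneg mult_nonneg_nonneg less_imp_le[OF tau_pos[OF that subsetD[OF JM]]]) auto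
  have tf_eq: "tf eps y = tau eps i" if i: "i \<in> Ck" "y \<in> S i" for eps y i
  proof -
    have "tf eps y = (\<Sum>j\<in>J. if j = i then tau eps i else 0)"
      unfolding tf_def
    proof (rule sum.cong[OF refl])
      fix j assume j: "j \<in> J"
      have "y \<notin> S j" if "j \<noteq> i"
        using disj[OF subsetD[OF JM j] subsetD[OF CkM i(1)] that] i(2) by blast
      then show "tau eps j * indicator (S j) y = (if j = i then tau eps i else 0)"
        using i(2) by auto
    qed
    also have "\<dots> = tau eps i" using finJ CkJ i(1) by (auto simp: sum.delta)
    finally show ?thesis .
  qed
  have pot_tf: "pot (Q eps) C one (\<lambda>y. ennreal (tf eps y)) x =
      (\<Sum>i\<in>J. ennreal (tau eps i) * expected_visits (Q eps) x C (S i))" if eps: "0 < eps" for eps x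
  proof -
    interpret renewal_kernel "Q eps" by (rule renewal_kernel[OF eps])
    have Sm[measurable]: "\<And>i. i \<in> J \<Longrightarrow> S i \<in> sets borel" using S_measurable JM by blast
    have "(\<lambda>y. ennreal (tf eps y)) = (\<lambda>y. \<Sum>i\<in>J. ennreal (tau eps i) * indicator (S i) y)"
    proof
      fix y
      have "ennreal (tf eps y) = (\<Sum>i\<in>J. ennreal (tau eps i * indicator (S i) y))"
        unfolding tf_def
        by (intro sum_ennreal[symmetric] mult_nonneg_nonneg less_imp_le[OF tau_pos[OF eps subsetD[OF JM]]]) auto
      also have "\<dots> = (\<Sum>i\<in>J. ennreal (tau eps i) * indicator (S i) y)"
        by (intro sum.cong refl) (auto simp: indicator_def)
      finally show "ennreal (tf eps y) = (\<Sum>i\<in>J. ennreal (tau eps i) * indicator (S i) y)" .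
    qed
    then have "pot (Q eps) C one (\<lambda>y. ennreal (tf eps y)) x
        = pot (Q eps) C one (\<lambda>y. \<Sum>i\<in>J. ennreal (tau eps i) * indicator (S i) y) x" by simp
    also have "\<dots> = (\<Sum>i\<in>J. pot (Q eps) C one (\<lambda>y. ennreal (tau eps i) * indicator (S i) y) x)"
      by (rule pot_sum[OF finJ]) (auto intro!: borel_measurable_times Sm)
    also have "\<dots> = (\<Sum>i\<in>J. ennreal (tau eps i) * expected_visits (Q eps) x C (S i))"
      by (intro sum.cong refl) (auto simp: pot_cmult expected_visits_eq Sm)
    finally show ?thesis .
  qed
  have m_ev: "eventually (\<lambda>eps. \<forall>x\<in>C. ennreal ((1 - \<delta>) * tauk eps) \<le> pot (Q eps) C one (\<lambda>y. ennreal (tf eps y)) x \<and>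
      pot (Q eps) C one (\<lambda>y. ennreal (tf eps y)) x \<le> ennreal ((1 + \<delta>) * tauk eps)) (at_right 0)" if \<delta>: "0 < \<delta>" for \<delta>
    using hyp[THEN spec, THEN mp, OF \<delta>, folded C_def, folded J_def] eventually_at_right_pos
  proof eventually_elim
    case (elim eps)
    show ?case
    proof
      fix x assume x: "x \<in> C"
      define s where "s = pot (Q eps) C one (\<lambda>y. ennreal (tf eps y)) x"
      have s: "s \<noteq> \<infinity>" "\<bar>enn2real s / tauk eps - 1\<bar> < \<delta>"
        using elim(1)[THEN bspec, OF x] unfolding Let_def pot_tf[OF elim(2), symmetric] s_def by auto
      have "(1 - \<delta>) * tauk eps \<le> enn2real s" "enn2real s \<le> (1 + \<delta>) * tauk eps"
        using s(2) tauk[OF elim(2)] by (simp_all add: abs_less_iff field_simps)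
      then have "ennreal ((1 - \<delta>) * tauk eps) \<le> ennreal (enn2real s)" "ennreal (enn2real s) \<le> ennreal ((1 + \<delta>) * tauk eps)"
        by (auto intro: ennreal_leI)
      moreover have "ennreal (enn2real s) = s" using s(1) by (simp add: less_top)
      ultimately show "ennreal ((1 - \<delta>) * tauk eps) \<le> pot (Q eps) C one (\<lambda>y. ennreal (tf eps y)) x \<and>
        pot (Q eps) C one (\<lambda>y. ennreal (tf eps y)) x \<le> ennreal ((1 + \<delta>) * tauk eps)" unfolding s_def by simp
    qed
  qed
  \<comment> \<open>At fixed \<open>eps\<close> every step costs at least the smallest
    \<open>tau eps i\<close>, while the total is at most \<open>2 * tauk eps\<close>; so the
    expected number of steps is bounded.\<close>
  have bounded: "pot_bounded r k"
    unfolding pot_bounded_def C_def[symmetric] using m_ev[of 1, OF zero_less_one] eventually_at_right_pos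
  proof eventually_elim
    case (elim eps)
    interpret renewal_kernel "Q eps" by (rule renewal_kernel[OF elim(2)])
    define tm where "tm = Min (tau eps ` {1..M})"
    have ne: "{1..M} \<noteq> {}" using M_pos by auto
    have tm: "0 < tm" "\<And>i. i \<in> {1..M} \<Longrightarrow> tm \<le> tau eps i"
      unfolding tm_def using ne tau_pos[OF elim(2)] by auto
    have "pot (Q eps) C one one x \<le> ennreal (1 / tm * (2 * tauk eps))" if x: "x \<in> C" for x
    proof -
      have "pot (Q eps) C one one x \<le> pot (Q eps) C one (\<lambda>y. ennreal (1 / tm) * ennreal (tf eps y)) x"
      proof (rule pot_mono)
        fix y assume y: "y \<in> C"
        then obtain i where i: "i \<in> Ck" "y \<in> S i" unfolding CU by blast
        have "1 \<le> 1 / tm * tf eps y" unfolding tf_eq[OF i] using tm(1) tm(2)[OF subsetD[OF CkM i(1)]] by simp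
        then have "ennreal 1 \<le> ennreal (1 / tm * tf eps y)" by (rule ennreal_leI)
        also have "\<dots> = ennreal (1 / tm) * ennreal (tf eps y)" using tm(1) tf0[OF elim(2)] by (intro ennreal_mult) auto
        finally show "y \<in> C \<and> 1 \<le> ennreal (1 / tm) * ennreal (tf eps y)" using y by simp
      qed (use x in auto)
      also have "\<dots> = ennreal (1 / tm) * pot (Q eps) C one (\<lambda>y. ennreal (tf eps y)) x"
        by (rule pot_cmult) measurable
      also have "\<dots> \<le> ennreal (1 / tm) * ennreal (2 * tauk eps)"
        using elim(1) x by (intro mult_left_mono) auto
      also have "\<dots> = ennreal (1 / tm * (2 * tauk eps))"
        using tm(1) tauk[OF elim(2)] by (intro ennreal_mult[symmetric]) auto
      finally show ?thesis .
    qed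
    then show ?case by blast
  qed
  have ex: "exit_asymp r k" and vis: "\<And>i c. i \<in> Ck \<Longrightarrow> visits_ge r k i c"
    using rank_asymptotics[OF r k bounded] not_single unfolding Ck_def by blast+
  \<comment> \<open>Once \<open>S i\<close> is visited at least \<open>2 / \<delta>\<close> times on
    average, its share \<open>tau eps i * (2 / \<delta>)\<close> cannot exceed the total, which is
    at most \<open>2 * tauk eps\<close>.\<close>
  have small: "eventually (\<lambda>eps. \<forall>x\<in>C. \<forall>i\<in>Ck. tau eps i \<le> \<delta> * tauk eps) (at_right 0)" if \<delta>: "0 < \<delta>" for \<delta>
  proof -
    have finC: "finite Ck" using CkM finite_subset by blast
    have "eventually (\<lambda>eps. \<forall>i\<in>Ck. \<forall>x\<in>C. ennreal (2 / \<delta>) \<le> pot (Q eps) C one (indicator (S i)) x) (at_right 0)"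
      using vis[unfolded visits_ge_def, folded C_def]
      by (intro eventually_ball_finite[OF finC] ballI) blast
    then show ?thesis using m_ev[of 1, OF zero_less_one] eventually_at_right_pos
    proof eventually_elim
      case (elim eps)
      interpret renewal_kernel "Q eps" by (rule renewal_kernel[OF elim(3)])
      show ?case
      proof (intro ballI)
        fix x i assume x: "x \<in> C" and i: "i \<in> Ck"
        have iM: "i \<in> {1..M}" using i CkM by blast
        note [measurable] = S_measurable[OF iM]
        have tp: "0 < tau eps i" by (rule tau_pos[OF elim(3) iM])
        have "ennreal (tau eps i * (2 / \<delta>)) = ennreal (tau eps i) * ennreal (2 / \<delta>)"
          using tp \<delta> by (intro ennreal_mult) auto
        also have "\<dots> \<le> ennreal (tau eps i) * pot (Q eps) C one (indicator (S i)) x"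
          using elim(1) i x by (intro mult_left_mono) auto
        also have "\<dots> = pot (Q eps) C one (\<lambda>y. ennreal (tau eps i) * indicator (S i) y) x"
          by (rule pot_cmult[symmetric]) measurable
        also have "\<dots> \<le> pot (Q eps) C one (\<lambda>y. ennreal (tf eps y)) x"
          by (rule pot_mono) (use x tf_eq[OF i] in \<open>auto simp: indicator_def\<close>)
        also have "\<dots> \<le> ennreal (2 * tauk eps)" using elim(2) x by simp
        finally have "tau eps i * (2 / \<delta>) \<le> 2 * tauk eps"
          using tauk[OF elim(3)] by (subst (asm) ennreal_le_iff) auto
        then show "tau eps i \<le> \<delta> * tauk eps" using \<delta> by (simp add: field_simps)
      qed
    qed
  qed
  obtain C2 where C2: "0 \<le> C2" and mom: "\<And>\<delta>. 0 < \<delta> \<Longrightarrow> \<delta> \<le> 1/2 \<Longrightarrow> eventually (\<lambda>eps. \<forall>i\<in>{1..M}. \<forall>y\<in>S i. \<forall>j\<in>{1..M}.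
      ennreal ((1 - \<delta>) * tau eps i) * kop (Q eps) (S j) one one y \<le> kop (Q eps) (S j) ennreal one y \<and>
      kop (Q eps) (S j) ennreal one y \<le> ennreal ((1 + \<delta>) * tau eps i) * kop (Q eps) (S j) one one y \<and>
      kop (Q eps) (S j) (\<lambda>t. ennreal (t\<^sup>2)) one y \<le> ennreal (C2 * (tau eps i)\<^sup>2) * kop (Q eps) (S j) one one y)
      (at_right 0)"
    using sojourn_moments[OF c] by blast
  define w where "w eps n s = ennreal (exp (- (real n * s / tauk eps)))" for eps and n :: nat and s
  have wm[measurable]: "w eps n \<in> borel_measurable borel" for eps n unfolding w_def by measurable
  \<comment> \<open>The range of admissible \<open>eps\<close> depends on \<delta> alone and serves
    all \<open>n\<close> at once; the growth in \<open>n\<close> sits in the constant in front of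
    \<delta>.\<close>
  have key: "eventually (\<lambda>eps. \<forall>x\<in>C. \<forall>n.
      \<bar>enn2real (exit_functional (Q eps) x C D (w eps n)) / h0 eps - 1 / (1 + real n)\<bar>
        \<le> (2 + 20 * real n + 2 * (real n)\<^sup>2 * C2) * \<delta> \<and>
      exit_functional (Q eps) x C D (w eps n) < \<infinity>) (at_right 0)" if \<delta>: "0 < \<delta>" "\<delta> \<le> 1/2" for \<delta>
  proof -
    have d1: "\<delta> < 1" using \<delta> by simp
    have "eventually (\<lambda>eps. \<forall>x\<in>C. ennreal ((1 - \<delta>) * h0 eps) \<le> pot (Q eps) C one (kop (Q eps) D one one) x \<and>
        pot (Q eps) C one (kop (Q eps) D one one) x \<le> ennreal ((1 + \<delta>) * h0 eps)) (at_right 0)"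
      using ex[unfolded exit_asymp_def, THEN bspec, OF l, THEN mp, OF lk, THEN spec, THEN mp, OF \<delta>(1), THEN mp, OF d1]
      unfolding C_def D_def h0_def .
    then show ?thesis
      using m_ev[OF \<delta>(1)] small[OF \<delta>(1)] mom[OF \<delta>] bounded[unfolded pot_bounded_def, folded C_def]
        eventually_at_right_pos
    proof eventually_elim
      case (elim eps)
      note eps = elim(6)
      interpret renewal_kernel "Q eps" by (rule renewal_kernel[OF eps])
      obtain B where B: "\<forall>x\<in>C. pot (Q eps) C one one x \<le> ennreal B" using elim(5) by blast
      \<comment> \<open>Stated for arbitrary unions of the sets \<open>S j\<close>, because it is
        needed for \<open>D\<close>, for the complement of \<open>C\<close> and for the whole
        space.\<close>
      have mean: "ennreal ((1 - \<delta>) * tf eps y) * kop (Q eps) (\<Union>j\<in>I. S j) one one y \<le> kop (Q eps) (\<Union>j\<in>I. S j) ennreal one y"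
        "kop (Q eps) (\<Union>j\<in>I. S j) ennreal one y \<le> ennreal ((1 + \<delta>) * tf eps y) * kop (Q eps) (\<Union>j\<in>I. S j) one one y"
        "kop (Q eps) (\<Union>j\<in>I. S j) (\<lambda>t. ennreal (t\<^sup>2)) one y \<le> ennreal (C2 * (tf eps y)\<^sup>2) * kop (Q eps) (\<Union>j\<in>I. S j) one one y"
        if I: "I \<subseteq> {1..M}" and y: "y \<in> C" for I y
      proof -
        obtain i where i: "i \<in> Ck" "y \<in> S i" using y unfolding CU by blast
        have fI: "finite I" using I finite_subset by blast
        have dI: "disjoint_family_on S I" by (rule disjoint_family_on_mono[OF I S_disjoint])
        have mI: "\<And>j. j \<in> I \<Longrightarrow> S j \<in> sets borel" using I S_measurable by blast
        have U: "kop (Q eps) (\<Union>j\<in>I. S j) v one y = (\<Sum>j\<in>I. kop (Q eps) (S j) v one y)"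
          if "v \<in> borel_measurable borel" for v
          by (rule kop_UN[OF fI dI]) (use mI that in auto)
        have e: "ennreal ((1 - \<delta>) * tf eps y) * kop (Q eps) (S j) one one y \<le> kop (Q eps) (S j) ennreal one y"
          "kop (Q eps) (S j) ennreal one y \<le> ennreal ((1 + \<delta>) * tf eps y) * kop (Q eps) (S j) one one y"
          "kop (Q eps) (S j) (\<lambda>t. ennreal (t\<^sup>2)) one y \<le> ennreal (C2 * (tf eps y)\<^sup>2) * kop (Q eps) (S j) one one y"
          if "j \<in> I" for j
          using elim(4)[THEN bspec, OF subsetD[OF CkM i(1)], THEN bspec, OF i(2), THEN bspec, OF subsetD[OF I that]]
          unfolding tf_eq[OF i] by auto
        show "ennreal ((1 - \<delta>) * tf eps y) * kop (Q eps) (\<Union>j\<in>I. S j) one one y \<le> kop (Q eps) (\<Union>j\<in>I. S j) ennreal one y"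
          by (simp add: U sum_distrib_left e sum_mono)
        show "kop (Q eps) (\<Union>j\<in>I. S j) ennreal one y \<le> ennreal ((1 + \<delta>) * tf eps y) * kop (Q eps) (\<Union>j\<in>I. S j) one one y"
          by (simp add: U sum_distrib_left e sum_mono)
        show "kop (Q eps) (\<Union>j\<in>I. S j) (\<lambda>t. ennreal (t\<^sup>2)) one y \<le> ennreal (C2 * (tf eps y)\<^sup>2) * kop (Q eps) (\<Union>j\<in>I. S j) one one y"
          by (simp add: U sum_distrib_left e sum_mono)
      qed
      note mean_D = mean(2)[OF lM, folded DU]
      note mean_mC = mean(2)[of "{1..M} - Ck", folded mCU]
      note mean_UNIV = mean[OF order_refl, unfolded S_cover kop_UNIV_one mult_1_right]
      show ?case
      proof (intro ballI allI)
        fix x and n :: nat assume x: "x \<in> C"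
        have tfs: "tf eps y \<le> \<delta> * tauk eps" if y: "y \<in> C" for y
        proof -
          obtain i where i: "i \<in> Ck" "y \<in> S i" using y unfolding CU by blast
          show ?thesis using elim(3) y i(1) unfolding tf_eq[OF i] by blast
        qed
        have le2: "ennreal ((1 + \<delta>) * tf eps y) \<le> ennreal (2 * \<delta> * tauk eps)" if "y \<in> C" for y
        proof (rule ennreal_leI)
          have "(1 + \<delta>) * tf eps y \<le> 2 * (\<delta> * tauk eps)"
            using \<delta> tf0[OF eps] tfs[OF that] by (intro mult_mono) auto
          then show "(1 + \<delta>) * tf eps y \<le> 2 * \<delta> * tauk eps" by simp
        qed
        have fin: "pot (Q eps) C one one x < \<infinity>" by (rule le_less_trans[OF B[THEN bspec, OF x]]) simp
        have ef: "exit_functional (Q eps) x C D (w eps n) = pot (Q eps) C (w eps n) (kop (Q eps) D (w eps n) one) x"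
        proof (rule exit_functional_laplace[OF C D wm])
          show "w eps n 0 = 1" by (simp add: w_def)
          show "w eps n (s + t) = w eps n s * w eps n t" for s t
            unfolding w_def
            by (subst ennreal_mult[symmetric]) (auto simp: exp_add[symmetric] add_divide_distrib distrib_left)
        qed
        have hlo: "ennreal ((1 - \<delta>) * h0 eps) \<le> pot (Q eps) C one (kop (Q eps) D one one) y"
          and hhi: "pot (Q eps) C one (kop (Q eps) D one one) y \<le> ennreal ((1 + \<delta>) * h0 eps)"
          and mlo: "ennreal ((1 - \<delta>) * tauk eps) \<le> pot (Q eps) C one (\<lambda>y. ennreal (tf eps y)) y"
          and mhi: "pot (Q eps) C one (\<lambda>y. ennreal (tf eps y)) y \<le> ennreal ((1 + \<delta>) * tauk eps)" if "y \<in> C" for y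
          using elim(1,2) that by blast+
        have mD: "kop (Q eps) D ennreal one y \<le> ennreal (2 * \<delta> * tauk eps) * kop (Q eps) D one one y" if "y \<in> C" for y
          by (rule order_trans[OF mean_D[OF that] mult_right_mono[OF le2[OF that]]]) simp
        have mC: "kop (Q eps) (- C) ennreal one y \<le> ennreal (2 * \<delta> * tauk eps) * kop (Q eps) (- C) one one y" if "y \<in> C" for y
          by (rule order_trans[OF mean_mC[OF _ that] mult_right_mono[OF le2[OF that]]]) auto
        have sqb: "kop (Q eps) UNIV (\<lambda>t. ennreal (t\<^sup>2)) one y \<le> ennreal (C2 * \<delta> * tauk eps * tf eps y)" if "y \<in> C" for y
        proof (rule order_trans[OF mean_UNIV(3)[OF that] ennreal_leI])
          have "C2 * (tf eps y * tf eps y) \<le> C2 * (\<delta> * tauk eps * tf eps y)"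
            using C2 tf0[OF eps] tfs[OF that] by (intro mult_left_mono mult_right_mono) auto
          then show "C2 * (tf eps y)\<^sup>2 \<le> C2 * \<delta> * tauk eps * tf eps y" by (simp add: power2_eq_square mult.assoc)
        qed
        note est = exit_laplace_estimate[of C D "tf eps" "real n" \<delta> C2 "tauk eps" "h0 eps" x, folded w_def,
            OF C D tf_meas tf0[OF eps] of_nat_0_le_iff \<delta>(1) less_imp_le[OF d1] C2 tauk[OF eps] h0[OF eps] fin x
              hlo hhi mlo mhi mD mC mean_UNIV(1) mean_UNIV(2) sqb]
        show "\<bar>enn2real (exit_functional (Q eps) x C D (w eps n)) / h0 eps - 1 / (1 + real n)\<bar>
            \<le> (2 + 20 * real n + 2 * (real n)\<^sup>2 * C2) * \<delta> \<and>
          exit_functional (Q eps) x C D (w eps n) < \<infinity>"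
          unfolding ef using est by blast
      qed
    qed
  qed
  \<comment> \<open>Both functionals are divided by \<open>h0\<close>, which does not depend on
    \<open>x\<close>, so that the moments converge to those of the uniform law. The moment of order
    0 is the exit probability relative to \<open>h0\<close>, and dividing by it at the end gives the
    conditional law.\<close>
  define \<mu> where "\<mu> n eps x = enn2real (exit_functional (Q eps) x C D (w eps n)) / h0 eps" for n eps x
  define F where "F eps x = enn2real (exit_functional (Q eps) x C D (indicator {s. t \<le> s / tauk eps})) / h0 eps" for eps x
  have mu: "unif_tendsto (\<mu> n) (1 / (real n + 1)) C" for n
    unfolding unif_tendsto_def
  proof (intro allI impI)
    fix \<rho> :: real assume \<rho>: "0 < \<rho>"
    define A where "A = 2 + 20 * real n + 2 * (real n)\<^sup>2 * C2"
    have A: "0 < A" using C2 unfolding A_def by (simp add: add_pos_nonneg)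
    define \<delta> where "\<delta> = min (1/2) (\<rho> / (2 * A))"
    have \<delta>: "0 < \<delta>" "\<delta> \<le> 1/2" unfolding \<delta>_def using \<rho> A by (simp, intro min.cobounded1)
    have "A * \<delta> \<le> A * (\<rho> / (2 * A))" using A unfolding \<delta>_def by (intro mult_left_mono) auto
    also have "\<dots> < \<rho>" using A \<rho> by simp
    finally have A\<delta>: "A * \<delta> < \<rho>" .
    show "eventually (\<lambda>eps. \<forall>x\<in>C. \<bar>\<mu> n eps x - 1 / (real n + 1)\<bar> < \<rho>) (at_right 0)"
      using key[OF \<delta>]
    proof eventually_elim
      case (elim eps)
      show ?case
      proof
        fix x assume "x \<in> C"
        then have "\<bar>\<mu> n eps x - 1 / (1 + real n)\<bar> \<le> A * \<delta>" using elim unfolding \<mu>_def A_def by blast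
        then show "\<bar>\<mu> n eps x - 1 / (real n + 1)\<bar> < \<rho>" using A\<delta> by (simp add: add.commute)
      qed
    qed
  qed
  have half: "0 < (1/2::real)" "(1/2::real) \<le> 1/2" by auto
  \<comment> \<open>Any admissible \<delta>, here 1/2, will do: only the finiteness half of
    \<open>key\<close> enters, uniformly in \<open>x\<close> and in the order of the moment.\<close>
  have poly: "eventually (\<lambda>eps. \<forall>x\<in>C. ((\<forall>v\<in>{0..1}. indicator {..exp (- t)} v \<le> (\<Sum>i\<le>N. a i * v ^ i)) \<longrightarrow>
        F eps x \<le> (\<Sum>i\<le>N. a i * \<mu> i eps x)) \<and>
      ((\<forall>v\<in>{0..1}. (\<Sum>i\<le>N. a i * v ^ i) \<le> indicator {..exp (- t)} v) \<longrightarrow>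
        (\<Sum>i\<le>N. a i * \<mu> i eps x) \<le> F eps x)) (at_right 0)" for a :: "nat \<Rightarrow> real" and N
    using key[OF half] eventually_at_right_pos
  proof eventually_elim
    case (elim eps)
    interpret renewal_kernel "Q eps" by (rule renewal_kernel[OF elim(2)])
    show ?case
    proof
      fix x assume x: "x \<in> C"
      have fin: "exit_functional (Q eps) x C D (w eps n) < \<infinity>" for n using elim(1) x by blast
      note b = exit_functional_polynomial_bounds[OF C D tauk[OF elim(2)] fin[unfolded w_def], folded w_def, where a=a and N=N and t=t]
      have s: "(\<Sum>i\<le>N. a i * \<mu> i eps x) = (\<Sum>i\<le>N. a i * enn2real (exit_functional (Q eps) x C D (w eps i))) / h0 eps"
        by (simp add: \<mu>_def sum_divide_distrib)
      show "((\<forall>v\<in>{0..1}. indicator {..exp (- t)} v \<le> (\<Sum>i\<le>N. a i * v ^ i)) \<longrightarrow>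
          F eps x \<le> (\<Sum>i\<le>N. a i * \<mu> i eps x)) \<and>
        ((\<forall>v\<in>{0..1}. (\<Sum>i\<le>N. a i * v ^ i) \<le> indicator {..exp (- t)} v) \<longrightarrow>
          (\<Sum>i\<le>N. a i * \<mu> i eps x) \<le> F eps x)"
        unfolding s F_def
        by (intro conjI impI divide_right_mono less_imp_le[OF h0[OF elim(2)]] b) blast+
    qed
  qed
  have "unif_tendsto F (exp (- t)) C"
  proof (rule unif_tendsto_of_uniform_moments[OF mu])
    fix a :: "nat \<Rightarrow> real" and N
    show "eventually (\<lambda>eps. \<forall>x\<in>C. F eps x \<le> (\<Sum>i\<le>N. a i * \<mu> i eps x)) (at_right 0)"
      if "\<And>v. v \<in> {0..1} \<Longrightarrow> indicator {..exp (- t)} v \<le> (\<Sum>i\<le>N. a i * v ^ i)"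
      using poly[of a N] by eventually_elim (use that in blast)
    show "eventually (\<lambda>eps. \<forall>x\<in>C. (\<Sum>i\<le>N. a i * \<mu> i eps x) \<le> F eps x) (at_right 0)"
      if "\<And>v. v \<in> {0..1} \<Longrightarrow> (\<Sum>i\<le>N. a i * v ^ i) \<le> indicator {..exp (- t)} v"
      using poly[of a N] by eventually_elim (use that in blast)
  qed (use t in auto)
  then have lim: "unif_tendsto (\<lambda>eps x. F eps x / \<mu> 0 eps x) (exp (- t)) C"
    by (rule unif_tendsto_divide_one) (use mu[of 0] in simp)
  have tail: "F eps x / \<mu> 0 eps x = exit_time_tail (Q eps) x C D (tauk eps) t" if eps: "0 < eps" for eps x
  proof -
    interpret renewal_kernel "Q eps" by (rule renewal_kernel[OF eps])
    have w0: "w eps 0 = indicator UNIV" by (simp add: w_def fun_eq_iff)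
    have [measurable]: "{s. s / tauk eps \<ge> t} \<in> sets borel" by measurable
    show ?thesis
      unfolding exit_time_tail_def F_def \<mu>_def w0
      by (subst exit_prob_eq[OF D _ DC], measurable, subst exit_prob_eq[OF D _ DC])
         (use h0[OF eps] in simp_all)
  qed
  show ?thesis
    unfolding C_def[symmetric] D_def[symmetric] unif_tendsto_def
  proof (intro allI impI)
    fix \<rho> :: real assume "0 < \<rho>"
    from unif_tendstoD[OF lim this] eventually_at_right_pos
    show "eventually (\<lambda>eps. \<forall>x\<in>C. \<bar>exit_time_tail (Q eps) x C D (tauk eps) t - exp (- t)\<bar> < \<rho>) (at_right 0)"
      by eventually_elim (simp add: tail)
  qed
qed

end

theorem theorem6p5:
  fixes Q :: "'a::metric_space kernels"
    and S :: "nat \<Rightarrow> 'a set" and M :: nat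
    and p :: "real \<Rightarrow> nat \<Rightarrow> nat \<Rightarrow> real" and tau :: "real \<Rightarrow> nat \<Rightarrow> real"
    and Mh :: "nat \<Rightarrow> nat" and Ph :: "nat \<Rightarrow> real \<Rightarrow> nat \<Rightarrow> nat \<Rightarrow> real"
    and Eh :: "nat \<Rightarrow> nat \<Rightarrow> nat set" and lamh :: "nat \<Rightarrow> nat \<Rightarrow> nat \<Rightarrow> real" and R :: nat
    and r k :: nat and tauk :: "real \<Rightarrow> real"
  assumes "base_ok Q S M"
    and "cond_a Q S M p" and "cond_b Q S M p tau" and "cond_c Q S M p tau"
    and "cond_d Q S M p tau" and "cond_e Q S M p tau" and "cond_f M p tau"
    and "hierarchy M p Mh Ph Eh lamh R"
    and "1 \<le> r" and "r < R" and "k \<in> {1..Mh r}"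
    and "\<forall>i\<in>{1..M}. Sr S Eh r k \<noteq> S i"
    and "\<forall>eps>0. tauk eps > 0"
    and "\<forall>\<delta>>0. eventually (\<lambda>eps. \<forall>x\<in>Sr S Eh r k.
            (let s = (\<Sum>i\<in>{i\<in>{1..M}. S i \<subseteq> Sr S Eh r k}.
                        ennreal (tau eps i) * expected_visits (Q eps) x (Sr S Eh r k) (S i))
             in s \<noteq> \<infinity> \<and> \<bar>enn2real s / tauk eps - 1\<bar> < \<delta>)) (at_right 0)"
  shows "\<forall>t\<ge>0. \<forall>l\<in>{1..Mh r}. not_ident_zero (\<lambda>eps. Ph r eps k l) \<longrightarrow>
           unif_tendsto (\<lambda>eps x. exit_time_tail (Q eps) x (Sr S Eh r k) (Sr S Eh r l) (tauk eps) t)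
             (exp (- t)) (Sr S Eh r k)"
proof (intro allI impI ballI)
  fix t :: real and l assume tl: "0 \<le> t" "l \<in> {1..Mh r}" "not_ident_zero (\<lambda>eps. Ph r eps k l)"
  interpret renewal_hierarchy Q S M p tau Mh Ph Eh lamh R
    by (intro renewal_hierarchy.intro; fact assms)
  show "unif_tendsto (\<lambda>eps x. exit_time_tail (Q eps) x (Sr S Eh r k) (Sr S Eh r l) (tauk eps) t)
             (exp (- t)) (Sr S Eh r k)"
    using assms(13) by (intro tail_limit[OF assms(4,10,11,12) _ assms(14) tl]) blast
qed

end
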